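(* Provably in ZFC, the following three statements are equivalent: $\mathbf{Det}(\Sigma^1_1)$; $\mathbf{Det}(\mathbf{CFL}_\omega)$; $\mathbf{Det}(\mathbf{BCL}(1)_\omega)$. That is: every Gale–Stewart game with an effective analytic winning set is determined iff every Gale–Stewart game whose winning set is accepted by a Büchi pushdown automaton is determined iff every Gale–Stewart game whose winning set is accepted by a Büchi $1$-counter automaton is determined.
   Context: All alphabets are finite. Gale–Stewart game: for $A\subseteq X^\omega$, in $G(A)$ Players 1 and 2 alternately write letters of $X$ (Player 1 first), producing $x=a_1b_1a_2b_2\cdots$; Player 1 wins iff $x\in A$. $G(A)$ is determined if one player has a winning strategy. For a class $\mathcal C$ of $\omega$-languages, $\mathbf{Det}(\mathcal C)$ is the sentence "every game $G(A)$ with $A\subseteq X^\omega$ in $\mathcal C$ is determined". A Büchi $k$-counter automaton is $(K,\Sigma,\Delta,q_0,F)$ with $\Delta\subseteq K\times(\Sigma\cup\{\lambda\})\times\{0,1\}^k\times K\times\{0,1,-1\}^k$: counters hold naturals; a transition $(q,a,i_1,\dots,i_k,q',j_1,\dots,j_k)$ applies in configuration $(q,c_1,\dots,c_k)$ when $i_m=0$ iff $c_m=0$, reads $a$ (nothing if $a=\lambda$), and moves to $(q',c_1+j_1,\dots,c_k+j_k)$ (zero counters are not decremented); it accepts $\sigma\in\Sigma^\omega$ iff some run from $(q_0,0,\dots,0)$ reading $\sigma$ visits $F$ infinitely often. $\mathbf{BCL}(k)_\omega$ is the class of $\omega$-languages accepted by such automata; $\mathbf{CFL}_\omega$ is the class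 of $\omega$-languages accepted by Büchi pushdown automata. $\Sigma^1_1$ is the class of effective analytic sets: $L\subseteq X^\omega$ such that for some recursive $R\subseteq\mathbb N\times\{0,1\}^*\times X^*$, $L=\{\sigma:\exists\tau\in\{0,1\}^\omega\ \forall n\ \exists m\ (n,\tau[m],\sigma[m])\in R\}$, where $y[m]$ is the length-$m$ prefix. *)

theory Defs
  imports Main "HOL-Library.Nat_Bijection"
begin

definition alphabet :: "nat set \<Rightarrow> bool" where
  "alphabet X \<longleftrightarrow> finite X \<and> X \<noteq> {}"

definition omega_words :: "nat set \<Rightarrow> (nat \<Rightarrow> nat) set" where
  "omega_words X = {x. \<forall>n. x n \<in> X}"

definition strategy :: "nat set \<Rightarrow> (nat list \<Rightarrow> nat) \<Rightarrow> bool" where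
  "strategy X s \<longleftrightarrow> (\<forall>w \<in> lists X. s w \<in> X)"

fun play_prefix :: "(nat list \<Rightarrow> nat) \<Rightarrow> (nat list \<Rightarrow> nat) \<Rightarrow> nat \<Rightarrow> nat list" where
  "play_prefix s t 0 = []"
| "play_prefix s t (Suc n) =
     (let w = play_prefix s t n in w @ [if even n then s w else t w])"

definition play :: "(nat list \<Rightarrow> nat) \<Rightarrow> (nat list \<Rightarrow> nat) \<Rightarrow> nat \<Rightarrow> nat" where
  "play s t n = play_prefix s t (Suc n) ! n"

definition player1_wins :: "nat set \<Rightarrow> (nat \<Rightarrow> nat) set \<Rightarrow> bool" where
  "player1_wins X A \<longleftrightarrow>
     (\<exists>s. strategy X s \<and> (\<forall>t. strategy X t \<longrightarrow> play s t \<in> A))"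

definition player2_wins :: "nat set \<Rightarrow> (nat \<Rightarrow> nat) set \<Rightarrow> bool" where
  "player2_wins X A \<longleftrightarrow>
     (\<exists>t. strategy X t \<and> (\<forall>s. strategy X s \<longrightarrow> play s t \<notin> A))"

definition determined :: "nat set \<Rightarrow> (nat \<Rightarrow> nat) set \<Rightarrow> bool" where
  "determined X A \<longleftrightarrow> player1_wins X A \<or> player2_wins X A"

definition Det :: "(nat set \<Rightarrow> (nat \<Rightarrow> nat) set \<Rightarrow> bool) \<Rightarrow> bool" where
  "Det C \<longleftrightarrow> (\<forall>X A. alphabet X \<and> A \<subseteq> omega_words X \<and> C X A \<longrightarrow> determined X A)"

datatype recf = Zero | Succ | Proj nat | Comp recf "recf list" | Prim recf recf | Mu recf

inductive evalr :: "recf \<Rightarrow> nat list \<Rightarrow> nat \<Rightarrow> bool" where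
  evalr_zero: "evalr Zero xs 0"
| evalr_succ: "evalr Succ (x # xs) (Suc x)"
| evalr_proj: "i < length xs \<Longrightarrow> evalr (Proj i) xs (xs ! i)"
| evalr_comp: "list_all2 (\<lambda>g y. evalr g xs y) gs ys \<Longrightarrow> evalr f ys z \<Longrightarrow> evalr (Comp f gs) xs z"
| evalr_prim0: "evalr f xs y \<Longrightarrow> evalr (Prim f g) (0 # xs) y"
| evalr_primS: "evalr (Prim f g) (n # xs) y \<Longrightarrow> evalr g (n # y # xs) z \<Longrightarrow>
                 evalr (Prim f g) (Suc n # xs) z"
| evalr_mu: "evalr f (n # xs) 0 \<Longrightarrow> (\<forall>m<n. \<exists>y. evalr f (m # xs) y \<and> y > 0) \<Longrightarrow>
              evalr (Mu f) xs n"

definition recursive_set :: "nat set \<Rightarrow> bool" where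
  "recursive_set P \<longleftrightarrow> (\<exists>f. \<forall>n. evalr f [n] (if n \<in> P then 1 else 0))"

definition code_triple :: "nat \<Rightarrow> bool list \<Rightarrow> nat list \<Rightarrow> nat" where
  "code_triple n u v = prod_encode (n, prod_encode (list_encode (map of_bool u), list_encode v))"

definition prefix_of :: "(nat \<Rightarrow> 'a) \<Rightarrow> nat \<Rightarrow> 'a list" where
  "prefix_of y m = map y [0..<m]"

definition Sigma11 :: "nat set \<Rightarrow> (nat \<Rightarrow> nat) set \<Rightarrow> bool" where
  "Sigma11 X L \<longleftrightarrow>
     (\<exists>R. recursive_set R \<and>
        L = {\<sigma> \<in> omega_words X. \<exists>\<tau> :: nat \<Rightarrow> bool. \<forall>n. \<exists>m.
               code_triple n (prefix_of \<tau> m) (prefix_of \<sigma> m) \<in> R})"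

text \<open>A step relation relates a configuration, a label (None = lambda, Some a = read a)
  and the next configuration. An omega-word sigma is accepted if there is an infinite run
  from the initial configuration whose non-lambda labels spell sigma (in order) and which
  visits accepting configurations infinitely often.\<close>

definition buchi_accepts ::
  "('c \<Rightarrow> 'l option \<Rightarrow> 'c \<Rightarrow> bool) \<Rightarrow> 'c \<Rightarrow> ('c \<Rightarrow> bool) \<Rightarrow> (nat \<Rightarrow> 'l) \<Rightarrow> bool" where
  "buchi_accepts step c0 fin \<sigma> \<longleftrightarrow>
     (\<exists>C lab pos. C 0 = c0 \<and> (\<forall>i. step (C i) (lab i) (C (Suc i))) \<and>
        strict_mono pos \<and> (\<forall>k. lab (pos k) = Some (\<sigma> k)) \<and>
        (\<forall>i. lab i \<noteq> None \<longrightarrow> i \<in> range pos) \<and>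
        infinite {i. fin (C i)})"

text \<open>Transitions (q, a, i_1..i_k, q', j_1..j_k): tests as a bool list (True = 1 = nonzero),
  increments as an int list with entries in {-1,0,1}. A decrement of a zero counter
  leaves it at 0 (natural-number truncation).\<close>

type_synonym ctrans = "nat \<times> nat option \<times> bool list \<times> nat \<times> int list"

definition counter_automaton ::
  "nat \<Rightarrow> nat set \<Rightarrow> nat set \<Rightarrow> ctrans set \<Rightarrow> nat \<Rightarrow> nat set \<Rightarrow> bool" where
  "counter_automaton k K \<Sigma> \<Delta> q0 F \<longleftrightarrow>
     finite K \<and> finite \<Delta> \<and> q0 \<in> K \<and> F \<subseteq> K \<and>
     (\<forall>(q, a, is, q', js) \<in> \<Delta>. q \<in> K \<and> q' \<in> K \<and> (\<forall>b. a = Some b \<longrightarrow> b \<in> \<Sigma>) \<and>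
        length is = k \<and> length js = k \<and> set js \<subseteq> {-1, 0, 1})"

definition counter_step ::
  "nat \<Rightarrow> ctrans set \<Rightarrow> nat \<times> nat list \<Rightarrow> nat option \<Rightarrow> nat \<times> nat list \<Rightarrow> bool" where
  "counter_step k \<Delta> c a c' \<longleftrightarrow>
     (\<exists>is js. (fst c, a, is, fst c', js) \<in> \<Delta> \<and> length (snd c) = k \<and>
        (\<forall>m<k. is ! m \<longleftrightarrow> snd c ! m \<noteq> 0) \<and>
        snd c' = map2 (\<lambda>x j. nat (int x + j)) (snd c) js)"

definition counter_lang ::
  "nat \<Rightarrow> nat set \<Rightarrow> ctrans set \<Rightarrow> nat \<Rightarrow> nat set \<Rightarrow> (nat \<Rightarrow> nat) set" where
  "counter_lang k \<Sigma> \<Delta> q0 F =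
     {\<sigma> \<in> omega_words \<Sigma>. buchi_accepts (counter_step k \<Delta>) (q0, replicate k 0) (\<lambda>c. fst c \<in> F) \<sigma>}"

definition BCL :: "nat \<Rightarrow> nat set \<Rightarrow> (nat \<Rightarrow> nat) set \<Rightarrow> bool" where
  "BCL k \<Sigma> L \<longleftrightarrow>
     (\<exists>K \<Delta> q0 F. counter_automaton k K \<Sigma> \<Delta> q0 F \<and> L = counter_lang k \<Sigma> \<Delta> q0 F)"

text \<open>(K, Sigma, Gamma, delta, q0, Z0, F) with delta a finite subset of
  K x (Sigma + lambda) x Gamma x K x Gamma^*. A transition (q, a, Z, q', gamma) applies
  in configuration (q, Z # beta) and leads to (q', gamma @ beta); empty stack blocks.\<close>

type_synonym ptrans = "nat \<times> nat option \<times> nat \<times> nat \<times> nat list"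

definition pushdown_automaton ::
  "nat set \<Rightarrow> nat set \<Rightarrow> nat set \<Rightarrow> ptrans set \<Rightarrow> nat \<Rightarrow> nat \<Rightarrow> nat set \<Rightarrow> bool" where
  "pushdown_automaton K \<Sigma> \<Gamma> \<delta> q0 Z0 F \<longleftrightarrow>
     finite K \<and> finite \<Gamma> \<and> finite \<delta> \<and> q0 \<in> K \<and> Z0 \<in> \<Gamma> \<and> F \<subseteq> K \<and>
     (\<forall>(q, a, Z, q', \<gamma>) \<in> \<delta>. q \<in> K \<and> q' \<in> K \<and> (\<forall>b. a = Some b \<longrightarrow> b \<in> \<Sigma>) \<and>
        Z \<in> \<Gamma> \<and> set \<gamma> \<subseteq> \<Gamma>)"

definition pd_step ::
  "ptrans set \<Rightarrow> nat \<times> nat list \<Rightarrow> nat option \<Rightarrow> nat \<times> nat list \<Rightarrow> bool" where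
  "pd_step \<delta> c a c' \<longleftrightarrow>
     (\<exists>Z \<beta> \<gamma>. snd c = Z # \<beta> \<and> (fst c, a, Z, fst c', \<gamma>) \<in> \<delta> \<and> snd c' = \<gamma> @ \<beta>)"

definition pd_lang ::
  "nat set \<Rightarrow> ptrans set \<Rightarrow> nat \<Rightarrow> nat \<Rightarrow> nat set \<Rightarrow> (nat \<Rightarrow> nat) set" where
  "pd_lang \<Sigma> \<delta> q0 Z0 F =
     {\<sigma> \<in> omega_words \<Sigma>. buchi_accepts (pd_step \<delta>) (q0, [Z0]) (\<lambda>c. fst c \<in> F) \<sigma>}"

definition CFL :: "nat set \<Rightarrow> (nat \<Rightarrow> nat) set \<Rightarrow> bool" where
  "CFL \<Sigma> L \<longleftrightarrow>
     (\<exists>K \<Gamma> \<delta> q0 Z0 F. pushdown_automaton K \<Sigma> \<Gamma> \<delta> q0 Z0 F \<and> L = pd_lang \<Sigma> \<delta> q0 Z0 F)"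

end

theory Submission
  imports Defs "HOL-Library.Infinite_Set"
begin

text \<open>
  Only \<open>Det (BCL 1) \<Longrightarrow> Det Sigma11\<close> needs an idea; the other implications are inclusions of classes.
  An effective analytic winning set \<open>A\<close> is presented as follows: a deterministic register machine that
  reads the play two letters at a time enumerates edges \<open>(s, s')\<close> between numbers, each of them
  infinitely often, and the play belongs to \<open>A\<close> iff the edges enumerated along it contain an infinite
  path from \<open>0\<close>. In the padded game Player 2 has to write down, in unary, the whole sequence of
  configurations of this machine, while the letters of Player 1 are ignored except in the rounds in which
  the machine reads. Each register of a configuration is a register of the preceding one up to a
  bounded change, so a one-counter automaton can guess and verify any mistake of Player 2, which makes
  Player 1 win. If there is no mistake, the automaton keeps the current node in its counter
  and guesses which of the written edges to follow. Since only Player 2 can violate the format, a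
  winning strategy of either player in the padded game yields one in the original game.
\<close>

section \<open>Games against a referee\<close>

text \<open>A nondeterministic automaton can certify that some mistake was made, but not that none
  was made. Mistakes therefore have to count in favour of acceptance, that is, of Player 1, and must
  lie entirely in the hands of Player 2; this is why Player 2 does the writing although the analytic
  set is the winning set of Player 1. One counter suffices because a mistake is local: one register
  of one configuration is wrong, and only this register has to be compared with its single source
  one configuration earlier. Comparing the current node with the first component of a written edge
  empties the counter and the second component refills it, so a path is followed with no further
  memory. The automaton meets the edges in the order of enumeration, not in the order of the path;
  hence every edge has to recur. Finally, the machine must always come back to reading: otherwise a
  play would contain only finitely many letters of the original game.\<close>

lemma prefix_of_Suc: "prefix_of y (Suc n) = prefix_of y n @ [y n]"
  by (simp add: prefix_of_def)

lemma length_prefix_of [simp]: "length (prefix_of y n) = n"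
  by (simp add: prefix_of_def)

lemma nth_prefix_of [simp]: "i < n \<Longrightarrow> prefix_of y n ! i = y i"
  by (simp add: prefix_of_def)

lemma prefix_of_lists: "y \<in> omega_words X \<Longrightarrow> prefix_of y n \<in> lists X"
  by (auto simp: prefix_of_def omega_words_def)

lemma prefix_of_cong: "(\<And>i. i < n \<Longrightarrow> x i = y i) \<Longrightarrow> prefix_of x n = prefix_of y n"
  by (simp add: prefix_of_def)

lemma play_prefix_eq: "play_prefix s t n = prefix_of (play s t) n"
proof (induction n)
  case 0
  then show ?case by (simp add: prefix_of_def)
next
  case (Suc n)
  have "length (play_prefix s t n) = n" using Suc by simp
  then have "play s t n = (if even n then s (play_prefix s t n) else t (play_prefix s t n))"
    by (simp add: play_def Let_def nth_append)
  with Suc show ?case by (simp add: Let_def prefix_of_Suc)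
qed

lemma play_rec:
  "play s t n = (if even n then s (prefix_of (play s t) n) else t (prefix_of (play s t) n))"
  using play_prefix_eq[of s t n] play_prefix_eq[of s t "Suc n"]
  by (simp add: Let_def prefix_of_Suc)

lemma play_eqI:
  assumes "\<And>n. even n \<Longrightarrow> y n = s (prefix_of y n)" "\<And>n. odd n \<Longrightarrow> y n = t (prefix_of y n)"
  shows "play s t = y"
proof
  fix n show "play s t n = y n"
  proof (induction n rule: less_induct)
    case (less n)
    then have "prefix_of (play s t) n = prefix_of y n" by (intro prefix_of_cong)
    then show ?case using assms[of n] play_rec[of s t n] by auto
  qed
qed

lemma play_in:
  assumes "strategy X s" "strategy X t" shows "play s t \<in> omega_words X"
proof -
  have "play s t n \<in> X" for n
  proof (induction n rule: less_induct)
    case (less n)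
    then have "prefix_of (play s t) n \<in> lists X" by (auto simp: prefix_of_def)
    then show ?case using assms play_rec[of s t n] by (auto simp: strategy_def)
  qed
  then show ?thesis by (simp add: omega_words_def)
qed

lemma strategy_follow: "y \<in> omega_words X \<Longrightarrow> strategy X (\<lambda>w. y (length w))"
  by (simp add: strategy_def omega_words_def)

lemma strategyD: "strategy X s \<Longrightarrow> w \<in> lists X \<Longrightarrow> s w \<in> X"
  by (simp add: strategy_def)

text \<open>A play \<open>y\<close> consistent with \<open>s\<close> arises when the opponent
  ignores the history and writes the letters of \<open>y\<close>, so quantifying over opposing
  strategies amounts to quantifying over consistent plays.\<close>

lemma player1_wins_iff:
  "player1_wins X A \<longleftrightarrow> (\<exists>s. strategy X s \<and>
     (\<forall>y \<in> omega_words X. (\<forall>n. even n \<longrightarrow> y n = s (prefix_of y n)) \<longrightarrow> y \<in> A))"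
  (is "_ \<longleftrightarrow> (\<exists>s. _ \<and> ?W s)")
proof -
  have "(\<forall>t. strategy X t \<longrightarrow> play s t \<in> A) \<longleftrightarrow> ?W s" if s: "strategy X s" for s
  proof (intro iffI ballI impI allI)
    fix y assume *: "\<forall>t. strategy X t \<longrightarrow> play s t \<in> A" "y \<in> omega_words X"
      "\<forall>n. even n \<longrightarrow> y n = s (prefix_of y n)"
    have "play s (\<lambda>w. y (length w)) = y" using *(3) by (intro play_eqI) auto
    then show "y \<in> A" using * strategy_follow[OF *(2)] by metis
  next
    fix t assume *: "?W s" "strategy X t"
    show "play s t \<in> A" using *(1) play_in[OF s *(2)] play_rec[of s t] by auto
  qed
  then show ?thesis unfolding player1_wins_def by (simp cong: conj_cong)
qed

lemma player2_wins_iff: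
  "player2_wins X A \<longleftrightarrow> (\<exists>t. strategy X t \<and>
     (\<forall>y \<in> omega_words X. (\<forall>n. odd n \<longrightarrow> y n = t (prefix_of y n)) \<longrightarrow> y \<notin> A))"
  (is "_ \<longleftrightarrow> (\<exists>s. _ \<and> ?W s)")
proof -
  have "(\<forall>s. strategy X s \<longrightarrow> play s t \<notin> A) \<longleftrightarrow> ?W t" if t: "strategy X t" for t
  proof (intro iffI ballI impI allI)
    fix y assume *: "\<forall>s. strategy X s \<longrightarrow> play s t \<notin> A" "y \<in> omega_words X"
      "\<forall>n. odd n \<longrightarrow> y n = t (prefix_of y n)"
    have "play (\<lambda>w. y (length w)) t = y" using *(3) by (intro play_eqI) auto
    then show "y \<notin> A" using * strategy_follow[OF *(2)] by metis
  next
    fix s assume *: "?W t" "strategy X s"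
    have "\<forall>n. odd n \<longrightarrow> play s t n = t (prefix_of (play s t) n)" 
      using play_rec[of s t] by auto
    then show "play s t \<notin> A" using *(1) play_in[OF *(2) t] by blast
  qed
  then show ?thesis unfolding player2_wins_def by (simp cong: conj_cong)
qed

section \<open>A deterministic referee with writing and reading rounds\<close>

locale referee =
  fixes at_read :: "'z \<Rightarrow> bool" and expects_one :: "'z \<Rightarrow> bool" and advance :: "'z \<Rightarrow> 'z"
    and after_read :: "'z \<Rightarrow> nat \<Rightarrow> nat \<Rightarrow> 'z" and z0 :: 'z and d :: "nat \<Rightarrow> nat"
begin

text \<open>Only the letters of reading rounds influence the state: in a writing round the referee
  advances as if the correct letter had been written, so what is expected next stays defined after a
  mistake.\<close>

fun ref_run :: "(nat \<Rightarrow> nat) \<Rightarrow> nat \<Rightarrow> 'z" where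
  "ref_run y 0 = z0"
| "ref_run y (Suc n) = (if at_read (ref_run y n) then after_read (ref_run y n) (d (y (2*n))) (d (y (2*n+1)))
     else advance (ref_run y n))"

definition ref_count :: "(nat \<Rightarrow> nat) \<Rightarrow> nat \<Rightarrow> nat" where
  "ref_count y n = card {i. i < n \<and> at_read (ref_run y i)}"

text \<open>Round \<open>n\<close> consists of letter \<open>2*n\<close> of Player 1 and letter
  \<open>2*n+1\<close> of Player 2; only the latter can be wrong.\<close>

definition ref_err :: "(nat \<Rightarrow> nat) \<Rightarrow> bool" where
  "ref_err y \<longleftrightarrow> (\<exists>n. \<not> at_read (ref_run y n) \<and> (y (2*n+1) = 1) \<noteq> expects_one (ref_run y n))"

definition ref_reads :: "(nat \<Rightarrow> nat) \<Rightarrow> (nat \<Rightarrow> nat) \<Rightarrow> bool" where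
  "ref_reads y \<sigma> \<longleftrightarrow> (\<forall>n. at_read (ref_run y n) \<longrightarrow>
     \<sigma> (2 * ref_count y n) = d (y (2*n)) \<and> \<sigma> (2 * ref_count y n + 1) = d (y (2*n+1)))"

definition ref_lang :: "nat set \<Rightarrow> (nat \<Rightarrow> nat) set \<Rightarrow> (nat \<Rightarrow> nat) set" where
  "ref_lang X A = {y \<in> omega_words X. ref_err y \<or> (\<exists>\<sigma>\<in>A. ref_reads y \<sigma>)}"

lemma ref_run_cong:
  "(\<And>i. i < 2*n \<Longrightarrow> x i = y i) \<Longrightarrow> ref_run x n = ref_run y n"
  by (induction n) auto

lemma ref_count_cong:
  assumes "\<And>i. i < 2*n \<Longrightarrow> x i = y i" shows "ref_count x n = ref_count y n"
proof -
  have "ref_run x i = ref_run y i" if "i < n" for i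
    using that assms by (intro ref_run_cong) auto
  then show ?thesis unfolding ref_count_def by (metis (lifting))
qed

lemma ref_count_0 [simp]: "ref_count y 0 = 0"
  by (simp add: ref_count_def)

lemma ref_count_Suc: "ref_count y (Suc n) = ref_count y n + of_bool (at_read (ref_run y n))"
proof -
  have "{i. i < Suc n \<and> at_read (ref_run y i)} =
    (if at_read (ref_run y n) then insert n {i. i < n \<and> at_read (ref_run y i)} else {i. i < n \<and> at_read (ref_run y i)})"
    by (auto simp: less_Suc_eq)
  then show ?thesis by (simp add: ref_count_def)
qed

lemma ref_count_mono: "m \<le> n \<Longrightarrow> ref_count y m \<le> ref_count y n"
  unfolding ref_count_def by (intro card_mono) auto

lemma read_unique:
  assumes "at_read (ref_run y m)" "at_read (ref_run y n)" "ref_count y m = ref_count y n" shows "m = n"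
proof (rule ccontr)
  have *: "ref_count y m < ref_count y n" if "m < n" "at_read (ref_run y m)" for m n
    using ref_count_mono[of "Suc m" n y] that by (simp add: ref_count_Suc)
  assume "m \<noteq> n"
  then show False using *[of m n] *[of n m] assms by (metis nat_neq_iff less_irrefl)
qed

end

locale reading_referee = referee +
  assumes reads_again: "\<And>y n. \<exists>m\<ge>n. at_read (ref_run y m)"
begin

lemma read_exists: "\<exists>n. at_read (ref_run y n) \<and> ref_count y n = j"
proof (induction j)
  case 0
  let ?n = "LEAST n. at_read (ref_run y n)"
  have "at_read (ref_run y ?n)" using reads_again[of 0 y] by (metis LeastI)
  moreover have "{i. i < ?n \<and> at_read (ref_run y i)} = {}" using not_less_Least by auto
  ultimately show ?case unfolding ref_count_def by (metis card.empty)
next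
  case (Suc j)
  then obtain n where n: "at_read (ref_run y n)" "ref_count y n = j" by auto
  let ?m = "LEAST m. Suc n \<le> m \<and> at_read (ref_run y m)"
  have m: "Suc n \<le> ?m \<and> at_read (ref_run y ?m)"
    using reads_again[of "Suc n" y] by (metis (mono_tags, lifting) LeastI)
  have no: "\<not> at_read (ref_run y i)" if "Suc n \<le> i" "i < ?m" for i
    using not_less_Least[OF that(2)] that(1) by auto
  have "ref_count y l = Suc j" if "Suc n \<le> l" "l \<le> ?m" for l
    using that
  proof (induction l rule: dec_induct)
    case base
    then show ?case using n by (simp add: ref_count_Suc)
  next
    case (step l)
    then show ?case using no[of l] by (simp add: ref_count_Suc)
  qed
  with m show ?case by blast
qed

text \<open>Since reading recurs, every pair of positions of the word is filled by some reading
  round.\<close>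

lemma reads_unique: assumes "ref_reads y \<sigma>" "ref_reads y \<sigma>'" shows "\<sigma> = \<sigma>'"
proof
  fix i
  obtain n where n: "at_read (ref_run y n)" "ref_count y n = i div 2" using read_exists by blast
  then have *: "\<sigma> (2 * (i div 2)) = \<sigma>' (2 * (i div 2))" "\<sigma> (2 * (i div 2) + 1) = \<sigma>' (2 * (i div 2) + 1)"
    using assms unfolding ref_reads_def by metis+
  have "i = 2 * (i div 2) \<or> i = 2 * (i div 2) + 1" by arith
  then show "\<sigma> i = \<sigma>' i" using * by metis
qed

text \<open>Either player (\<open>p = 0\<close> for Player 1, \<open>p = 1\<close> for Player 2) turns a strategy \<open>s'\<close> for the padded game
  into one for the original game by imagining a correctly padded play; \<open>F \<sigma>\<close> is the rule producing
  that play, where \<open>\<sigma>\<close> supplies the opponent's letters.\<close>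

lemma transfer_strategy:
  assumes X: "x0 \<in> X" "X \<subseteq> X'" "0 \<in> X'" "1 \<in> X'"
    and d: "\<And>a. a \<in> X' \<Longrightarrow> d a \<in> X" "\<And>a. a \<in> X \<Longrightarrow> d a = a"
    and s': "strategy X' s'" and p: "p < (2::nat)"
  shows "\<exists>s. strategy X s \<and> (\<forall>\<sigma>\<in>omega_words X. (\<forall>n. n mod 2 = p \<longrightarrow> \<sigma> n = s (prefix_of \<sigma> n)) \<longrightarrow>
    (\<exists>y\<in>omega_words X'. (\<forall>n. n mod 2 = p \<longrightarrow> y n = s' (prefix_of y n)) \<and> ref_reads y \<sigma> \<and>
      (p = 0 \<longrightarrow> \<not> ref_err y)))"
proof -
  define ext where "ext w i = (if i < length w then w ! i else x0)" for w :: "nat list" and i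
  have ext_prefix: "ext (prefix_of \<sigma> n) i = (if i < n then \<sigma> i else x0)" for \<sigma> n i
    by (simp add: ext_def)
  \<comment> \<open>\<open>play F F\<close> lets one rule move at both parities, so a single
    function on prefixes generates the whole imagined play.\<close>
  define gen where "gen F = play F F" for F :: "nat list \<Rightarrow> nat"
  have gen: "gen F n = F (prefix_of (gen F) n)" for F n
    unfolding gen_def using play_rec[of F F n] by auto
  have gen_cong: "gen F n = gen F' n"
    if "\<And>m. m \<le> n \<Longrightarrow> F (prefix_of (gen F) m) = F' (prefix_of (gen F) m)" for F F' n
    using that
  proof (induction n rule: less_induct)
    case (less n)
    have "gen F m = gen F' m" if "m < n" for m
      using less that by auto
    then have "prefix_of (gen F) n = prefix_of (gen F') n" by (intro prefix_of_cong)
    then show ?case using less.prems[of n] gen[of F n] gen[of F' n] by simp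
  qed
  \<comment> \<open>The state of the referee after a finite prefix; the padding in
    \<open>ext\<close> is never inspected, because the state before a round depends on earlier
    letters only.\<close>
  define st where "st u = ref_run (ext u) (length u div 2)" for u
  define ct where "ct u = ref_count (ext u) (length u div 2)" for u
  have st: "st (prefix_of y n) = ref_run y (n div 2)"
    and ct: "ct (prefix_of y n) = ref_count y (n div 2)" for y n
    unfolding st_def ct_def
    by (auto intro!: ref_run_cong ref_count_cong simp: ext_prefix)
  define T where "T y j = (SOME n. at_read (ref_run y n) \<and> ref_count y n = j)" for y j
  have T: "T y j = n" if "at_read (ref_run y n)" "ref_count y n = j" for y n j
    using someI_ex[OF read_exists[of y j]] read_unique[of y "T y j" n] that unfolding T_def by auto
  \<comment> \<open>Own positions follow \<open>s'\<close>. In reading rounds the opponent's letters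
    come from \<open>\<sigma>\<close>; in writing rounds an imagined Player 2 writes the correct
    bit, while an imagined Player 1 may write anything.\<close>
  define F where "F \<sigma> u = (if length u mod 2 = p then s' u
    else if at_read (st u) then \<sigma> (2 * ct u + (1 - p)) else if p = 0 then of_bool (expects_one (st u)) else x0)" for \<sigma> u
  \<comment> \<open>The reply to \<open>w\<close> is the own letter in the reading round with number
    \<open>length w div 2\<close>, taken from the play generated by \<open>w\<close> padded with
    \<open>x0\<close>. That the padding has no influence so early in the play is the claim
    \<open>eq\<close> below.\<close>
  define s where "s w = (let y = gen (F (ext w)) in d (s' (prefix_of y (2 * T y (length w div 2) + p))))" for w
  have genX: "gen (F \<sigma>) \<in> omega_words X'" if "\<sigma> \<in> omega_words X" for \<sigma>
  proof -
    have "strategy X' (F \<sigma>)" using that s' X unfolding strategy_def F_def omega_words_def by auto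
    then show ?thesis unfolding gen_def by (rule play_in) fact
  qed
  have extX: "ext w \<in> omega_words X" if "w \<in> lists X" for w
    using that X unfolding omega_words_def ext_def by (auto simp: in_lists_conv_set)
  have "strategy X s"
    unfolding strategy_def
  proof
    fix w assume "w \<in> lists X"
    then have "s' (prefix_of (gen (F (ext w))) n) \<in> X'" for n
      by (intro strategyD[OF s'] prefix_of_lists genX extX)
    then show "s w \<in> X" unfolding s_def Let_def using d(1) by blast
  qed
  moreover have "\<exists>y\<in>omega_words X'. (\<forall>n. n mod 2 = p \<longrightarrow> y n = s' (prefix_of y n)) \<and> ref_reads y \<sigma> \<and>
      (p = 0 \<longrightarrow> \<not> ref_err y)"
    if \<sigma>: "\<sigma> \<in> omega_words X" and con: "\<forall>n. n mod 2 = p \<longrightarrow> \<sigma> n = s (prefix_of \<sigma> n)" for \<sigma>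
  proof -
    let ?y = "gen (F \<sigma>)"
    have own: "?y n = s' (prefix_of ?y n)" if "n mod 2 = p" for n
      using gen[of "F \<sigma>" n] that by (simp add: F_def)
    have odd: "(2 * n + (1 - p)) mod 2 \<noteq> p" "(2 * n + (1 - p)) div 2 = n" "(2 * n + p) mod 2 = p" for n
      using p by (auto simp: less_2_cases_iff)
    have opp: "?y (2*n + (1-p)) = (if at_read (ref_run ?y n) then \<sigma> (2 * ref_count ?y n + (1-p))
        else if p = 0 then of_bool (expects_one (ref_run ?y n)) else x0)" for n
      using gen[of "F \<sigma>" "2*n + (1-p)"] odd(1,2)[of n] by (simp add: F_def st ct)
    have noerr: "p = 0 \<longrightarrow> \<not> ref_err ?y" unfolding ref_err_def using opp by (auto simp del: One_nat_def)
    have "\<sigma> (2 * ref_count ?y n + p) = d (?y (2*n + p)) \<and> \<sigma> (2 * ref_count ?y n + (1-p)) = d (?y (2*n + (1-p)))"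
      if r: "at_read (ref_run ?y n)" for n
    proof
      let ?j = "ref_count ?y n"
      show "\<sigma> (2 * ?j + (1-p)) = d (?y (2*n + (1-p)))" using opp[of n] r d(2) \<sigma> by (simp add: omega_words_def)
      let ?F' = "F (ext (prefix_of \<sigma> (2 * ?j + p)))"
      \<comment> \<open>Up to the own move in this reading round, the plays generated by all of
        \<open>\<sigma>\<close> and by its prefix coincide, since every opponent letter used so far
        lies inside the prefix.\<close>
      have eq: "gen (F \<sigma>) m = gen ?F' m" if "m < 2*n + p" for m
      proof (rule gen_cong)
        fix l assume "l \<le> m"
        then have l: "l < 2 * n + p" using that by simp
        show "F \<sigma> (prefix_of ?y l) = ?F' (prefix_of ?y l)"
        proof (cases "l mod 2 \<noteq> p \<and> at_read (ref_run ?y (l div 2))")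
          case True
          \<comment> \<open>If the opponent is Player 2 (\<open>p = 0\<close>), the earlier move
            belongs to a strictly earlier round; if the opponent is Player 1, it may belong to round
            \<open>n\<close> itself.\<close>
          have "l div 2 + (1 - p) \<le> n"
          proof (cases "p = 0")
            case 0: True
            have "l < 2 * n" "l mod 2 \<noteq> 0" using l True 0 by auto
            then have "l div 2 + 1 \<le> n" by presburger
            then show ?thesis using 0 by simp
          next
            case False
            then have p1: "p = 1" using p by simp
            have "l < 2 * n + 1" using l p1 by simp
            then have "l div 2 \<le> n" by presburger
            then show ?thesis using p1 by simp
          qed
          from ref_count_mono[OF this, of ?y] True p have "2 * ref_count ?y (l div 2) + (1 - p) < 2 * ?j + p"
            by (cases "p = 0") (auto simp: ref_count_Suc)
          then show ?thesis by (simp add: F_def ct ext_prefix)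
        qed (auto simp: F_def st)
      qed
      then have pe: "prefix_of ?y (2*n + p) = prefix_of (gen ?F') (2*n + p)" by (intro prefix_of_cong)
      have "T (gen ?F') ?j = n"
        using ref_run_cong[of n ?y "gen ?F'"] ref_count_cong[of n ?y "gen ?F'"] eq r
        by (intro T) auto
      moreover have "(2 * ?j + p) div 2 = ?j" using p by simp
      ultimately have "s (prefix_of \<sigma> (2 * ?j + p)) = d (s' (prefix_of ?y (2*n + p)))"
        by (simp add: s_def Let_def pe)
      then show "\<sigma> (2 * ?j + p) = d (?y (2*n + p))" using con own[of "2*n + p"] odd(3) by metis
    qed
    then have "ref_reads ?y \<sigma>" unfolding ref_reads_def using p by (cases "p = 0") (auto simp: less_2_cases_iff)
    then show ?thesis using genX[OF \<sigma>] own noerr by blast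
  qed
  ultimately show ?thesis by blast
qed

text \<open>If Player 1 wins the padded game, the imagined play has no mistake, so its membership in
  \<open>ref_lang\<close> is due to the word read, which is unique. If Player 2 wins, mistakes need
  no attention: a play outside \<open>ref_lang\<close> has no word of \<open>A\<close> among the
  words read in it.\<close>

lemma determined_transfer:
  assumes X: "x0 \<in> X" "X \<subseteq> X'" "0 \<in> X'" "1 \<in> X'"
    and d: "\<And>a. a \<in> X' \<Longrightarrow> d a \<in> X" "\<And>a. a \<in> X \<Longrightarrow> d a = a"
    and det: "determined X' (ref_lang X' A)"
  shows "determined X A"
proof -
  from det consider "player1_wins X' (ref_lang X' A)" | "player2_wins X' (ref_lang X' A)"
    unfolding determined_def by blast
  then show ?thesis
  proof cases
    case 1
    then obtain s' where s': "strategy X' s'"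
      and win: "\<And>y. y \<in> omega_words X' \<Longrightarrow> (\<And>n. even n \<Longrightarrow> y n = s' (prefix_of y n)) \<Longrightarrow> y \<in> ref_lang X' A"
      unfolding player1_wins_iff by metis
    obtain s where s: "strategy X s"
      and y: "\<And>\<sigma>. \<sigma> \<in> omega_words X \<Longrightarrow> \<forall>n. n mod 2 = 0 \<longrightarrow> \<sigma> n = s (prefix_of \<sigma> n) \<Longrightarrow>
        \<exists>y\<in>omega_words X'. (\<forall>n. n mod 2 = 0 \<longrightarrow> y n = s' (prefix_of y n)) \<and> ref_reads y \<sigma> \<and> \<not> ref_err y"
      using transfer_strategy[OF X d s', of 0] by auto
    have "\<sigma> \<in> A" if \<sigma>: "\<sigma> \<in> omega_words X" and con: "\<forall>n. even n \<longrightarrow> \<sigma> n = s (prefix_of \<sigma> n)" for \<sigma>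
    proof -
      obtain y where "y \<in> omega_words X'" "\<forall>n. even n \<longrightarrow> y n = s' (prefix_of y n)" "ref_reads y \<sigma>" "\<not> ref_err y"
        using y[OF \<sigma>] con unfolding even_iff_mod_2_eq_zero by blast
      then show ?thesis using win[of y] reads_unique unfolding ref_lang_def by blast
    qed
    then show ?thesis using s unfolding determined_def player1_wins_iff by blast
  next
    case 2
    then obtain t' where t': "strategy X' t'"
      and win: "\<And>y. y \<in> omega_words X' \<Longrightarrow> (\<And>n. odd n \<Longrightarrow> y n = t' (prefix_of y n)) \<Longrightarrow> y \<notin> ref_lang X' A"
      unfolding player2_wins_iff by metis
    obtain t where t: "strategy X t"
      and y: "\<And>\<sigma>. \<sigma> \<in> omega_words X \<Longrightarrow> \<forall>n. n mod 2 = 1 \<longrightarrow> \<sigma> n = t (prefix_of \<sigma> n) \<Longrightarrow>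
        \<exists>y\<in>omega_words X'. (\<forall>n. n mod 2 = 1 \<longrightarrow> y n = t' (prefix_of y n)) \<and> ref_reads y \<sigma>"
      using transfer_strategy[OF X d t', of 1] by auto
    have "\<sigma> \<notin> A" if \<sigma>: "\<sigma> \<in> omega_words X" and con: "\<forall>n. odd n \<longrightarrow> \<sigma> n = t (prefix_of \<sigma> n)" for \<sigma>
    proof -
      obtain y where "y \<in> omega_words X'" "\<forall>n. odd n \<longrightarrow> y n = t' (prefix_of y n)" "ref_reads y \<sigma>"
        using y[OF \<sigma>] con unfolding odd_iff_mod_2_eq_one by blast
      then show ?thesis using win[of y] unfolding ref_lang_def by blast
    qed
    then show ?thesis using t unfolding determined_def player2_wins_iff by blast
  qed
qed

end

section \<open>One-counter automata as pushdown automata\<close>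

text \<open>A simulation that preserves labels transports runs together with their letter positions;
  \<open>I\<close> confines it to configurations of a known shape.\<close>

lemma buchi_accepts_map:
  assumes acc: "buchi_accepts step c0 fin \<sigma>"
    and I: "I c0" "\<And>c a c'. step c a c' \<Longrightarrow> I c \<Longrightarrow> I c' \<and> step' (f c) a (f c')"
    and fin: "\<And>c. I c \<Longrightarrow> fin c \<Longrightarrow> fin' (f c)"
  shows "buchi_accepts step' (f c0) fin' \<sigma>"
proof -
  obtain C lab pos where C: "C 0 = c0" "\<And>i. step (C i) (lab i) (C (Suc i))"
    and pos: "strict_mono pos" "\<forall>k. lab (pos k) = Some (\<sigma> k)" "\<forall>i. lab i \<noteq> None \<longrightarrow> i \<in> range pos"
    and inf: "infinite {i. fin (C i)}"
    using acc unfolding buchi_accepts_def by auto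
  have IC: "I (C i)" for i
    by (induction i) (use C I in auto)
  have "infinite {i. fin' (f (C i))}"
    using inf by (rule contrapos_nn) (auto elim!: finite_subset[rotated] intro: fin IC)
  then show ?thesis unfolding buchi_accepts_def using C I(2)[OF C(2) IC] pos
    by (intro exI[of _ "\<lambda>i. f (C i)"] exI[of _ lab] exI[of _ pos]) auto
qed

text \<open>Unary over a bottom marker \<open>0\<close>: the top symbol alone decides the zero test,
  and the stack is never empty, so it never blocks.\<close>

definition counter_stack :: "nat \<Rightarrow> nat list" where
  "counter_stack c = replicate c 1 @ [0]"

lemma counter_stack_simps [simp]: "counter_stack 0 = [0]" "counter_stack (Suc c) = 1 # counter_stack c"
  by (simp_all add: counter_stack_def)

lemma replicate_counter_stack: "replicate m 1 @ counter_stack c = counter_stack (m + c)"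
  by (simp add: counter_stack_def replicate_add)

text \<open>The popped symbol has to be put back: a \<open>1\<close> becomes \<open>1 + j\<close>
  ones, the bottom marker becomes \<open>j\<close> ones above itself, where \<open>nat\<close> turns
  a decrement at zero into no change.\<close>

definition pd_trans :: "ctrans \<Rightarrow> ptrans" where
  "pd_trans = (\<lambda>(q, a, is, q', js). (q, a, of_bool (hd is), q',
     if hd is then replicate (nat (1 + hd js)) 1 else replicate (nat (hd js)) 1 @ [0]))"

text \<open>On stacks of the form \<open>counter_stack c\<close> the two step relations correspond
  in both directions; going back, the counter is the stack length minus one.\<close>

lemma BCL_1_CFL:
  assumes "BCL 1 \<Sigma> L" shows "CFL \<Sigma> L"
proof -
  obtain K \<Delta> q0 F where ca: "counter_automaton 1 K \<Sigma> \<Delta> q0 F" and L: "L = counter_lang 1 \<Sigma> \<Delta> q0 F"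
    using assms unfolding BCL_def by blast
  let ?\<delta> = "pd_trans ` \<Delta>"
  have form: "\<exists>i j. is = [i] \<and> js = [j] \<and> j \<in> {-1,0,1} \<and> q \<in> K \<and> q' \<in> K \<and> (\<forall>b. a = Some b \<longrightarrow> b \<in> \<Sigma>)"
    if "(q, a, is, q', js) \<in> \<Delta>" for q a "is" q' js
    using ca that unfolding counter_automaton_def by (fastforce simp: length_Suc_conv)
  have pa: "pushdown_automaton K \<Sigma> {0,1} ?\<delta> q0 0 F"
    unfolding pushdown_automaton_def
  proof (intro conjI ballI)
    fix t assume "t \<in> ?\<delta>"
    then obtain q a "is" q' js where "(q, a, is, q', js) \<in> \<Delta>" "t = pd_trans (q, a, is, q', js)" by auto
    with form[OF this(1)] show "case t of (q, a, Z, q', \<gamma>) \<Rightarrow> q \<in> K \<and> q' \<in> K \<and>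
      (\<forall>b. a = Some b \<longrightarrow> b \<in> \<Sigma>) \<and> Z \<in> {0,1} \<and> set \<gamma> \<subseteq> {0,1}"
      by (auto simp: pd_trans_def set_replicate_conv_if)
  qed (use ca in \<open>auto simp: counter_automaton_def\<close>)
  have step: "pd_step ?\<delta> (q, counter_stack c) a (q', s) \<longleftrightarrow>
    (\<exists>c'. s = counter_stack c' \<and> counter_step 1 \<Delta> (q, [c]) a (q', [c']))" (is "?l \<longleftrightarrow> ?r") for q c a q' s
  proof
    assume ?l
    then obtain Z \<beta> \<gamma> where st: "counter_stack c = Z # \<beta>" "(q, a, Z, q', \<gamma>) \<in> ?\<delta>" "s = \<gamma> @ \<beta>"
      unfolding pd_step_def by auto
    then obtain "is" js where \<Delta>: "(q, a, is, q', js) \<in> \<Delta>"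
      and Z: "Z = of_bool (hd is)" "\<gamma> = (if hd is then replicate (nat (1 + hd js)) 1 else replicate (nat (hd js)) 1 @ [0])"
      unfolding pd_trans_def by auto
    from form[OF \<Delta>] obtain i j where ij: "is = [i]" "js = [j]" "j \<in> {-1,0,1}" by blast
    have "(i \<longleftrightarrow> c \<noteq> 0) \<and> s = counter_stack (nat (int c + j))"
    proof (cases c)
      case 0
      then have "\<not> i" "\<beta> = []" using st(1) Z(1) ij(1) by (cases i; simp)+
      then show ?thesis using 0 st(3) Z(2) ij by (auto simp: counter_stack_def)
    next
      case (Suc m)
      then have "i" "\<beta> = counter_stack m" using st(1) Z(1) ij(1) by (cases i; simp)+
      moreover have "nat (1 + j) + m = nat (int (Suc m) + j)" using ij(3) by auto
      ultimately show ?thesis using Suc st(3) Z(2) ij(1,2)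
        by (simp only: replicate_counter_stack list.sel if_True simp_thms)
    qed
    then have i: "i \<longleftrightarrow> c \<noteq> 0" and "s = counter_stack (nat (int c + j))" by auto
    moreover have "counter_step 1 \<Delta> (q, [c]) a (q', [nat (int c + j)])"
      unfolding counter_step_def using \<Delta> ij(1,2) i
      by (intro exI[of _ "[i]"] exI[of _ "[j]"]) auto
    ultimately show ?r by blast
  next
    assume ?r
    then obtain c' "is" js where \<Delta>: "(q, a, is, q', js) \<in> \<Delta>" and s: "s = counter_stack c'"
      and c: "is ! 0 \<longleftrightarrow> c \<noteq> 0" "[c'] = map2 (\<lambda>x j. nat (int x + j)) [c] js"
      unfolding counter_step_def by auto
    from form[OF \<Delta>] obtain i j where ij: "is = [i]" "js = [j]" "j \<in> {-1,0,1}" by blast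
    have "pd_trans (q, a, is, q', js) \<in> ?\<delta>" using \<Delta> by blast
    then have m: "(q, a, of_bool i, q', if i then replicate (nat (1 + j)) 1 else replicate (nat j) 1 @ [0]) \<in> ?\<delta>"
      unfolding ij by (subst (asm) pd_trans_def) (simp only: case_prod_conv list.sel)
    show ?l
    proof (cases c)
      case 0
      then have "(q, a, 0, q', replicate (nat j) 1 @ [0]) \<in> ?\<delta>" "c' = nat j" using m c ij by auto
      then show ?thesis unfolding pd_step_def using 0 s by (auto simp: counter_stack_def)
    next
      case (Suc n)
      have "nat (1 + j) + n = nat (int (Suc n) + j)" using ij(3) by auto
      then have "(q, a, 1, q', replicate (nat (1 + j)) 1) \<in> ?\<delta>" "c' = nat (1 + j) + n"
        using m c ij Suc by auto
      then show ?thesis unfolding pd_step_def using Suc s by (auto simp: replicate_counter_stack[symmetric])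
    qed
  qed
  have "buchi_accepts (counter_step 1 \<Delta>) (q0, replicate 1 0) (\<lambda>c. fst c \<in> F) \<sigma> \<longleftrightarrow>
    buchi_accepts (pd_step ?\<delta>) (q0, [0]) (\<lambda>c. fst c \<in> F) \<sigma>" for \<sigma>
  proof
    assume *: "buchi_accepts (counter_step 1 \<Delta>) (q0, replicate 1 0) (\<lambda>c. fst c \<in> F) \<sigma>"
    have "buchi_accepts (pd_step ?\<delta>) ((\<lambda>c. (fst c, counter_stack (hd (snd c)))) (q0, replicate 1 0)) (\<lambda>c. fst c \<in> F) \<sigma>"
    proof (rule buchi_accepts_map[where I = "\<lambda>c. length (snd c) = 1" and
        f = "\<lambda>c. (fst c, counter_stack (hd (snd c)))", OF *])
      fix c a c' assume c: "counter_step 1 \<Delta> c a c'" "length (snd c) = 1"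
      have "length (snd c') = 1" using c(1) form unfolding counter_step_def by fastforce
      with c show "length (snd c') = 1 \<and> pd_step ?\<delta> (fst c, counter_stack (hd (snd c))) a (fst c', counter_stack (hd (snd c')))"
        unfolding step by (cases c; cases c') (auto simp: length_Suc_conv)
    qed auto
    then show "buchi_accepts (pd_step ?\<delta>) (q0, [0]) (\<lambda>c. fst c \<in> F) \<sigma>" by (simp add: counter_stack_def)
  next
    assume *: "buchi_accepts (pd_step ?\<delta>) (q0, [0]) (\<lambda>c. fst c \<in> F) \<sigma>"
    have len: "length (counter_stack c) - 1 = c" for c by (simp add: counter_stack_def)
    have "buchi_accepts (counter_step 1 \<Delta>) ((\<lambda>c :: nat \<times> nat list. (fst c, [length (snd c) - 1])) (q0, [0])) (\<lambda>c. fst c \<in> F) \<sigma>"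
    proof (rule buchi_accepts_map[where I = "\<lambda>c. snd c \<in> range counter_stack" and
        f = "\<lambda>c :: nat \<times> nat list. (fst c, [length (snd c) - 1])", OF *])
      show "snd (q0, [0]) \<in> range counter_stack" by (auto simp: counter_stack_def image_iff intro!: exI[of _ 0])
      fix c a c' assume c: "pd_step ?\<delta> c a c'" "snd c \<in> range counter_stack"
      then obtain x where "snd c = counter_stack x" by auto
      with c(1) step[of "fst c" x a "fst c'" "snd c'"] 
      show "snd c' \<in> range counter_stack \<and> counter_step 1 \<Delta> (fst c, [length (snd c) - 1]) a (fst c', [length (snd c') - 1])"
        using len by (cases c; cases c') auto
    qed auto
    then show "buchi_accepts (counter_step 1 \<Delta>) (q0, replicate 1 0) (\<lambda>c. fst c \<in> F) \<sigma>" by simp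
  qed
  then have "L = pd_lang \<Sigma> ?\<delta> q0 0 F" unfolding L counter_lang_def pd_lang_def by simp
  with pa show ?thesis unfolding CFL_def by blast
qed

section \<open>One-counter automata reading two letters at a time\<close>

definition round_accepts ::
  "('s \<Rightarrow> bool \<Rightarrow> nat \<Rightarrow> nat \<Rightarrow> 's \<Rightarrow> int \<Rightarrow> bool) \<Rightarrow> ('s \<Rightarrow> bool) \<Rightarrow> ('s \<Rightarrow> bool) \<Rightarrow> (nat \<Rightarrow> nat) \<Rightarrow> bool" where
  "round_accepts \<delta> ini fin y \<longleftrightarrow> (\<exists>C :: nat \<Rightarrow> 's \<times> nat. ini (fst (C 0)) \<and> snd (C 0) = 0 \<and>
     (\<forall>n. \<exists>j. \<delta> (fst (C n)) (snd (C n) \<noteq> 0) (y (2*n)) (y (2*n+1)) (fst (C (Suc n))) j \<and>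
            snd (C (Suc n)) = nat (int (snd (C n)) + j)) \<and>
     infinite {n. fin (fst (C n))})"

lemma strict_mono_surj_id:
  fixes pos :: "nat \<Rightarrow> nat"
  assumes "strict_mono pos" "range pos = UNIV" shows "pos k = k"
proof -
  have le: "k \<le> pos k" for k using strict_mono_imp_increasing[OF assms(1)] .
  show ?thesis
  proof (rule ccontr)
    assume "pos k \<noteq> k"
    then have gt: "k < pos k" using le[of k] by simp
    have "{..k} \<subseteq> pos ` {..<k}"
    proof
      fix x assume "x \<in> {..k}"
      obtain l where l: "x = pos l" using assms(2) by (metis UNIV_I imageE)
      then have "pos l < pos k" using \<open>x \<in> {..k}\<close> gt by simp
      then have "l < k" using assms(1) by (simp add: strict_mono_less)
      then show "x \<in> pos ` {..<k}" using l by blast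
    qed
    then have "card {..k} \<le> card {..<k}" by (meson surj_card_le finite_lessThan)
    then show False by simp
  qed
qed

text \<open>Without empty steps every index lies in the range of \<open>pos\<close>, and a strictly
  increasing surjection of the naturals is the identity.\<close>

lemma buchi_accepts_realtime:
  assumes "\<And>c a c'. step c a c' \<Longrightarrow> a \<noteq> None"
  shows "buchi_accepts step c0 fin \<sigma> \<longleftrightarrow>
    (\<exists>C. C 0 = c0 \<and> (\<forall>i. step (C i) (Some (\<sigma> i)) (C (Suc i))) \<and> infinite {i. fin (C i)})" (is "?l \<longleftrightarrow> ?r")
proof
  assume ?l
  then obtain C lab pos where C: "C 0 = c0" "\<And>i. step (C i) (lab i) (C (Suc i))"
    and pos: "strict_mono pos" "\<And>k. lab (pos k) = Some (\<sigma> k)" "\<And>i. lab i \<noteq> None \<Longrightarrow> i \<in> range pos"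
    and inf: "infinite {i. fin (C i)}"
    unfolding buchi_accepts_def by blast
  have "range pos = UNIV" using assms[OF C(2)] pos(3) by auto
  then have "lab k = Some (\<sigma> k)" for k using strict_mono_surj_id[OF pos(1)] pos(2)[of k] by metis
  then show ?r using C inf by metis
next
  assume ?r
  then obtain C where "C 0 = c0" "\<forall>i. step (C i) (Some (\<sigma> i)) (C (Suc i))" "infinite {i. fin (C i)}" by blast
  then show ?l unfolding buchi_accepts_def
    by (intro exI[of _ C] exI[of _ "\<lambda>i. Some (\<sigma> i)"] exI[of _ "\<lambda>i. i"]) (auto simp: strict_mono_def)
qed

text \<open>A counter automaton reads one round (two letters) of \<open>\<delta>\<close> in two steps; the state \<open>(p, Some a)\<close>
  remembers the first letter, and \<open>p = None\<close> is a fresh initial state.\<close>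

lemma BCL_1_round:
  fixes \<delta> :: "'s \<Rightarrow> bool \<Rightarrow> nat \<Rightarrow> nat \<Rightarrow> 's \<Rightarrow> int \<Rightarrow> bool"
  assumes X: "finite X" and P: "finite P" "\<And>p. ini p \<Longrightarrow> p \<in> P"
    and \<delta>: "\<And>p z a b p' j. \<delta> p z a b p' j \<Longrightarrow> p \<in> P \<Longrightarrow> p' \<in> P \<and> j \<in> {-1,0,1}"
  shows "BCL 1 X {y \<in> omega_words X. round_accepts \<delta> ini fin y}"
proof -
  define Q where "Q = (insert None (Some ` P)) \<times> (insert None (Some ` X))"
  have finQ: "finite Q" unfolding Q_def using X P by simp
  obtain f :: "'s option \<times> nat option \<Rightarrow> nat" where f: "inj_on f Q"
    using finite_imp_inj_to_nat_seg[OF finQ] by blast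
  \<comment> \<open>The choice of the initial state is deferred to the second letter of the first
    round; until then the state component is \<open>None\<close>.\<close>
  define src where "src x p \<longleftrightarrow> (case x of None \<Rightarrow> ini p | Some q \<Rightarrow> p = q)" for x :: "'s option" and p
  \<comment> \<open>The first letter is stored without touching the counter, so the zero test at the
    second letter still sees the value at the beginning of the round.\<close>
  define T where "T = {(x, a, z, x', j). x \<in> Q \<and> x' \<in> Q \<and> a \<in> X \<and>
     ((snd x = None \<and> x' = (fst x, Some a) \<and> j = 0) \<or>
      (\<exists>a' p p'. snd x = Some a' \<and> src (fst x) p \<and> x' = (Some p', None) \<and> \<delta> p z a' a p' j))} "
  define \<Delta> where "\<Delta> = (\<lambda>(x, a, z, x', j). (f x, Some a, [z], f x', [j])) ` T"
  define F where "F = f ` {x \<in> Q. snd x = None \<and> (\<exists>p. fst x = Some p \<and> fin p)}"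
  have srcP: "p \<in> P" if "src x p" "(x, a) \<in> Q" for x p a
    using that P unfolding src_def Q_def by (auto split: option.splits)
  have Tj: "j \<in> {-1,0,1}" if "(x, a, z, x', j) \<in> T" for x a z x' j
  proof -
    from that consider "j = 0" | a' p p' where "src (fst x) p" "x \<in> Q" "\<delta> p z a' a p' j" unfolding T_def by auto
    then show ?thesis using srcP[of "fst x" _ "snd x"] \<delta> by cases auto
  qed
  have "T \<subseteq> Q \<times> X \<times> UNIV \<times> Q \<times> {-1,0,1}"
    using Tj unfolding T_def by blast
  then have finT: "finite T" by (rule finite_subset) (simp add: finQ X)
  have init: "(None, None) \<in> Q" by (simp add: Q_def)
  have ca: "counter_automaton 1 (f ` Q) X \<Delta> (f (None, None)) F"
    unfolding counter_automaton_def
  proof (intro conjI ballI)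
    fix t assume "t \<in> \<Delta>"
    then obtain x a z x' j where t: "t = (f x, Some a, [z], f x', [j])" "(x, a, z, x', j) \<in> T"
      unfolding \<Delta>_def by auto
    with Tj[OF t(2)] show "case t of (q, a, is, q', js) \<Rightarrow> q \<in> f ` Q \<and> q' \<in> f ` Q \<and> (\<forall>b. a = Some b \<longrightarrow> b \<in> X) \<and>
        length is = 1 \<and> length js = 1 \<and> set js \<subseteq> {-1, 0, 1}"
      unfolding T_def by auto
  qed (use finQ finT init in \<open>auto simp: \<Delta>_def F_def\<close>)
  have step: "counter_step 1 \<Delta> (f x, [c]) (Some a) c' \<longleftrightarrow>
    (\<exists>x' j. (x, a, c \<noteq> 0, x', j) \<in> T \<and> c' = (f x', [nat (int c + j)]))" if "x \<in> Q" for x c a c'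
  proof
    assume "counter_step 1 \<Delta> (f x, [c]) (Some a) c'"
    then obtain "is" js where *: "(f x, Some a, is, fst c', js) \<in> \<Delta>" "is ! 0 \<longleftrightarrow> c \<noteq> 0"
      "snd c' = map2 (\<lambda>x j. nat (int x + j)) [c] js"
      unfolding counter_step_def by auto
    then obtain x2 z x' j where **: "f x = f x2" "is = [z]" "fst c' = f x'" "js = [j]" "(x2, a, z, x', j) \<in> T"
      unfolding \<Delta>_def by auto
    have "x2 \<in> Q" using ** unfolding T_def by blast
    then have "x = x2" using f that **(1) by (auto dest: inj_onD)
    then show "\<exists>x' j. (x, a, c \<noteq> 0, x', j) \<in> T \<and> c' = (f x', [nat (int c + j)])"
      using * ** by (intro exI[of _ x'] exI[of _ j]) (cases c', auto)
  next
    assume "\<exists>x' j. (x, a, c \<noteq> 0, x', j) \<in> T \<and> c' = (f x', [nat (int c + j)])"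
    then obtain x' j where *: "(x, a, c \<noteq> 0, x', j) \<in> T" "c' = (f x', [nat (int c + j)])" by blast
    then have "(f x, Some a, [c \<noteq> 0], f x', [j]) \<in> \<Delta>" unfolding \<Delta>_def by force
    then show "counter_step 1 \<Delta> (f x, [c]) (Some a) c'" unfolding counter_step_def using *
      by (intro exI[of _ "[c \<noteq> 0]"] exI[of _ "[j]"]) auto
  qed
  have some: "a \<noteq> None" if "counter_step 1 \<Delta> c a c'" for c a c'
    using that unfolding counter_step_def \<Delta>_def by auto
  have rep: "replicate 1 (0::nat) = [0]" by simp
  have bar: "buchi_accepts (counter_step 1 \<Delta>) (f (None, None), replicate 1 0) (\<lambda>c. fst c \<in> F) y \<longleftrightarrow>
      (\<exists>C. C 0 = (f (None, None), [0]) \<and> (\<forall>i. counter_step 1 \<Delta> (C i) (Some (y i)) (C (Suc i))) \<and>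
        infinite {i. fst (C i) \<in> F})" for y
    unfolding rep by (rule buchi_accepts_realtime) (use some in blast)
  have "buchi_accepts (counter_step 1 \<Delta>) (f (None, None), replicate 1 0) (\<lambda>c. fst c \<in> F) y \<longleftrightarrow>
      round_accepts \<delta> ini fin y" (is "?l \<longleftrightarrow> ?r") if y: "y \<in> omega_words X" for y
  proof
    assume ?l
    then obtain C where C: "C 0 = (f (None, None), [0])" "\<And>i. counter_step 1 \<Delta> (C i) (Some (y i)) (C (Suc i))"
      and inf: "infinite {i. fst (C i) \<in> F}"
      unfolding bar by blast
    have "\<exists>x c. C i = (f x, [c]) \<and> x \<in> Q" for i
    proof (induction i)
      case 0
      then show ?case using C(1) init by blast
    next
      case (Suc i)
      then obtain x c where xc: "C i = (f x, [c])" "x \<in> Q" by blast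
      from C(2)[of i] obtain x' j where "(x, y i, c \<noteq> 0, x', j) \<in> T" "C (Suc i) = (f x', [nat (int c + j)])"
        unfolding xc(1) step[OF xc(2)] by blast
      then show ?case unfolding T_def by blast
    qed
    then obtain x c where xc: "\<And>i. C i = (f (x i), [c i])" "\<And>i. x i \<in> Q" by metis
    have st: "\<exists>j. (x i, y i, c i \<noteq> 0, x (Suc i), j) \<in> T \<and> c (Suc i) = nat (int (c i) + j)" for i
    proof -
      from C(2)[of i] obtain x' j where *: "(x i, y i, c i \<noteq> 0, x', j) \<in> T"
        "f (x (Suc i)) = f x'" "c (Suc i) = nat (int (c i) + j)"
        unfolding xc(1) step[OF xc(2)] by auto
      have "x' \<in> Q" using * unfolding T_def by blast
      then have "x (Suc i) = x'" using f xc(2) *(2) by (auto dest: inj_onD)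
      with * show ?thesis by blast
    qed
    have x0: "x 0 = (None, None)" "c 0 = 0" using C(1) xc f init by (auto dest: inj_onD)
    have par: "snd (x (2*n)) = None" for n
    proof (induction n)
      case (Suc n)
      obtain j where "(x (2*n), y (2*n), c (2*n) \<noteq> 0, x (Suc (2*n)), j) \<in> T" using st by blast
      then have "snd (x (Suc (2*n))) \<noteq> None" using Suc unfolding T_def by auto
      moreover obtain j where "(x (Suc (2*n)), y (Suc (2*n)), c (Suc (2*n)) \<noteq> 0, x (Suc (Suc (2*n))), j) \<in> T" using st by blast
      ultimately have "snd (x (Suc (Suc (2*n)))) = None" unfolding T_def by auto
      then show ?case by simp
    qed (simp add: x0)
    have two: "\<exists>p p' j. src (fst (x (2*n))) p \<and> x (2 * Suc n) = (Some p', None) \<and> snd (x (Suc (2*n))) \<noteq> None \<and>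
       \<delta> p (c (2*n) \<noteq> 0) (y (2*n)) (y (2*n+1)) p' j \<and> c (2 * Suc n) = nat (int (c (2*n)) + j)" for n
    proof -
      obtain j1 where "(x (2*n), y (2*n), c (2*n) \<noteq> 0, x (Suc (2*n)), j1) \<in> T"
        "c (Suc (2*n)) = nat (int (c (2*n)) + j1)" using st by blast
      then have 1: "x (Suc (2*n)) = (fst (x (2*n)), Some (y (2*n)))" "c (Suc (2*n)) = c (2*n)"
        using par[of n] unfolding T_def by auto
      obtain j where "(x (Suc (2*n)), y (Suc (2*n)), c (Suc (2*n)) \<noteq> 0, x (Suc (Suc (2*n))), j) \<in> T"
        "c (Suc (Suc (2*n))) = nat (int (c (Suc (2*n))) + j)" using st by blast
      then show ?thesis using 1 unfolding T_def by auto
    qed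
    \<comment> \<open>The run does not record the initial state, so at index 0 one that justifies
      the first round is chosen.\<close>
    define p where "p n = (case n of 0 \<Rightarrow> (SOME p. ini p \<and>
       (\<exists>j p'. x 2 = (Some p', None) \<and> \<delta> p False (y 0) (y 1) p' j \<and> c 2 = nat (int 0 + j))) | Suc m \<Rightarrow> the (fst (x (2*n))))" for n
    have p0: "ini (p 0) \<and> (\<exists>j p'. x 2 = (Some p', None) \<and> \<delta> (p 0) False (y 0) (y 1) p' j \<and> c 2 = nat (int 0 + j))"
      unfolding p_def nat.case by (rule someI_ex) (use two[of 0] x0 in \<open>fastforce simp: src_def numeral_2_eq_2\<close>)
    have pS: "x (2 * Suc n) = (Some (p (Suc n)), None)" for n
      using two[of n] unfolding p_def by auto
    have "\<exists>j. \<delta> (p n) (c (2*n) \<noteq> 0) (y (2*n)) (y (2*n+1)) (p (Suc n)) j \<and> c (2 * Suc n) = nat (int (c (2*n)) + j)" for n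
    proof (cases n)
      case 0
      then show ?thesis using p0 pS[of 0] x0 by (auto simp: numeral_2_eq_2)
    next
      case (Suc m)
      then show ?thesis using two[of n] pS[of m] pS[of n] by (auto simp: src_def)
    qed
    moreover have "infinite {n. fin (p n)}"
    proof
      assume fi: "finite {n. fin (p n)}"
      have "{i. fst (C i) \<in> F} \<subseteq> (\<lambda>n. 2*n) ` {n. fin (p n)}"
      proof
        fix i assume "i \<in> {i. fst (C i) \<in> F}"
        then obtain x' where "f (x i) = f x'" "x' \<in> Q" "snd x' = None" "\<exists>p. fst x' = Some p \<and> fin p"
          using xc(1) unfolding F_def by auto
        moreover from this have "x i = x'" using f xc(2) by (auto dest: inj_onD)
        ultimately have xi: "snd (x i) = None" "\<exists>p. fst (x i) = Some p \<and> fin p" by auto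
        have "even i"
        proof (rule ccontr)
          assume "odd i"
          then obtain n where "i = Suc (2*n)" by (metis oddE Suc_eq_plus1)
          then show False using two[of n] xi by auto
        qed
        then obtain n where n: "i = 2*n" by (metis evenE)
        moreover have "n \<noteq> 0" using n xi(2) x0(1) by (intro notI) simp
        then obtain m where "n = Suc m" by (cases n) auto
        ultimately have "fin (p n)" using xi pS[of m] by auto
        then show "i \<in> (\<lambda>n. 2*n) ` {n. fin (p n)}" using n by blast
      qed
      then show False using fi inf finite_subset by blast
    qed
    ultimately show ?r unfolding round_accepts_def using p0 x0
      by (intro exI[of _ "\<lambda>n. (p n, c (2*n))"]) auto
  next
    assume ?r
    then obtain D where D: "ini (fst (D 0))" "snd (D 0) = 0"
      "\<And>n. \<exists>j. \<delta> (fst (D n)) (snd (D n) \<noteq> 0) (y (2*n)) (y (2*n+1)) (fst (D (Suc n))) j \<and>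
            snd (D (Suc n)) = nat (int (snd (D n)) + j)"
      "infinite {n. fin (fst (D n))}" unfolding round_accepts_def by blast
    have DP: "fst (D n) \<in> P" for n
    proof (induction n)
      case (Suc n)
      then show ?case using D(3)[of n] \<delta> by blast
    qed (use D P in blast)
    define x where "x i = (if i = 0 then None else if i = 1 then None else Some (fst (D (i div 2))),
        if even i then None else Some (y (i-1)))" for i
    have xQ: "x i \<in> Q" for i
      using DP y unfolding x_def Q_def omega_words_def by auto
    define C where "C i = (f (x i), [snd (D (i div 2))])" for i
    have "counter_step 1 \<Delta> (C i) (Some (y i)) (C (Suc i))" for i
      unfolding C_def step[OF xQ]
    proof (cases "even i")
      case True
      then obtain n where n: "i = 2*n" by (metis evenE)
      have "(x i, y i, snd (D (i div 2)) \<noteq> 0, x (Suc i), 0) \<in> T"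
        unfolding T_def using xQ[of i] xQ[of "Suc i"] y n by (auto simp: omega_words_def x_def)
      then show "\<exists>x' j. (x i, y i, snd (D (i div 2)) \<noteq> 0, x', j) \<in> T \<and>
        (f (x (Suc i)), [snd (D (Suc i div 2))]) = (f x', [nat (int (snd (D (i div 2))) + j)])"
        using n by (intro exI[of _ "x (Suc i)"] exI[of _ 0]) auto
    next
      case False
      then obtain n where n: "i = Suc (2*n)" by (metis oddE Suc_eq_plus1)
      obtain j where j: "\<delta> (fst (D n)) (snd (D n) \<noteq> 0) (y (2*n)) (y (2*n+1)) (fst (D (Suc n))) j"
            "snd (D (Suc n)) = nat (int (snd (D n)) + j)" using D(3) by blast
      have "(x i, y i, snd (D (i div 2)) \<noteq> 0, x (Suc i), j) \<in> T"
        unfolding T_def using xQ[of i] xQ[of "Suc i"] y n j D(1)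
        by (auto simp: omega_words_def x_def src_def intro!: exI[of _ "fst (D n)"])
      then show "\<exists>x' j. (x i, y i, snd (D (i div 2)) \<noteq> 0, x', j) \<in> T \<and>
        (f (x (Suc i)), [snd (D (Suc i div 2))]) = (f x', [nat (int (snd (D (i div 2))) + j)])"
        using n j(2) by (intro exI[of _ "x (Suc i)"] exI[of _ j]) auto
    qed
    moreover have "C 0 = (f (None, None), [0])" unfolding C_def x_def using D(2) by simp
    moreover have "infinite {i. fst (C i) \<in> F}"
    proof
      assume fi: "finite {i. fst (C i) \<in> F}"
      \<comment> \<open>Round 0 may be lost because the fresh initial state is not accepting; a
        single index does not affect infinity.\<close>
      have "{n. fin (fst (D n))} \<subseteq> insert 0 ((\<lambda>i. i div 2) ` {i. fst (C i) \<in> F})"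
      proof
        fix n assume n: "n \<in> {n. fin (fst (D n))}"
        show "n \<in> insert 0 ((\<lambda>i. i div 2) ` {i. fst (C i) \<in> F})"
        proof (cases n)
          case (Suc m)
          have "fst (C (2*n)) \<in> F" using n Suc xQ[of "2*n"] unfolding C_def F_def x_def by auto
          then show ?thesis by (auto intro!: image_eqI[of _ _ "2*n"])
        qed simp
      qed
      then show False using fi D(4) by (meson finite_imageI finite_insert finite_subset)
    qed
    ultimately show ?l unfolding bar by blast
  qed
  then have "{y \<in> omega_words X. round_accepts \<delta> ini fin y} = counter_lang 1 X \<Delta> (f (None, None)) F"
    unfolding counter_lang_def by auto
  with ca show ?thesis unfolding BCL_def by blast
qed

section \<open>Pasting finite paths into accepting runs\<close>

definition round_step ::
  "('s \<Rightarrow> bool \<Rightarrow> nat \<Rightarrow> nat \<Rightarrow> 's \<Rightarrow> int \<Rightarrow> bool) \<Rightarrow> (nat \<Rightarrow> nat) \<Rightarrow> nat \<Rightarrow> 's \<times> nat \<Rightarrow> 's \<times> nat \<Rightarrow> bool" where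
  "round_step \<delta> y n x x' \<longleftrightarrow> (\<exists>j. \<delta> (fst x) (snd x \<noteq> 0) (y (2*n)) (y (2*n+1)) (fst x') j \<and>
     snd x' = nat (int (snd x) + j))"

definition round_path ::
  "('s \<Rightarrow> bool \<Rightarrow> nat \<Rightarrow> nat \<Rightarrow> 's \<Rightarrow> int \<Rightarrow> bool) \<Rightarrow> (nat \<Rightarrow> nat) \<Rightarrow> nat \<Rightarrow> 's \<times> nat \<Rightarrow> nat \<Rightarrow> 's \<times> nat \<Rightarrow> bool" where
  "round_path \<delta> y a x b x' \<longleftrightarrow> a \<le> b \<and> (\<exists>C. C a = x \<and> C b = x' \<and> (\<forall>n. a \<le> n \<and> n < b \<longrightarrow> round_step \<delta> y n (C n) (C (Suc n))))"

lemma round_path_refl: "round_path \<delta> y a x a x"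
  unfolding round_path_def by (intro conjI exI[of _ "\<lambda>_. x"]) auto

lemma round_path_step: assumes "round_path \<delta> y a x b x'" "round_step \<delta> y b x' x''" shows "round_path \<delta> y a x (Suc b) x''"
proof -
  obtain C where C: "a \<le> b" "C a = x" "C b = x'" "\<And>n. a \<le> n \<and> n < b \<Longrightarrow> round_step \<delta> y n (C n) (C (Suc n))"
    using assms(1) unfolding round_path_def by blast
  have "round_step \<delta> y n ((C(Suc b := x'')) n) ((C(Suc b := x'')) (Suc n))" if "a \<le> n \<and> n < Suc b" for n
    using that C assms(2) by (cases "n = b") auto
  then show ?thesis using C unfolding round_path_def by (intro conjI exI[of _ "C(Suc b := x'')"]) auto
qed

text \<open>Dependent choice strings together finite pieces, each leading from a configuration
  satisfying \<open>G\<close> to a strictly later one that is also final; the pieces are then glued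
  into one run.\<close>

lemma round_accepts_progress:
  assumes ini: "ini p" and G0: "G 0 (p, 0)"
    and prog: "\<And>a x. G a x \<Longrightarrow> \<exists>b x'. a < b \<and> round_path \<delta> y a x b x' \<and> G b x' \<and> fin (fst x')"
  shows "round_accepts \<delta> ini fin y"
proof -
  define R where "R = (\<lambda>s s'. fst s < fst s' \<and> round_path \<delta> y (fst s) (snd s) (fst s') (snd s') \<and> fin (fst (snd s')))"
  have "\<exists>s :: nat \<Rightarrow> nat \<times> 'a \<times> nat. \<forall>i. (G (fst (s i)) (snd (s i)) \<and> (i = 0 \<longrightarrow> s i = (0, (p, 0)))) \<and> R (s i) (s (Suc i))"
  proof (rule dependent_nat_choice)
    show "\<exists>s. G (fst s) (snd s) \<and> (0 = (0::nat) \<longrightarrow> s = (0, (p, 0)))" using G0 by auto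
    fix s :: "nat \<times> 'a \<times> nat" and n assume "G (fst s) (snd s) \<and> (n = (0::nat) \<longrightarrow> s = (0, (p, 0)))"
    with prog[of "fst s" "snd s"] obtain b x' where
      "fst s < b" "round_path \<delta> y (fst s) (snd s) b x'" "G b x'" "fin (fst x')" by blast
    then show "\<exists>s'. (G (fst s') (snd s') \<and> (Suc n = 0 \<longrightarrow> s' = (0, (p, 0)))) \<and> R s s'"
      unfolding R_def by (intro exI[of _ "(b, x')"]) auto
  qed
  then obtain s where s: "\<And>i. G (fst (s i)) (snd (s i))" "s 0 = (0, (p, 0))" "\<And>i. R (s i) (s (Suc i))" by blast
  define a where "a i = fst (s i)" for i
  have a0: "a 0 = 0" using s(2) by (simp add: a_def)
  have a_less: "a i < a (Suc i)" for i using s(3)[of i] by (simp add: R_def a_def)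
  then have amono: "strict_mono a" by (simp add: strict_mono_Suc_iff)
  have "\<forall>i. \<exists>C. C (a i) = snd (s i) \<and> C (a (Suc i)) = snd (s (Suc i)) \<and>
     (\<forall>n. a i \<le> n \<and> n < a (Suc i) \<longrightarrow> round_step \<delta> y n (C n) (C (Suc n)))"
    using s(3) unfolding R_def round_path_def a_def by blast
  then obtain D where D: "\<And>i. D i (a i) = snd (s i)" "\<And>i. D i (a (Suc i)) = snd (s (Suc i))"
    "\<And>i n. a i \<le> n \<Longrightarrow> n < a (Suc i) \<Longrightarrow> round_step \<delta> y n (D i n) (D i (Suc n))" by metis
  define ix where "ix n = (LEAST i. n < a (Suc i))" for n
  have ix: "a (ix n) \<le> n" "n < a (Suc (ix n))" for n
  proof -
    have "n < a (Suc n)" using strict_mono_imp_increasing[OF amono, of "Suc n"] by simp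
    then show "n < a (Suc (ix n))" unfolding ix_def by (rule LeastI)
    show "a (ix n) \<le> n"
    proof (cases "ix n")
      case (Suc i)
      then have "\<not> n < a (Suc i)" using not_less_Least[of i "\<lambda>i. n < a (Suc i)"] unfolding ix_def by auto
      then show ?thesis using Suc by simp
    qed (simp add: a0)
  qed
  have ix_eq: "ix n = i" if "a i \<le> n" "n < a (Suc i)" for n i
  proof -
    have "a (ix n) < a (Suc i)" "a i < a (Suc (ix n))" using ix[of n] that by auto
    then show ?thesis using amono by (simp add: strict_mono_less)
  qed
  define C where "C n = D (ix n) n" for n
  have Ca: "C (a i) = snd (s i)" for i
    using ix_eq[of i "a i"] a_less D(1) by (simp add: C_def)
  have "round_step \<delta> y n (C n) (C (Suc n))" for n
  proof -
    have "C (Suc n) = D (ix n) (Suc n)"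
    proof (cases "Suc n < a (Suc (ix n))")
      case True
      then have "ix (Suc n) = ix n" using ix[of n] by (intro ix_eq) auto
      then show ?thesis by (simp add: C_def)
    next
      case False
      then have "Suc n = a (Suc (ix n))" using ix[of n] by simp
      then show ?thesis using Ca[of "Suc (ix n)"] D(2)[of "ix n"] by simp
    qed
    then show ?thesis using D(3)[OF ix] by (simp add: C_def)
  qed
  moreover have "C 0 = (p, 0)" using Ca[of 0] a0 s(2) by simp
  moreover have "infinite {n. fin (fst (C n))}"
  proof
    assume "finite {n. fin (fst (C n))}"
    moreover have "range (\<lambda>i. a (Suc i)) \<subseteq> {n. fin (fst (C n))}"
      using s(3) Ca by (auto simp: R_def)
    ultimately have "finite (range (\<lambda>i. a (Suc i)))" by (rule finite_subset[rotated])
    moreover have "inj (\<lambda>i. a (Suc i))" using amono by (simp add: inj_def strict_mono_eq)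
    ultimately show False using finite_imageD by blast
  qed
  ultimately show ?thesis unfolding round_accepts_def round_step_def using ini
    by (intro exI[of _ C]) auto
qed

text \<open>Since \<open>s\<close> changes only on entering a flagged index, sampling it at the
  predecessors of the flagged indices deletes the repetitions and leaves a chain.\<close>

lemma flagged_subsequence:
  assumes inf: "infinite {n. fl n}"
    and R: "\<And>n. fl (Suc n) \<Longrightarrow> R (s n) (s (Suc n))"
    and eq: "\<And>n. \<not> fl (Suc n) \<Longrightarrow> s (Suc n) = s n"
  shows "\<exists>g. g 0 = s 0 \<and> (\<forall>i::nat. R (g i) (g (Suc i)))"
proof -
  define S where "S = {n. fl (Suc n)}"
  have "infinite S"
  proof
    assume "finite S"
    moreover have "{n. fl n} \<subseteq> insert 0 (Suc ` S)"
    proof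
      fix n assume "n \<in> {n. fl n}"
      then show "n \<in> insert 0 (Suc ` S)" by (cases n) (auto simp: S_def)
    qed
    ultimately show False using inf by (meson finite_imageI finite_insert finite_subset)
  qed
  have const: "s n = s m" if "m \<le> n" "\<And>l. m \<le> l \<Longrightarrow> l < n \<Longrightarrow> l \<notin> S" for m n
    using that
  proof (induction n rule: dec_induct)
    case (step n)
    then show ?case using eq[of n] by (auto simp: S_def)
  qed simp
  define e where "e = enumerate S"
  have e0: "l \<notin> S" if "l < e 0" for l
    using not_less_Least[of l "\<lambda>n. n \<in> S"] that unfolding e_def enumerate_0 by blast
  have e1: "l \<notin> S" if "e i < l" "l < e (Suc i)" for l i
    using not_less_Least[of l "\<lambda>n. n \<in> S \<and> e i < n"] that
    unfolding e_def by (auto simp: enumerate_Suc''[OF \<open>infinite S\<close>])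
  have "R (s (e i)) (s (e (Suc i)))" for i
  proof -
    have "e i \<in> S" unfolding e_def using \<open>infinite S\<close> by (rule enumerate_in_set)
    then have "R (s (e i)) (s (Suc (e i)))" using R by (simp add: S_def)
    moreover have "e i < e (Suc i)" unfolding e_def using \<open>infinite S\<close> by (rule enumerate_step)
    then have "s (e (Suc i)) = s (Suc (e i))" by (intro const) (simp_all add: e1 Suc_le_eq)
    ultimately show ?thesis by simp
  qed
  moreover have "s (e 0) = s 0" using e0 by (intro const) auto
  ultimately show ?thesis by (intro exI[of _ "\<lambda>i. s (e i)"]) auto
qed

section \<open>Computable functions\<close>

named_theorems computable_intros

text \<open>Total functions of fixed arity, given as HOL functions of the argument list:
  computability of a defined function then follows by applying introduction rules along its
  body.\<close>

definition computable :: "nat \<Rightarrow> (nat list \<Rightarrow> nat) \<Rightarrow> bool" where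
  "computable k F \<longleftrightarrow> (\<exists>r. \<forall>xs. length xs = k \<longrightarrow> evalr r xs (F xs))"

lemma computable_proj [computable_intros]: "i < k \<Longrightarrow> computable k (\<lambda>xs. xs ! i)"
  unfolding computable_def by (rule exI[of _ "Proj i"]) (auto intro: evalr_proj)

lemma computable_comp:
  assumes F: "computable n F" and G: "\<And>i. i < n \<Longrightarrow> computable k (G i)"
  shows "computable k (\<lambda>xs. F (map (\<lambda>i. G i xs) [0..<n]))"
proof -
  obtain f where f: "\<And>xs. length xs = n \<Longrightarrow> evalr f xs (F xs)" using F unfolding computable_def by blast
  have "\<forall>i. \<exists>r. i < n \<longrightarrow> (\<forall>xs. length xs = k \<longrightarrow> evalr r xs (G i xs))" using G unfolding computable_def by blast
  then obtain g where g: "\<And>i xs. i < n \<Longrightarrow> length xs = k \<Longrightarrow> evalr (g i) xs (G i xs)" by metis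
  have "evalr (Comp f (map g [0..<n])) xs (F (map (\<lambda>i. G i xs) [0..<n]))" if "length xs = k" for xs
    by (rule evalr_comp[where ys = "map (\<lambda>i. G i xs) [0..<n]"])
      (use f g that in \<open>auto simp: list_all2_conv_all_nth\<close>)
  then show ?thesis unfolding computable_def by blast
qed

definition "computable1 f \<longleftrightarrow> computable 1 (\<lambda>xs. f (xs ! 0))"
definition "computable2 f \<longleftrightarrow> computable 2 (\<lambda>xs. f (xs ! 0) (xs ! 1))"
definition "computable3 f \<longleftrightarrow> computable 3 (\<lambda>xs. f (xs ! 0) (xs ! 1) (xs ! 2))"

lemma computable1D: "computable1 f \<Longrightarrow> computable k a \<Longrightarrow> computable k (\<lambda>xs. f (a xs))"
  unfolding computable1_def by (drule computable_comp[where k = k and G = "\<lambda>_. a"]) auto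

lemma computable2D: "computable2 f \<Longrightarrow> computable k a \<Longrightarrow> computable k b \<Longrightarrow> computable k (\<lambda>xs. f (a xs) (b xs))"
  unfolding computable2_def
  by (drule computable_comp[where k = k and G = "\<lambda>i. if i = 0 then a else b"]) (auto simp: upt_rec)

lemma computable3D: "computable3 f \<Longrightarrow> computable k a \<Longrightarrow> computable k b \<Longrightarrow> computable k c \<Longrightarrow> computable k (\<lambda>xs. f (a xs) (b xs) (c xs))"
  unfolding computable3_def
  by (drule computable_comp[where k = k and G = "\<lambda>i. if i = 0 then a else if i = 1 then b else c"]) (auto simp: upt_rec)

lemma computable1_Suc: "computable1 Suc"
  unfolding computable1_def computable_def
  by (rule exI[of _ Succ]) (auto simp: length_Suc_conv intro: evalr_succ)

lemma computable_Suc [computable_intros]: "computable k a \<Longrightarrow> computable k (\<lambda>xs. Suc (a xs))"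
  by (rule computable1D[OF computable1_Suc])

lemma computable_const [computable_intros]: "computable k (\<lambda>_. c)"
proof (induction c)
  case 0
  show ?case unfolding computable_def by (rule exI[of _ Zero]) (auto intro: evalr_zero)
qed (rule computable_Suc)

text \<open>One parameter is enough, since further data can be carried in paired numbers.\<close>

lemma computable2_rec:
  assumes "computable1 b" "computable3 s"
  shows "computable2 (\<lambda>n x. rec_nat (b x) (\<lambda>i acc. s i acc x) n)"
proof -
  obtain f where f: "\<And>xs. length xs = 1 \<Longrightarrow> evalr f xs (b (xs ! 0))"
    using assms(1) unfolding computable1_def computable_def by blast
  obtain g where g: "\<And>xs. length xs = 3 \<Longrightarrow> evalr g xs (s (xs ! 0) (xs ! 1) (xs ! 2))"
    using assms(2) unfolding computable3_def computable_def by blast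
  have "evalr (Prim f g) (n # [x]) (rec_nat (b x) (\<lambda>i acc. s i acc x) n)" for n x
  proof (induction n)
    case 0
    then show ?case using f[of "[x]"] by (auto intro: evalr_prim0)
  next
    case (Suc n)
    then show ?case using g[of "[n, rec_nat (b x) (\<lambda>i acc. s i acc x) n, x]"] by (auto intro: evalr_primS)
  qed
  then have "evalr (Prim f g) xs (rec_nat (b (xs ! 1)) (\<lambda>i acc. s i acc (xs ! 1)) (xs ! 0))" if "length xs = 2" for xs
    using that by (auto simp: length_Suc_conv numeral_2_eq_2)
  then show ?thesis unfolding computable2_def computable_def by blast
qed

lemma computable_rec:
  assumes "computable1 b" "computable3 s" "computable k n" "computable k x"
  shows "computable k (\<lambda>xs. rec_nat (b (x xs)) (\<lambda>i acc. s i acc (x xs)) (n xs))"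
  using computable2D[OF computable2_rec[OF assms(1,2)] assms(3,4)] .

lemma computable_add [computable_intros]: assumes "computable k a" "computable k b" shows "computable k (\<lambda>xs. a xs + b xs)"
proof -
  have "rec_nat (y::nat) (\<lambda>i acc. Suc acc) x = x + y" for x y by (induction x) auto
  moreover have "computable1 (\<lambda>x. x)" "computable3 (\<lambda>i acc x. Suc acc)" unfolding computable1_def computable3_def by (intro computable_intros; simp)+
  ultimately show ?thesis using computable_rec[of "\<lambda>x. x" "\<lambda>i acc x. Suc acc", OF _ _ assms] by simp
qed

lemma computable_pred [computable_intros]: assumes "computable k a" shows "computable k (\<lambda>xs. a xs - Suc 0)"
proof -
  have "rec_nat 0 (\<lambda>i acc. i) x = x - 1" for x by (induction x) auto
  moreover have "computable1 (\<lambda>x. 0)" "computable3 (\<lambda>i acc x. i)" unfolding computable1_def computable3_def by (intro computable_intros; simp)+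
  ultimately show ?thesis using computable_rec[of "\<lambda>x. 0" "\<lambda>i acc x. i", OF _ _ assms assms] by simp
qed

lemma computable_diff [computable_intros]: assumes "computable k a" "computable k b" shows "computable k (\<lambda>xs. a xs - b xs)"
proof -
  have "rec_nat (y::nat) (\<lambda>i acc. acc - Suc 0) x = y - x" for x y by (induction x) auto
  moreover have "computable1 (\<lambda>x. x)" "computable3 (\<lambda>i acc x. acc - Suc 0)" unfolding computable1_def computable3_def by (intro computable_intros; simp)+
  ultimately show ?thesis using computable_rec[of "\<lambda>x. x" "\<lambda>i acc x. acc - Suc 0", OF _ _ assms(2,1)] by simp
qed

lemma computable_mult [computable_intros]: assumes "computable k a" "computable k b" shows "computable k (\<lambda>xs. a xs * b xs)"
proof -
  have "rec_nat 0 (\<lambda>i acc. acc + y) x = x * y" for x y :: nat by (induction x) auto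
  moreover have "computable1 (\<lambda>x. 0)" "computable3 (\<lambda>i acc x. acc + x)" unfolding computable1_def computable3_def by (intro computable_intros; simp)+
  ultimately show ?thesis using computable_rec[of "\<lambda>x. 0" "\<lambda>i acc x. acc + x", OF _ _ assms(1,2)] by simp
qed

section \<open>Decidable predicates\<close>

definition "decidable k P \<longleftrightarrow> computable k (\<lambda>xs. of_bool (P xs))"

lemma computable_of_bool [computable_intros]: "decidable k P \<Longrightarrow> computable k (\<lambda>xs. of_bool (P xs))"
  unfolding decidable_def .

lemma computable_if [computable_intros]: assumes "decidable k P" "computable k a" "computable k b" shows "computable k (\<lambda>xs. if P xs then a xs else b xs)"
proof -
  have "computable k (\<lambda>xs. of_bool (P xs) * a xs + (1 - of_bool (P xs)) * b xs)"
    using assms unfolding decidable_def by (intro computable_add computable_mult computable_diff computable_const)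
  moreover have "(\<lambda>xs. of_bool (P xs) * a xs + (1 - of_bool (P xs)) * b xs) = (\<lambda>xs. if P xs then a xs else b xs)"
    by auto
  ultimately show ?thesis by metis
qed

lemma decidable_le [computable_intros]: assumes "computable k a" "computable k b" shows "decidable k (\<lambda>xs. a xs \<le> b xs)"
proof -
  have "computable k (\<lambda>xs. 1 - (a xs - b xs))" using assms by (intro computable_diff computable_const)
  moreover have "(\<lambda>xs. 1 - (a xs - b xs)) = (\<lambda>xs. of_bool (a xs \<le> b xs))" by auto
  ultimately show ?thesis unfolding decidable_def by metis
qed

lemma decidable_not [computable_intros]: assumes "decidable k P" shows "decidable k (\<lambda>xs. \<not> P xs)"
proof -
  have "computable k (\<lambda>xs. 1 - of_bool (P xs))" using assms unfolding decidable_def by (intro computable_diff computable_const)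
  moreover have "(\<lambda>xs. 1 - of_bool (P xs)) = (\<lambda>xs. of_bool (\<not> P xs) :: nat)" by auto
  ultimately show ?thesis unfolding decidable_def by metis
qed

lemma decidable_conj [computable_intros]: assumes "decidable k P" "decidable k Q" shows "decidable k (\<lambda>xs. P xs \<and> Q xs)"
proof -
  have "computable k (\<lambda>xs. of_bool (P xs) * of_bool (Q xs))" using assms unfolding decidable_def by (rule computable_mult)
  moreover have "(\<lambda>xs. of_bool (P xs) * of_bool (Q xs)) = (\<lambda>xs. of_bool (P xs \<and> Q xs) :: nat)" by auto
  ultimately show ?thesis unfolding decidable_def by metis
qed

lemma decidable_disj [computable_intros]: "decidable k P \<Longrightarrow> decidable k Q \<Longrightarrow> decidable k (\<lambda>xs. P xs \<or> Q xs)"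
  using decidable_not[OF decidable_conj[OF decidable_not decidable_not], of k P Q] by simp

lemma decidable_less [computable_intros]: "computable k a \<Longrightarrow> computable k b \<Longrightarrow> decidable k (\<lambda>xs. a xs < b xs)"
  using decidable_not[OF decidable_le, of k b a] by (simp add: not_le)

lemma decidable_eq [computable_intros]: "computable k a \<Longrightarrow> computable k b \<Longrightarrow> decidable k (\<lambda>xs. a xs = b xs)"
  using decidable_conj[OF decidable_le decidable_le, of k a b b a] by (simp add: eq_iff)

lemma decidable_const [computable_intros]: "decidable k (\<lambda>_. c)"
  unfolding decidable_def by (rule computable_const)

lemma decidable_bex: assumes "finite S" "\<And>t. t \<in> S \<Longrightarrow> decidable k (P t)" shows "decidable k (\<lambda>xs. \<exists>t\<in>S. P t xs)"
  using assms by (induction S) (auto intro: decidable_const decidable_disj)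

lemma computable_iter: assumes "computable1 h" "computable k n" "computable k x" shows "computable k (\<lambda>xs. (h ^^ n xs) (x xs))"
proof -
  have "rec_nat x (\<lambda>i acc. h acc) n = (h ^^ n) x" for n x by (induction n) auto
  moreover have "computable1 (\<lambda>x. x)" unfolding computable1_def by (intro computable_intros; simp)
  moreover have "computable3 (\<lambda>i acc x. h acc)" unfolding computable3_def by (intro computable1D[OF assms(1)] computable_intros; simp)
  ultimately show ?thesis using computable_rec[of "\<lambda>x. x" "\<lambda>i acc x. h acc", OF _ _ assms(2,3)] by simp
qed

lemma computable_triangle [computable_intros]: assumes "computable k a" shows "computable k (\<lambda>xs. triangle (a xs))"
proof -
  have "rec_nat 0 (\<lambda>i acc. acc + Suc i) n = triangle n" for n by (induction n) auto
  moreover have "computable1 (\<lambda>x. 0)" "computable3 (\<lambda>i acc x. acc + Suc i)" unfolding computable1_def computable3_def by (intro computable_intros; simp)+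
  ultimately show ?thesis using computable_rec[of "\<lambda>x. 0" "\<lambda>i acc x. acc + Suc i", OF _ _ assms(1,1)] by simp
qed

lemma computable_pair [computable_intros]: "computable k a \<Longrightarrow> computable k b \<Longrightarrow> computable k (\<lambda>xs. prod_encode (a xs, b xs))"
  unfolding prod_encode_def prod.case by (intro computable_intros)

lemma mono_triangle: "mono triangle"
  by (rule monoI, unfold triangle_def, intro div_le_mono mult_le_mono) auto

text \<open>Inverts Cantor pairing: \<open>s\<close> counts the triangular numbers below the code.\<close>

lemma triangle_count:
  assumes "m \<le> s"
  shows "rec_nat 0 (\<lambda>i acc. acc + of_bool (triangle (Suc i) \<le> triangle s + m)) (triangle s + m) = s"
proof -
  have "triangle (Suc i) \<le> triangle s + m \<longleftrightarrow> i < s" for i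
  proof
    assume *: "triangle (Suc i) \<le> triangle s + m"
    show "i < s"
    proof (rule ccontr)
      assume "\<not> i < s"
      then have "triangle (Suc s) \<le> triangle (Suc i)" by (intro monoD[OF mono_triangle]) auto
      then show False using * assms by simp
    qed
  next
    assume "i < s"
    then have "triangle (Suc i) \<le> triangle s" by (intro monoD[OF mono_triangle]) auto
    then show "triangle (Suc i) \<le> triangle s + m" by simp
  qed
  then have "rec_nat 0 (\<lambda>i acc. acc + of_bool (triangle (Suc i) \<le> triangle s + m)) n = min n s" for n
    by (induction n) auto
  moreover have "s \<le> triangle s" by (induction s) auto
  ultimately show ?thesis by simp
qed

lemma computable_unpair [computable_intros]:
  assumes "computable k a"
  shows "computable k (\<lambda>xs. fst (prod_decode (a xs)))" "computable k (\<lambda>xs. snd (prod_decode (a xs)))"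
proof -
  define r :: "nat \<Rightarrow> nat" where "r z = rec_nat 0 (\<lambda>i acc. acc + of_bool (triangle (Suc i) \<le> z)) z" for z
  have r: "r (triangle s + m) = s" if "m \<le> s" for s m
    unfolding r_def using triangle_count[OF that] .
  have dec: "fst (prod_decode z) = z - triangle (r z)" "snd (prod_decode z) = r z - (z - triangle (r z))" for z
  proof -
    obtain m n where z: "z = prod_encode (m, n)" by (metis prod_decode_inverse prod.exhaust)
    have t: "z = triangle (m + n) + m" unfolding z by (simp add: prod_encode_def)
    have "r z = m + n" unfolding t by (rule r) simp
    then show "fst (prod_decode z) = z - triangle (r z)" "snd (prod_decode z) = r z - (z - triangle (r z))"
      using t unfolding z prod_encode_inverse by simp_all
  qed
  have "computable1 (\<lambda>x. 0)" "computable3 (\<lambda>i acc x. acc + of_bool (triangle (Suc i) \<le> x))"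
    unfolding computable1_def computable3_def by (intro computable_intros; simp)+
  from computable_rec[OF this assms assms] have r: "computable k (\<lambda>xs. r (a xs))" unfolding r_def .
  then show "computable k (\<lambda>xs. fst (prod_decode (a xs)))" "computable k (\<lambda>xs. snd (prod_decode (a xs)))"
    unfolding dec by (intro computable_diff computable_triangle r assms)+
qed

section \<open>Computable operations on coded lists\<close>

definition lcons :: "nat \<Rightarrow> nat \<Rightarrow> nat" where "lcons x l = Suc (prod_encode (x, l))"
definition lhd :: "nat \<Rightarrow> nat" where "lhd l = fst (prod_decode (l - 1))"
definition ltl :: "nat \<Rightarrow> nat" where "ltl l = snd (prod_decode (l - 1))"

lemma computable_lcons [computable_intros]: "computable k a \<Longrightarrow> computable k b \<Longrightarrow> computable k (\<lambda>xs. lcons (a xs) (b xs))"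
  unfolding lcons_def by (intro computable_intros)

lemma computable_lhd [computable_intros]: "computable k a \<Longrightarrow> computable k (\<lambda>xs. lhd (a xs))"
  unfolding lhd_def by (intro computable_intros)

lemma computable_ltl [computable_intros]: "computable k a \<Longrightarrow> computable k (\<lambda>xs. ltl (a xs))"
  unfolding ltl_def by (intro computable_intros)

lemma lcons_list_encode [simp]: "lcons x (list_encode xs) = list_encode (x # xs)"
  by (simp add: lcons_def)

declare list_encode.simps(2) [simp del]

lemma lhd_ltl [simp]: "lhd (list_encode (x # xs)) = x" "ltl (list_encode (x # xs)) = list_encode xs"
  by (simp_all add: lhd_def ltl_def list_encode.simps(2))

text \<open>Iterating \<open>ltl\<close> beyond the end of a list thus stays at the code of the
  empty list.\<close>

lemma ltl_0 [simp]: "ltl 0 = 0"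
proof -
  have "prod_encode (0, 0) = 0" by (simp add: prod_encode_def)
  then have "prod_decode 0 = (0, 0)" using prod_encode_inverse[of "(0,0)"] by simp
  then show ?thesis by (simp add: ltl_def)
qed

lemma list_encode_eq_0 [simp]: "list_encode xs = 0 \<longleftrightarrow> xs = []"
  by (cases xs) (simp_all add: list_encode.simps(2))

lemma length_le_list_encode: "length xs \<le> list_encode xs"
proof (induction xs)
  case (Cons x xs)
  then show ?case using le_prod_encode_2[of "list_encode xs" x] by (simp add: list_encode.simps(2))
qed simp

text \<open>A loop on the pair of accumulator and remaining list. The number of iterations is the
  code of the list, which is at least its length; once the list is exhausted, the pair no longer
  changes.\<close>

lemma computable_foldl:
  assumes h: "computable2 h" and "computable k acc" "computable k l"
  shows "computable k (\<lambda>xs. foldl h (acc xs) (list_decode (l xs)))"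
proof -
  define st where "st p = (let a = fst (prod_decode p); l = snd (prod_decode p) in
    if l = 0 then p else prod_encode (h a (lhd l), ltl l))" for p
  have "computable1 st" unfolding computable1_def st_def Let_def by (intro computable_intros computable2D[OF h]; simp)
  then have "computable k (\<lambda>xs. fst (prod_decode ((st ^^ (l xs)) (prod_encode (acc xs, l xs)))))"
    using assms(2,3) by (intro computable_unpair computable_iter computable_pair)
  moreover have st0: "(st ^^ n) (prod_encode (a, 0)) = prod_encode (a, 0)" for n a
    by (induction n) (auto simp: st_def)
  have it: "(st ^^ n) (prod_encode (a, list_encode ys)) = prod_encode (foldl h a ys, 0)" if "length ys \<le> n" for n a ys
    using that
  proof (induction n arbitrary: a ys)
    case (Suc n)
    then show ?case
    proof (cases ys)
      case Nil
      then show ?thesis using st0[of "Suc n" a] by simp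
    next
      case (Cons z zs)
      then have "st (prod_encode (a, list_encode ys)) = prod_encode (h a z, list_encode zs)"
        by (simp add: st_def)
      then show ?thesis using Suc Cons by (simp add: funpow_Suc_right del: funpow.simps)
    qed
  qed simp
  have "fst (prod_decode ((st ^^ y) (prod_encode (a, y)))) = foldl h a (list_decode y)" for a y
    using it[OF length_le_list_encode[of "list_decode y"]] by simp
  ultimately show ?thesis by simp
qed

lemma computable_lrev [computable_intros]:
  assumes "computable k l" shows "computable k (\<lambda>xs. list_encode (rev (list_decode (l xs))))"
proof -
  have *: "foldl (\<lambda>a x. lcons x a) (list_encode zs) ys = list_encode (rev ys @ zs)" for ys zs
    by (induction ys arbitrary: zs) auto
  have "computable2 (\<lambda>a x. lcons x a)" unfolding computable2_def by (intro computable_intros; simp)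
  from computable_foldl[OF this computable_const[of k 0] assms] *[of "[]"] show ?thesis by simp
qed

lemma computable_ldrop [computable_intros]:
  assumes "computable k n" "computable k l" shows "computable k (\<lambda>xs. list_encode (drop (n xs) (list_decode (l xs))))"
proof -
  have 0: "(ltl ^^ n) 0 = 0" for n by (induction n) auto
  have *: "(ltl ^^ n) (list_encode ys) = list_encode (drop n ys)" for ys n
  proof (induction n arbitrary: ys)
    case (Suc n)
    then show ?case by (cases ys) (auto simp: funpow_Suc_right 0 simp del: funpow.simps)
  qed simp
  have "computable1 ltl" unfolding computable1_def by (intro computable_intros; simp)
  from computable_iter[OF this assms] *[of _ "list_decode _"] show ?thesis by simp
qed

lemma computable_llength [computable_intros]:
  assumes "computable k l" shows "computable k (\<lambda>xs. length (list_decode (l xs)))"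
proof -
  have *: "foldl (\<lambda>a x. Suc a) n ys = n + length ys" for n ys by (induction ys arbitrary: n) auto
  have "computable2 (\<lambda>a x. Suc a)" unfolding computable2_def by (intro computable_intros; simp)
  from computable_foldl[OF this computable_const[of k 0] assms] show ?thesis by (simp add: *)
qed

text \<open>Taking is dropping from the reversed list.\<close>

lemma computable_ltake [computable_intros]:
  assumes "computable k n" "computable k l" shows "computable k (\<lambda>xs. list_encode (take (n xs) (list_decode (l xs))))"
proof -
  have "computable k (\<lambda>xs. list_encode (rev (list_decode (list_encode (drop (length (list_decode (l xs)) - n xs)
    (list_decode (list_encode (rev (list_decode (l xs))))))))))"
    using assms by (intro computable_lrev computable_ldrop computable_diff computable_llength)
  moreover have "rev (drop (length ys - n) (rev ys)) = take n ys" for n and ys :: "nat list"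
    by (metis rev_drop rev_rev_ident length_rev diff_diff_cancel nat_le_linear take_all_iff diff_is_0_eq' drop0)
  ultimately show ?thesis by simp
qed

lemma lhd_drop: "n < length ys \<Longrightarrow> lhd (list_encode (drop n ys)) = ys ! n"
  by (metis Cons_nth_drop_Suc lhd_ltl(1))

lemma recursive_set_iff: "recursive_set R \<longleftrightarrow> decidable 1 (\<lambda>xs. xs ! 0 \<in> R)"
proof -
  have "(\<forall>n. evalr f [n] (if n \<in> R then 1 else 0)) \<longleftrightarrow>
    (\<forall>xs. length xs = 1 \<longrightarrow> evalr f xs (of_bool (xs ! 0 \<in> R)))" (is "?l \<longleftrightarrow> ?r") for f
  proof
    assume l: ?l
    show ?r
    proof (intro allI impI)
      fix xs :: "nat list" assume "length xs = 1"
      then obtain n where "xs = [n]" by (metis One_nat_def length_0_conv length_Suc_conv)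
      then show "evalr f xs (of_bool (xs ! 0 \<in> R))" using l[rule_format, of n] by (simp add: of_bool_def)
    qed
  next
    assume r: ?r
    show ?l
    proof
      fix n show "evalr f [n] (if n \<in> R then 1 else 0)"
        using r[rule_format, of "[n]"] by (simp add: of_bool_def)
    qed
  qed
  then show ?thesis unfolding recursive_set_def decidable_def computable_def by simp
qed

section \<open>Register machines\<close>

datatype op = OZ | OI | OS | OP

fun apply_op :: "op \<Rightarrow> nat \<Rightarrow> nat" where
  "apply_op OZ x = 0" | "apply_op OI x = x" | "apply_op OS x = Suc x" | "apply_op OP x = x - 1"

text \<open>Each instruction both overwrites a register and branches, the test being evaluated
  before the overwriting. The uniform shape gives every register of the next configuration exactly
  one source register, which is what the counter will check.\<close>

datatype instr = Ins (dest: nat) (oper: op) (src: nat) (test: nat) (if_zero: nat) (if_nonzero: nat)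

type_synonym regs = "nat \<Rightarrow> nat"

fun machine_step :: "(nat \<Rightarrow> instr) \<Rightarrow> nat \<times> regs \<Rightarrow> nat \<times> regs" where
  "machine_step P (q, \<rho>) = (if \<rho> (test (P q)) = 0 then if_zero (P q) else if_nonzero (P q),
     \<rho>(dest (P q) := apply_op (oper (P q)) (\<rho> (src (P q)))))"

text \<open>\<open>D\<close> holds the labels at which steps are taken; the last label need not
  belong to it. In this way a run can be kept away from the reading and output labels and still end
  there.\<close>

definition machine_run :: "(nat \<Rightarrow> instr) \<Rightarrow> nat set \<Rightarrow> nat \<times> regs \<Rightarrow> nat \<times> regs \<Rightarrow> bool" where
  "machine_run P D = (\<lambda>c c'. fst c \<in> D \<and> c' = machine_step P c)\<^sup>*\<^sup>*"

definition code_at :: "(nat \<Rightarrow> instr) \<Rightarrow> nat \<Rightarrow> instr list \<Rightarrow> bool" where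
  "code_at P off cs \<longleftrightarrow> (\<forall>i<length cs. P (off + i) = cs ! i)"

lemma code_at_append: "code_at P off (cs @ cs') \<longleftrightarrow> code_at P off cs \<and> code_at P (off + length cs) cs'"
proof
  assume *: "code_at P off (cs @ cs')"
  have "P (off + length cs + i) = cs' ! i" if "i < length cs'" for i
    using *[unfolded code_at_def, rule_format, of "length cs + i"] that by (simp add: add.assoc)
  then show "code_at P off cs \<and> code_at P (off + length cs) cs'"
    using * unfolding code_at_def by (auto simp: nth_append)
next
  assume *: "code_at P off cs \<and> code_at P (off + length cs) cs'"
  show "code_at P off (cs @ cs')" unfolding code_at_def
  proof (intro allI impI)
    fix i assume "i < length (cs @ cs')"
    then show "P (off + i) = (cs @ cs') ! i"
      using * unfolding code_at_def by (cases "i < length cs") (auto simp: nth_append dest: spec[of _ "i - length cs"])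
  qed
qed

lemma code_at_single: "code_at P off [c] \<longleftrightarrow> P off = c"
  by (simp add: code_at_def)

lemma code_at_Cons: "code_at P off (c # cs) \<longleftrightarrow> P off = c \<and> code_at P (Suc off) cs"
  using code_at_append[of P off "[c]" cs] by (simp add: code_at_single)

lemma machine_run_refl: "machine_run P D c c"
  by (simp add: machine_run_def)

lemma machine_run_trans: "machine_run P D c c' \<Longrightarrow> machine_run P D c' c'' \<Longrightarrow> machine_run P D c c''"
  unfolding machine_run_def by (rule rtranclp_trans)

lemma machine_run_step: "fst c \<in> D \<Longrightarrow> machine_run P D (machine_step P c) c' \<Longrightarrow> machine_run P D c c'"
  unfolding machine_run_def by (rule converse_rtranclp_into_rtranclp) auto

lemma machine_run_mono: "machine_run P D c c' \<Longrightarrow> D \<subseteq> D' \<Longrightarrow> machine_run P D' c c'"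
  unfolding machine_run_def by (erule rtranclp_mono[THEN predicate2D, rotated]) auto

text \<open>Total-correctness triples for relocatable code; the parameter \<open>x\<close> is an auxiliary variable.\<close>

definition realizes ::
  "nat \<Rightarrow> instr list \<Rightarrow> ('x \<Rightarrow> regs \<Rightarrow> bool) \<Rightarrow> ('x \<Rightarrow> regs \<Rightarrow> bool) \<Rightarrow> bool" where
  "realizes off cs p q \<longleftrightarrow> (\<forall>P x \<rho>. code_at P off cs \<longrightarrow> p x \<rho> \<longrightarrow>
     (\<exists>\<rho>'. machine_run P {off..<off + length cs} (off, \<rho>) (off + length cs, \<rho>') \<and> q x \<rho>'))"

text \<open>Hiding the code behind an existential quantifier for every offset lets triples be
  composed without computing labels.\<close>

definition prog :: "('x \<Rightarrow> regs \<Rightarrow> bool) \<Rightarrow> ('x \<Rightarrow> regs \<Rightarrow> bool) \<Rightarrow> bool" where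
  "prog p q \<longleftrightarrow> (\<forall>off. \<exists>cs. realizes off cs p q)"

lemma realizesD:
  assumes "realizes off cs p q" "code_at P off cs" "p x \<rho>"
  obtains \<rho>' where "machine_run P {off..<off + length cs} (off, \<rho>) (off + length cs, \<rho>')" "q x \<rho>'"
  using assms unfolding realizes_def by blast

lemma prog_conseq:
  assumes "prog p q" "\<And>x' \<rho>. p' x' \<rho> \<Longrightarrow> \<exists>x. p x \<rho> \<and> (\<forall>\<rho>'. q x \<rho>' \<longrightarrow> q' x' \<rho>')"
  shows "prog p' q'"
  unfolding prog_def
proof
  fix off
  obtain cs where "realizes off cs p q" using assms(1) unfolding prog_def by blast
  then have "realizes off cs p' q'" unfolding realizes_def by (meson assms(2))
  then show "\<exists>cs. realizes off cs p' q'" ..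
qed

lemma prog_skip: "prog p p"
  unfolding prog_def realizes_def by (auto intro!: exI[of _ "[]"] machine_run_refl)

lemma prog_op: "prog (\<lambda>x \<rho>. q x (\<rho>(d := apply_op f (\<rho> s)))) q"
  unfolding prog_def
proof
  fix off
  have "machine_run P {off..<off + 1} (off, \<rho>) (off + 1, \<rho>(d := apply_op f (\<rho> s)))"
    if "P off = Ins d f s 0 (Suc off) (Suc off)" for P \<rho>
    by (rule machine_run_step) (simp_all add: that machine_run_refl)
  then have "realizes off [Ins d f s 0 (Suc off) (Suc off)] (\<lambda>x \<rho>. q x (\<rho>(d := apply_op f (\<rho> s)))) q"
    unfolding realizes_def by (force simp: code_at_single)
  then show "\<exists>cs. realizes off cs (\<lambda>x \<rho>. q x (\<rho>(d := apply_op f (\<rho> s)))) q" ..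
qed

lemma prog_assign:
  assumes "\<And>x \<rho>. p x \<rho> \<Longrightarrow> q x (\<rho>(d := apply_op f (\<rho> s)))" shows "prog p q"
  by (rule prog_conseq[OF prog_op[of q d f s]]) (use assms in blast)

lemma prog_False: "prog (\<lambda>x \<rho>. False) q"
  by (rule prog_conseq[OF prog_skip]) simp

lemma prog_seq:
  assumes "prog p q" "prog q r" shows "prog p r"
  unfolding prog_def
proof
  fix off
  obtain cs where cs: "realizes off cs p q" using assms(1) unfolding prog_def by blast
  let ?o = "off + length cs"
  obtain ds where ds: "realizes ?o ds q r" using assms(2) unfolding prog_def by blast
  have "realizes off (cs @ ds) p r" unfolding realizes_def
  proof (intro allI impI)
    fix P x \<rho> assume c: "code_at P off (cs @ ds)" and p: "p x \<rho>"
    let ?D = "{off..<off + length (cs @ ds)}"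
    obtain \<rho>1 where 1: "machine_run P {off..<?o} (off, \<rho>) (?o, \<rho>1)" "q x \<rho>1"
      using realizesD[OF cs _ p] c by (auto simp: code_at_append)
    obtain \<rho>2 where 2: "machine_run P {?o..<?o + length ds} (?o, \<rho>1) (?o + length ds, \<rho>2)" "r x \<rho>2"
      using realizesD[OF ds _ 1(2)] c by (auto simp: code_at_append)
    have "machine_run P ?D (off, \<rho>) (?o + length ds, \<rho>2)"
      by (rule machine_run_trans[OF machine_run_mono[OF 1(1)] machine_run_mono[OF 2(1)]]) auto
    then show "\<exists>\<rho>'. machine_run P ?D (off, \<rho>) (off + length (cs @ ds), \<rho>') \<and> r x \<rho>'"
      using 2(2) by (auto simp: add.assoc)
  qed
  then show "\<exists>cs. realizes off cs p r" ..
qed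

text \<open>The auxiliary variable is paired with \<open>n\<close>, the value of the measure
  \<open>m\<close> before the body, so that the postcondition of the body can demand a
  decrease.\<close>

lemma prog_while:
  assumes "prog (\<lambda>(x, n) \<rho>. I x \<rho> \<and> \<rho> t \<noteq> 0 \<and> (m x \<rho> :: nat) = n) (\<lambda>(x, n) \<rho>. I x \<rho> \<and> m x \<rho> < n)"
  shows "prog I (\<lambda>x \<rho>. I x \<rho> \<and> \<rho> t = 0)"
  unfolding prog_def
proof
  fix off
  let ?o = "Suc off"
  obtain cs where cs: "realizes ?o cs (\<lambda>(x, n) \<rho>. I x \<rho> \<and> \<rho> t \<noteq> 0 \<and> m x \<rho> = n) (\<lambda>(x, n) \<rho>. I x \<rho> \<and> m x \<rho> < n)"
    using assms unfolding prog_def by blast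
  define l where "l = length cs"
  \<comment> \<open>\<open>Ins 0 OI 0\<close> leaves all registers alone: the first instruction only
    tests, the last only jumps back.\<close>
  define prg where "prg = Ins 0 OI 0 t (?o + l + 1) ?o # cs @ [Ins 0 OI 0 0 off off]"
  have len: "off + length prg = ?o + l + 1" by (simp add: prg_def l_def)
  let ?D = "{off..<off + length prg}"
  have "realizes off prg I (\<lambda>x \<rho>. I x \<rho> \<and> \<rho> t = 0)" unfolding realizes_def
  proof (intro allI impI)
    fix P x \<rho> assume c: "code_at P off prg" and p: "I x \<rho>"
    from c have P0: "P off = Ins 0 OI 0 t (?o + l + 1) ?o" and c1: "code_at P ?o cs"
      and P1: "P (Suc (off + l)) = Ins 0 OI 0 0 off off"
      by (auto simp: code_at_append code_at_Cons code_at_single l_def prg_def)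
    have upd: "\<rho>(0 := \<rho> 0) = \<rho>" for \<rho> :: regs by simp
    from p show "\<exists>\<rho>'. machine_run P ?D (off, \<rho>) (off + length prg, \<rho>') \<and> I x \<rho>' \<and> \<rho>' t = 0"
    proof (induction "m x \<rho>" arbitrary: \<rho> rule: less_induct)
      case less
      show ?case
      proof (cases "\<rho> t = 0")
        case True
        then have "machine_run P ?D (off, \<rho>) (off + length prg, \<rho>)"
          by - (rule machine_run_step, simp_all add: P0 len upd machine_run_refl)
        then show ?thesis using True less by blast
      next
        case False
        obtain \<rho>1 where
          1: "machine_run P {?o..<?o + l} (?o, \<rho>) (?o + l, \<rho>1)" "I x \<rho>1" "m x \<rho>1 < m x \<rho>"
          using realizesD[OF cs c1, of "(x, m x \<rho>)" \<rho>] less.prems False unfolding l_def by auto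
        from less.hyps[OF 1(3,2)] obtain \<rho>2 where
          2: "machine_run P ?D (off, \<rho>1) (off + length prg, \<rho>2)" "I x \<rho>2" "\<rho>2 t = 0" by blast
        have "machine_run P ?D (?o + l, \<rho>1) (off + length prg, \<rho>2)"
          by (rule machine_run_step) (use 2(1) in \<open>simp_all add: P1 upd len\<close>)
        then have "machine_run P ?D (?o, \<rho>) (off + length prg, \<rho>2)"
          by (rule machine_run_trans[OF machine_run_mono[OF 1(1)], rotated]) (auto simp: len)
        then have "machine_run P ?D (off, \<rho>) (off + length prg, \<rho>2)"
          by - (rule machine_run_step, use False in \<open>simp_all add: P0 upd len\<close>)
        then show ?thesis using 2 by blast
      qed
    qed
  qed
  then show "\<exists>cs. realizes off cs I (\<lambda>x \<rho>. I x \<rho> \<and> \<rho> t = 0)" ..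
qed

section \<open>Compiling partial recursive functions\<close>

definition agree :: "nat \<Rightarrow> regs \<Rightarrow> regs \<Rightarrow> bool" where
  "agree b \<rho> \<rho>' \<longleftrightarrow> (\<forall>j<b. \<rho>' j = \<rho> j)"

text \<open>Registers from \<open>b\<close> on are scratch space. The value \<open>y\<close> belongs
  to the auxiliary variable, so termination is demanded only where the function is defined.\<close>

definition compiles :: "recf \<Rightarrow> nat list \<Rightarrow> nat \<Rightarrow> nat \<Rightarrow> bool" where
  "compiles r is out b \<longleftrightarrow> prog (\<lambda>(\<rho>0, y) \<rho>. \<rho> = \<rho>0 \<and> evalr r (map \<rho>0 is) y)
     (\<lambda>(\<rho>0, y) \<rho>. \<rho> out = y \<and> (\<forall>j<b. j \<noteq> out \<longrightarrow> \<rho> j = \<rho>0 j))"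

lemma compilesD:
  assumes "compiles r is out b"
    and "\<And>x \<rho>. p x \<rho> \<Longrightarrow> \<exists>y. evalr r (map \<rho> is) y \<and>
      (\<forall>\<rho>'. \<rho>' out = y \<longrightarrow> (\<forall>j<b. j \<noteq> out \<longrightarrow> \<rho>' j = \<rho> j) \<longrightarrow> q x \<rho>')"
  shows "prog p q"
  by (rule prog_conseq[OF assms(1)[unfolded compiles_def]]) (use assms(2) in \<open>fastforce\<close>)

text \<open>The intermediate values \<open>v\<close> become the auxiliary variable in the invariant
  of the compiled loop.\<close>

lemma evalr_Prim_trace:
  assumes "evalr (Prim f g) (n # xs) y"
  shows "\<exists>v. evalr f xs (v 0) \<and> (\<forall>i<n. evalr g (i # v i # xs) (v (Suc i))) \<and> v n = y"
  using assms
proof (induction n arbitrary: y)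
  case 0
  then have "evalr f xs y" by (cases rule: evalr.cases) auto
  then show ?case by (intro exI[of _ "\<lambda>_. y"]) auto
next
  case (Suc n)
  from Suc.prems obtain z where z: "evalr (Prim f g) (n # xs) z" "evalr g (n # z # xs) y"
    by (cases rule: evalr.cases) auto
  from Suc.IH[OF z(1)] obtain v where v: "evalr f xs (v 0)" "\<forall>i<n. evalr g (i # v i # xs) (v (Suc i))" "v n = z" by blast
  show ?case
    by (rule exI[of _ "v(Suc n := y)"]) (use v z(2) in \<open>auto simp: less_Suc_eq\<close>)
qed

text \<open>Induction on the function code. Intermediate results live from register \<open>b\<close>
  on, and subprograms are compiled with a larger bound, so they leave those results intact.\<close>

lemma compile:
  assumes "\<forall>i\<in>set is. i < b" "out < b"
  shows "compiles r is out b"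
  using assms
proof (induction r arbitrary: "is" out b)
  case Zero
  show ?case unfolding compiles_def
    by (rule prog_assign[where d = out and f = OZ and s = 0]) (auto elim: evalr.cases)
next
  case Succ
  show ?case
  proof (cases "is")
    case Nil
    then show ?thesis unfolding compiles_def
      by (intro prog_conseq[OF prog_False]) (auto elim: evalr.cases)
  next
    case (Cons i js)
    then show ?thesis unfolding compiles_def
      by (intro prog_assign[where d = out and f = OS and s = i]) (auto elim: evalr.cases)
  qed
next
  case (Proj n)
  show ?case
  proof (cases "n < length is")
    case False
    then show ?thesis unfolding compiles_def
      by (intro prog_conseq[OF prog_False]) (auto elim: evalr.cases)
  next
    case True
    then show ?thesis unfolding compiles_def
      by (intro prog_assign[where d = out and f = OI and s = "is ! n"]) (auto elim: evalr.cases)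
  qed
next
  case (Comp f gs)
  let ?n = "length gs"
  define J where "J l = (\<lambda>(\<rho>0, ys) \<rho>. agree b \<rho>0 \<rho> \<and> length ys = ?n \<and>
     (\<forall>i<?n. evalr (gs ! i) (map \<rho>0 is) (ys ! i)) \<and> (\<forall>i<l. \<rho> (b + i) = ys ! i))" for l
  have mp: "map \<rho> is = map \<rho>0 is" if "agree b \<rho>0 \<rho>" for \<rho> \<rho>0
    using that Comp.prems by (auto simp: agree_def)
  have comp: "compiles (gs ! l) is (b + l) (b + ?n)" if "l < ?n" for l
    using Comp.IH(2)[of "gs ! l"] that Comp.prems by (auto simp: less_SucI trans_less_add1)
  have step: "prog (J l) (J (Suc l))" if "l < ?n" for l
  proof (rule compilesD[OF comp[OF that]], goal_cases)
    case J: (1 x \<rho>)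
    obtain \<rho>0 ys where x: "x = (\<rho>0, ys)" by (cases x)
    show ?case
    proof (intro exI[of _ "ys ! l"] conjI allI impI)
      have "agree b \<rho>0 \<rho>" using J unfolding J_def x by simp
      then show "evalr (gs ! l) (map \<rho> is) (ys ! l)" using J that mp[of \<rho>0 \<rho>] unfolding J_def x by (simp del: map_eq_conv)
      fix \<rho>' assume \<rho>': "\<rho>' (b + l) = ys ! l" "\<forall>j<b + ?n. j \<noteq> b + l \<longrightarrow> \<rho>' j = \<rho> j"
      then show "J (Suc l) x \<rho>'" using J that unfolding J_def x by (auto simp: agree_def less_Suc_eq)
    qed
  qed
  have "prog (J 0) (J l)" if "l \<le> ?n" for l
    using that
  proof (induction l)
    case (Suc l)
    then show ?case using prog_seq[OF _ step[of l]] by simp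
  qed (rule prog_skip)
  then have all: "prog (J 0) (J ?n)" by simp
  have comp: "compiles f [b..<b + ?n] out (b + ?n)"
    using Comp.IH(1) Comp.prems by auto
  have fin: "prog (\<lambda>((\<rho>0, ys), z) \<rho>. J ?n (\<rho>0, ys) \<rho> \<and> evalr f ys z)
     (\<lambda>((\<rho>0, ys), z) \<rho>. \<rho> out = z \<and> (\<forall>j<b. j \<noteq> out \<longrightarrow> \<rho> j = \<rho>0 j))"
  proof (rule compilesD[OF comp], goal_cases)
    case (1 x \<rho>)
    obtain \<rho>0 ys z where x: "x = ((\<rho>0, ys), z)" by (metis prod.exhaust)
    from 1 have J: "J ?n (\<rho>0, ys) \<rho>" "evalr f ys z" unfolding x by auto
    have "map \<rho> [b..<b + ?n] = ys" using J(1) by (auto simp: J_def intro!: nth_equalityI)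
    then show ?case using J by (intro exI[of _ z]) (auto simp: x J_def agree_def)
  qed
  have all': "prog (\<lambda>((\<rho>0, ys), z) \<rho>. J 0 (\<rho>0, ys) \<rho> \<and> evalr f ys z)
     (\<lambda>((\<rho>0, ys), z) \<rho>. J ?n (\<rho>0, ys) \<rho> \<and> evalr f ys z)"
    by (rule prog_conseq[OF all]) auto
  show ?case unfolding compiles_def
  proof (rule prog_conseq[OF prog_seq[OF all' fin]], goal_cases)
    case (1 x' \<rho>)
    obtain \<rho>0 z where x': "x' = (\<rho>0, z)" by (cases x')
    with 1 have "\<rho> = \<rho>0" "evalr (Comp f gs) (map \<rho>0 is) z" by auto
    from this(2) obtain ys where ys: "list_all2 (\<lambda>g y. evalr g (map \<rho>0 is) y) gs ys" "evalr f ys z"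
      by (cases rule: evalr.cases) auto
    then show ?case
      using \<open>\<rho> = \<rho>0\<close> by (intro exI[of _ "((\<rho>0, ys), z)"]) (auto simp: x' J_def agree_def list_all2_conv_all_nth)
  qed
next
  case (Prim f g)
  show ?case
  proof (cases "is")
    case Nil
    then show ?thesis unfolding compiles_def
      by (intro prog_conseq[OF prog_False]) (auto elim: evalr.cases)
  next
    case (Cons i0 js)
    have mp: "map \<rho> js = map \<rho>0 js" "\<rho> i0 = \<rho>0 i0" if "agree b \<rho>0 \<rho>" for \<rho> \<rho>0
      using that Prim.prems Cons by (auto simp: agree_def)
    define A where "A = (\<lambda>(\<rho>0, v) \<rho>. agree b \<rho>0 \<rho> \<and> evalr f (map \<rho>0 js) (v 0) \<and>
       (\<forall>i<\<rho>0 i0. evalr g (i # v i # map \<rho>0 js) (v (Suc i))))"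
    \<comment> \<open>Register \<open>b\<close> counts up, \<open>b + 1\<close> holds the current
      value, \<open>b + 2\<close> the number of rounds left; \<open>b + 3\<close> later receives the
      next value before it is copied.\<close>
    define I where "I = (\<lambda>(\<rho>0, v) \<rho>. A (\<rho>0, v) \<rho> \<and> \<rho> b + \<rho> (b + 2) = \<rho>0 i0 \<and> \<rho> (b + 1) = v (\<rho> b))"
    have p1: "prog A (\<lambda>x \<rho>. A x \<rho> \<and> \<rho> (b + 2) = fst x i0)"
      by (rule prog_assign[where d = "b + 2" and f = OI and s = i0])
        (auto simp: A_def agree_def mp[unfolded agree_def])
    have p2: "prog (\<lambda>x \<rho>. A x \<rho> \<and> \<rho> (b + 2) = fst x i0) (\<lambda>x \<rho>. A x \<rho> \<and> \<rho> (b + 2) = fst x i0 \<and> \<rho> b = 0)"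
      by (rule prog_assign[where d = b and f = OZ and s = 0])
        (auto simp: A_def agree_def)
    have comp: "compiles f js (b + 1) (b + 4)"
      using Prim.IH(1) Prim.prems Cons by (auto simp: less_SucI trans_less_add1)
    have p3: "prog (\<lambda>x \<rho>. A x \<rho> \<and> \<rho> (b + 2) = fst x i0 \<and> \<rho> b = 0) I"
    proof (rule compilesD[OF comp], goal_cases)
      case (1 x \<rho>)
      obtain \<rho>0 v where x: "x = (\<rho>0, v)" by (cases x)
      show ?case using 1 mp(1)[of \<rho>0 \<rho>]
        by (intro exI[of _ "v 0"]) (auto simp: x A_def I_def agree_def simp del: map_eq_conv)
    qed
    define m where "m = (\<lambda>(x :: regs \<times> (nat \<Rightarrow> nat)) (\<rho> :: regs). \<rho> (b + 2))"
    define B where "B = (\<lambda>((\<rho>0, v), n) \<rho>. A (\<rho>0, v) \<rho> \<and> Suc (\<rho> b) + n = Suc (\<rho>0 i0) \<and> 0 < n \<and> \<rho> (b + 2) = n \<and> \<rho> (b + 3) = v (Suc (\<rho> b)))"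
    define B1 where "B1 = (\<lambda>((\<rho>0, v), n) \<rho>. A (\<rho>0, v) \<rho> \<and> Suc (\<rho> b) + n = Suc (\<rho>0 i0) \<and> 0 < n \<and> \<rho> (b + 2) = n \<and> \<rho> (b + 1) = v (Suc (\<rho> b)))"
    define B2 where "B2 = (\<lambda>((\<rho>0, v), n) \<rho>. A (\<rho>0, v) \<rho> \<and> \<rho> b + n = Suc (\<rho>0 i0) \<and> 0 < n \<and> \<rho> (b + 2) = n \<and> \<rho> (b + 1) = v (\<rho> b))"
    have comp: "compiles g (b # (b + 1) # js) (b + 3) (b + 4)"
      using Prim.IH(2) Prim.prems Cons by (auto simp: less_SucI trans_less_add1)
    have l1: "prog (\<lambda>(x, n) \<rho>. I x \<rho> \<and> \<rho> (b + 2) \<noteq> 0 \<and> m x \<rho> = n) B"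
    proof (rule compilesD[OF comp], goal_cases)
      case (1 x \<rho>)
      obtain \<rho>0 v n where x: "x = ((\<rho>0, v), n)" by (metis prod.exhaust)
      with 1 have *: "I (\<rho>0, v) \<rho>" "\<rho> (b + 2) \<noteq> 0" "\<rho> (b + 2) = n" by (auto simp: m_def)
      then have ag: "agree b \<rho>0 \<rho>" by (simp add: I_def A_def)
      have "evalr g (\<rho> b # v (\<rho> b) # map \<rho>0 js) (v (Suc (\<rho> b)))" using * by (auto simp: I_def A_def)
      then show ?case using * mp(1)[OF ag]
        by (intro exI[of _ "v (Suc (\<rho> b))"]) (auto simp: x I_def A_def B_def agree_def simp del: map_eq_conv)
    qed
    have l2: "prog B B1"
      by (rule prog_assign[where d = "b + 1" and f = OI and s = "b + 3"])
        (auto simp: A_def B_def B1_def agree_def)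
    have l3: "prog B1 B2"
      by (rule prog_assign[where d = "b" and f = OS and s = "b"])
        (auto simp: A_def B2_def B1_def agree_def)
    have l4: "prog B2 (\<lambda>(x, n) \<rho>. I x \<rho> \<and> m x \<rho> < n)"
      by (rule prog_assign[where d = "b + 2" and f = OP and s = "b + 2"])
        (auto simp: A_def B2_def I_def m_def agree_def)
    have loop: "prog I (\<lambda>x \<rho>. I x \<rho> \<and> \<rho> (b + 2) = 0)"
      by (rule prog_while[OF prog_seq[OF prog_seq[OF prog_seq[OF l1 l2] l3] l4]])
    have p5: "prog (\<lambda>x \<rho>. I x \<rho> \<and> \<rho> (b + 2) = 0)
       (\<lambda>(\<rho>0, v) \<rho>. \<rho> out = v (\<rho>0 i0) \<and> (\<forall>j<b. j \<noteq> out \<longrightarrow> \<rho> j = \<rho>0 j))"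
      by (rule prog_assign[where d = out and f = OI and s = "b + 1"])
        (auto simp: A_def I_def agree_def)
    note P = prog_seq[OF prog_seq[OF prog_seq[OF prog_seq[OF p1 p2] p3] loop] p5]
    show ?thesis unfolding compiles_def
    proof (rule prog_conseq[OF P], goal_cases)
      case (1 x' \<rho>)
      obtain \<rho>0 z where x': "x' = (\<rho>0, z)" by (cases x')
      with 1 have *: "\<rho> = \<rho>0" "evalr (Prim f g) (\<rho>0 i0 # map \<rho>0 js) z" by (auto simp: Cons)
      from evalr_Prim_trace[OF *(2)] obtain v where v: "evalr f (map \<rho>0 js) (v 0)"
        "\<forall>i<\<rho>0 i0. evalr g (i # v i # map \<rho>0 js) (v (Suc i))" "v (\<rho>0 i0) = z" by blast
      show ?case
        by (rule exI[of _ "(\<rho>0, v)"]) (use v * in \<open>auto simp: A_def x' agree_def\<close>)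
    qed
  qed
next
  case (Mu f)
  have mp: "map \<rho> is = map \<rho>0 is" if "agree b \<rho>0 \<rho>" for \<rho> \<rho>0
    using that Mu.prems by (auto simp: agree_def)
  \<comment> \<open>\<open>v\<close> lists the values at the candidates up to the least zero
    \<open>n\<close>. The candidate is kept in register \<open>b\<close>, its value in
    \<open>b + 1\<close>, and \<open>n - \<rho> b\<close> decreases.\<close>
  define A where "A = (\<lambda>((\<rho>0 :: regs), v :: nat \<Rightarrow> nat, n :: nat) \<rho>. agree b \<rho>0 \<rho> \<and> \<rho> b \<le> n \<and> v n = 0 \<and>
     (\<forall>i<n. 0 < v i) \<and> (\<forall>i\<le>n. evalr f (i # map \<rho>0 is) (v i)))"
  define I where "I = (\<lambda>(\<rho>0, v, n) \<rho>. A (\<rho>0, v, n) \<rho> \<and> \<rho> (b + 1) = v (\<rho> b))"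
  define m where "m = (\<lambda>(\<rho>0 :: regs, v :: nat \<Rightarrow> nat, n) (\<rho> :: regs). n - \<rho> b)"
  define p where "p = (\<lambda>((\<rho>0 :: regs), v :: nat \<Rightarrow> nat, n :: nat) \<rho>. \<rho> = \<rho>0 \<and> v n = 0 \<and>
     (\<forall>i<n. 0 < v i) \<and> (\<forall>i\<le>n. evalr f (i # map \<rho>0 is) (v i)))"
  have comp: "compiles f (b # is) (b + 1) (b + 2)"
    using Mu.IH Mu.prems by (auto simp: less_SucI trans_less_add1)
  have p1: "prog p A"
    by (rule prog_assign[where d = b and f = OZ and s = 0])
      (auto simp: A_def p_def agree_def)
  have p2: "prog A I"
  proof (rule compilesD[OF comp], goal_cases)
    case (1 x \<rho>)
    obtain \<rho>0 v n where x: "x = (\<rho>0, v, n)" by (metis prod.exhaust)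
    show ?case using 1 mp[of \<rho>0 \<rho>]
      by (intro exI[of _ "v (\<rho> b)"]) (auto simp: x A_def I_def agree_def simp del: map_eq_conv)
  qed
  have l1: "prog (\<lambda>(x, n) \<rho>. I x \<rho> \<and> \<rho> (b + 1) \<noteq> 0 \<and> m x \<rho> = n) (\<lambda>(x, n) \<rho>. A x \<rho> \<and> m x \<rho> < n)"
  proof (rule prog_assign[where d = b and f = OS and s = b], goal_cases)
    case (1 x' \<rho>)
    moreover obtain \<rho>0 v n k where x': "x' = ((\<rho>0, v, n), k)" by (metis prod.exhaust)
    ultimately have *: "A (\<rho>0, v, n) \<rho>" "v (\<rho> b) \<noteq> 0" "n - \<rho> b = k" by (auto simp: I_def m_def)
    then have "\<rho> b \<noteq> n" by (auto simp: A_def)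
    then show ?case
      using * by (auto simp: x' A_def m_def agree_def)
  qed
  have l2: "prog (\<lambda>(x, n) \<rho>. A x \<rho> \<and> m x \<rho> < n) (\<lambda>(x, n) \<rho>. I x \<rho> \<and> m x \<rho> < n)"
  proof (rule compilesD[OF comp], goal_cases)
    case (1 x \<rho>)
    obtain \<rho>0 v n k where x: "x = ((\<rho>0, v, n), k)" by (metis prod.exhaust)
    show ?case using 1 mp[of \<rho>0 \<rho>]
      by (intro exI[of _ "v (\<rho> b)"]) (auto simp: x A_def I_def m_def agree_def simp del: map_eq_conv)
  qed
  have loop: "prog I (\<lambda>x \<rho>. I x \<rho> \<and> \<rho> (b + 1) = 0)"
    by (rule prog_while[OF prog_seq[OF l1 l2]])
  have p5: "prog (\<lambda>x \<rho>. I x \<rho> \<and> \<rho> (b + 1) = 0)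
     (\<lambda>(\<rho>0, v, n) \<rho>. \<rho> out = n \<and> (\<forall>j<b. j \<noteq> out \<longrightarrow> \<rho> j = \<rho>0 j))"
  proof (rule prog_assign[where d = out and f = OI and s = b], goal_cases)
    case (1 x' \<rho>)
    obtain \<rho>0 v n where x': "x' = (\<rho>0, v, n)" by (metis prod.exhaust)
    have "\<rho> b = n" using 1 by (auto simp: x' I_def A_def dest: le_neq_implies_less)
    then show ?case using 1 by (auto simp: x' I_def A_def agree_def)
  qed
  show ?case unfolding compiles_def
  proof (rule prog_conseq[OF prog_seq[OF prog_seq[OF prog_seq[OF p1 p2] loop] p5]], goal_cases)
    case (1 x' \<rho>)
    obtain \<rho>0 z where x': "x' = (\<rho>0, z)" by (cases x')
    with 1 have *: "\<rho> = \<rho>0" "evalr (Mu f) (map \<rho>0 is) z" by auto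
    from *(2) have 0: "evalr f (z # map \<rho>0 is) 0" and "\<forall>m<z. \<exists>y. evalr f (m # map \<rho>0 is) y \<and> y > 0"
      by (cases rule: evalr.cases; simp)+
    then obtain w where w: "\<forall>m<z. evalr f (m # map \<rho>0 is) (w m) \<and> w m > 0" by metis
    show ?case
      by (rule exI[of _ "(\<rho>0, w(z := 0), z)"]) (use w 0 * in \<open>auto simp: p_def x' le_less\<close>)
  qed
qed

lemma prog_computable:
  assumes "computable k F" "length rs = k" "\<forall>i\<in>set rs. i < b" "out < b"
    and "\<And>x \<rho> \<rho>'. p x \<rho> \<Longrightarrow> \<rho>' out = F (map \<rho> rs) \<Longrightarrow> (\<forall>j<b. j \<noteq> out \<longrightarrow> \<rho>' j = \<rho> j) \<Longrightarrow> q x \<rho>'"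
  shows "prog p q"
proof -
  obtain r where r: "\<And>xs. length xs = k \<Longrightarrow> evalr r xs (F xs)" using assms(1) unfolding computable_def by blast
  show ?thesis
  proof (rule compilesD[OF compile[OF assms(3,4), of r]])
    fix x \<rho> assume "p x \<rho>"
    then show "\<exists>y. evalr r (map \<rho> rs) y \<and> (\<forall>\<rho>'. \<rho>' out = y \<longrightarrow> (\<forall>j<b. j \<noteq> out \<longrightarrow> \<rho>' j = \<rho> j) \<longrightarrow> q x \<rho>')"
      using r[of "map \<rho> rs"] assms(2,5) by auto
  qed
qed

section \<open>A register machine as referee\<close>

text \<open>Modes for finding a mistake: \<open>Watch\<close> (not begun), \<open>Cnt e\<close>
  (counting the source of register \<open>e\<close>), \<open>Wt e f\<close> (waiting for, then
  checking, register \<open>e\<close> of the next configuration, which has begun iff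
  \<open>f\<close>), \<open>Done\<close>. Modes for following a path: \<open>Hold f\<close> (the
  node is in the counter; \<open>f\<close> marks an edge just completed), \<open>Take1\<close> and
  \<open>Take2\<close> (comparing with the first, loading the second component of an edge).\<close>

datatype mode = Watch | Cnt nat | Wt nat bool | Done | Hold bool | Take1 | Take2

text \<open>Label \<open>0\<close> is the reading state. Its instruction changes no register, so the
  passage over a reading is checked by the same rule as a machine step; \<open>entry\<close> turns
  the letters read into the label where the machine continues.\<close>

locale reg_machine =
  fixes P :: "nat \<Rightarrow> instr" and N k qo :: nat and entry :: "nat \<Rightarrow> nat \<Rightarrow> nat" and d :: "nat \<Rightarrow> nat"
  assumes k: "2 < k"
    and P0: "P 0 = Ins 0 OI 0 0 0 0"
    and regs: "\<And>q. q < N \<Longrightarrow> dest (P q) < k \<and> src (P q) < k \<and> test (P q) < k"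
    and labels: "\<And>q. q < N \<Longrightarrow> if_zero (P q) < N \<and> if_nonzero (P q) < N"
    and entry: "\<And>a b. entry (d a) (d b) < N"
    and N: "0 < N"
begin

definition start :: "nat \<times> regs \<Rightarrow> nat \<times> nat \<times> nat \<times> regs" where
  "start = (\<lambda>(q, \<rho>). (q, 0, \<rho> 0, \<rho>))"

text \<open>In state \<open>(q, i, m, \<rho>)\<close> Player 2 is writing register \<open>i\<close> of the configuration \<open>(q, \<rho>)\<close> in unary and
  still owes \<open>m\<close> ones; \<open>i = k\<close> means that two letters of the original game are to be read.\<close>

definition "at_read = (\<lambda>(q :: nat, i :: nat, m :: nat, \<rho> :: regs). i = k)"
definition "expects_one = (\<lambda>(q :: nat, i :: nat, m :: nat, \<rho> :: regs). 0 < m)"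
definition "advance = (\<lambda>(q, i, m, \<rho>). if 0 < m then (q, i, m - 1, \<rho>) else if Suc i < k then (q, Suc i, \<rho> (Suc i), \<rho>)
   else if q = 0 then (0, k, 0, \<rho>) else start (machine_step P (q, \<rho>)))"
definition "after_read = (\<lambda>(q :: nat, i :: nat, m :: nat, \<rho>) a b. start (entry a b, \<rho>))"

lemma at_read_eq: "at_read (q, i, m, \<rho>) \<longleftrightarrow> i = k"
  and expects_one_eq: "expects_one (q, i, m, \<rho>) \<longleftrightarrow> 0 < m"
  and advance_eq: "advance (q, i, m, \<rho>) = (if 0 < m then (q, i, m - 1, \<rho>) else if Suc i < k then (q, Suc i, \<rho> (Suc i), \<rho>)
    else if q = 0 then (0, k, 0, \<rho>) else start (machine_step P (q, \<rho>)))"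
  and after_read_eq: "after_read (q, i, m, \<rho>) a b = start (entry a b, \<rho>)"
  by (simp_all add: at_read_def expects_one_def advance_def after_read_def)

sublocale referee at_read expects_one advance after_read "start (0, \<lambda>_. 0)" d .

text \<open>Labels are not written in the play, so the finite control recomputes them. The Boolean
  remembers whether the block of the tested register contained a one, which decides the
  jump.\<close>

definition track_step :: "nat \<times> nat \<times> bool \<Rightarrow> nat \<Rightarrow> nat \<Rightarrow> nat \<times> nat \<times> bool" where
  "track_step = (\<lambda>(q, i, z) a b. if i = k then (entry (d a) (d b), 0, False)
     else if b = 1 then (q, i, z \<or> i = test (P q))
     else if Suc i < k then (q, Suc i, z)
     else if q = 0 then (0, k, False)
     else (if z then if_nonzero (P q) else if_zero (P q), 0, False))"

text \<open>What \<open>track_step\<close> knows in a play without mistakes: inside the tested block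
  a one has been seen iff fewer ones are owed than the register holds.\<close>

definition track :: "nat \<times> nat \<times> nat \<times> regs \<Rightarrow> nat \<times> nat \<times> bool" where
  "track = (\<lambda>(q, i, m, \<rho>). (q, i, i \<noteq> k \<and> (if i = test (P q) then m < \<rho> i else test (P q) < i \<and> \<rho> (test (P q)) \<noteq> 0)))"

definition wf_state :: "nat \<times> nat \<times> nat \<times> regs \<Rightarrow> bool" where
  "wf_state = (\<lambda>(q, i, m, \<rho>). q < N \<and> i \<le> k \<and> (i = k \<longrightarrow> q = 0) \<and> (i < k \<longrightarrow> m \<le> \<rho> i))"

definition source :: "nat \<Rightarrow> nat \<Rightarrow> nat" where "source q e = (if e = dest (P q) then src (P q) else e)"
definition operation :: "nat \<Rightarrow> nat \<Rightarrow> op" where "operation q e = (if e = dest (P q) then oper (P q) else OI)"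

lemma machine_step_reg: "snd (machine_step P (q, \<rho>)) e = apply_op (operation q e) (\<rho> (source q e))"
  by (simp add: source_def operation_def)

lemma source_less: "q < N \<Longrightarrow> e < k \<Longrightarrow> source q e < k"
  using regs by (simp add: source_def)

lemma source_0 [simp]: "source 0 e = e" and operation_0 [simp]: "operation 0 e = OI"
  by (simp_all add: source_def operation_def P0)

lemma wf_state_start: "fst c < N \<Longrightarrow> wf_state (start c)"
  using k by (cases c) (auto simp: wf_state_def start_def)

lemma wf_state_run: "wf_state (ref_run y n)"
proof (induction n)
  case 0
  then show ?case using N wf_state_start by simp
next
  case (Suc n)
  obtain q i m \<rho> where z: "ref_run y n = (q, i, m, \<rho>)" by (metis prod.exhaust)
  with Suc have o: "wf_state (q, i, m, \<rho>)" by simp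
  show ?case
  proof (cases "at_read (q, i, m, \<rho>)")
    case True
    then show ?thesis using z wf_state_start[of "(entry (d (y (2 * n))) (d (y (2 * n + 1))), \<rho>)"] entry by (simp add: after_read_eq)
  next
    case False
    have "fst (machine_step P (q, \<rho>)) < N" using o labels by (auto simp: wf_state_def)
    then have "wf_state (start (machine_step P (q, \<rho>)))" by (rule wf_state_start)
    then show ?thesis using z False o N by (auto simp: advance_eq at_read_eq wf_state_def)
  qed
qed

lemma track_advance:
  assumes "wf_state z" "\<not> at_read z" "(b = 1) = expects_one z"
  shows "track_step (track z) a b = track (advance z)"
proof -
  obtain q i m \<rho> where z: "z = (q, i, m, \<rho>)" by (metis prod.exhaust)
  have i: "i < k" "m \<le> \<rho> i" and q: "q < N" using assms by (auto simp: z wf_state_def at_read_eq)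
  have t: "test (P q) < k" using regs q by blast
  have st: "track (start (q', \<rho>')) = (q', 0, False)" for q' \<rho>'
    using k by (simp add: track_def start_def)
  show ?thesis
  proof (cases "0 < m")
    case True
    then show ?thesis using assms i k by (auto simp: z track_step_def track_def advance_eq expects_one_eq)
  next
    case False
    then have b: "b \<noteq> 1" using assms by (simp add: z expects_one_eq)
    show ?thesis
    proof (cases "Suc i < k")
      case True
      then show ?thesis using False b i by (auto simp: z track_step_def track_def advance_eq less_Suc_eq)
    next
      case False': False
      then have ik: "i = k - 1" "Suc i = k" using i by auto
      show ?thesis
      proof (cases "q = 0")
        case True
        then show ?thesis using False' False b i by (auto simp: z track_step_def track_def advance_eq)
      next
        case q0: False
        have "(if i = test (P q) then m < \<rho> i else test (P q) < i \<and> \<rho> (test (P q)) \<noteq> 0) \<longleftrightarrow> \<rho> (test (P q)) \<noteq> 0"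
          using t ik False by auto
        then show ?thesis using False False' b i q0 st by (auto simp: z track_step_def track_def advance_eq)
      qed
    qed
  qed
qed

lemma track_after_read: "at_read z \<Longrightarrow> track_step (track z) a b = track (after_read z (d a) (d b))"
  using k by (cases z) (auto simp: at_read_eq track_step_def track_def after_read_eq start_def)

text \<open>A mistake is caught by loading the expected value of a register and subtracting the ones
  written: \<open>Done\<close> is reached by a one at counter zero or by a block end at positive
  counter, and the run dies if the numbers agree. Counting and comparing start only at a block
  boundary, that is, after a reading or a letter other than one.\<close>

fun mode_step :: "nat \<times> nat \<times> bool \<Rightarrow> mode \<Rightarrow> bool \<Rightarrow> nat \<Rightarrow> nat \<times> nat \<times> bool \<Rightarrow> mode \<Rightarrow> int \<Rightarrow> bool" where
  "mode_step (q, i, z) Watch pos b (q', i', z') mo' j \<longleftrightarrow> j = 0 \<and> (mo' = Watch \<or>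
     (i = k \<or> b \<noteq> 1) \<and> (\<exists>e<k. mo' = Cnt e \<and> i' = source q' e))"
| "mode_step (q, i, z) (Cnt e) pos b (q', i', z') mo' j \<longleftrightarrow>
     (if b = 1 then mo' = Cnt e \<and> j = (if operation q e = OZ then 0 else 1)
      else mo' = Wt e (i' = 0) \<and> j = (case operation q e of OS \<Rightarrow> 1 | OP \<Rightarrow> -1 | _ \<Rightarrow> 0))"
| "mode_step (q, i, z) (Wt e f) pos b (q', i', z') mo' j \<longleftrightarrow>
     (if \<not> f then mo' = Wt e (i' = 0) \<and> j = 0
      else if i \<noteq> e then mo' = Wt e True \<and> j = 0
      else if b = 1 then (if pos then mo' = Wt e True \<and> j = -1 else mo' = Done \<and> j = 0)
      else pos \<and> mo' = Done \<and> j = 0)"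
| "mode_step tr Done pos b tr' mo' j \<longleftrightarrow> mo' = Done \<and> j = 0"
| "mode_step (q, i, z) (Hold f) pos b (q', i', z') mo' j \<longleftrightarrow> j = 0 \<and> (mo' = Hold False \<or>
     (i = k \<or> b \<noteq> 1) \<and> i' = 0 \<and> q' = qo \<and> mo' = Take1)"
| "mode_step tr Take1 pos b tr' mo' j \<longleftrightarrow>
     (if b = 1 then pos \<and> mo' = Take1 \<and> j = -1 else \<not> pos \<and> mo' = Take2 \<and> j = 0)"
| "mode_step tr Take2 pos b tr' mo' j \<longleftrightarrow>
     (if b = 1 then mo' = Take2 \<and> j = 1 else mo' = Hold True \<and> j = 0)"

definition delta where
  "delta x pos a b x' j \<longleftrightarrow> fst x' = track_step (fst x) a b \<and> mode_step (fst x) (snd x) pos b (fst x') (snd x') j"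

text \<open>With counter 0, \<open>Wt e True\<close> checks that register \<open>e\<close> of the
  first configuration is zero. \<open>Cnt 0\<close> is listed because block 0 of that configuration
  has no boundary before it at which \<open>Watch\<close> could start counting.\<close>

definition init :: "(nat \<times> nat \<times> bool) \<times> mode \<Rightarrow> bool" where
  "init x \<longleftrightarrow> fst x = (0, 0, False) \<and> (snd x = Watch \<or> snd x = Hold False \<or>
  snd x = Cnt 0 \<or> (\<exists>e<k. snd x = Wt e True))"

definition final :: "(nat \<times> nat \<times> bool) \<times> mode \<Rightarrow> bool" where
  "final x \<longleftrightarrow> snd x = Done \<or> snd x = Hold True"

text \<open>The counter contents as long as no mistake has occurred. \<open>Done\<close> is
  excluded, so preservation of this invariant means that no mistake is reported without cause;
  \<open>mode_inv_reach\<close> gives the converse, that the situations described can all arise in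
  the mistake-finding modes.\<close>

definition mode_inv :: "nat \<times> nat \<times> nat \<times> regs \<Rightarrow> mode \<Rightarrow> nat \<Rightarrow> bool" where
  "mode_inv = (\<lambda>(q, i, m, \<rho>) mo c. case mo of Watch \<Rightarrow> c = 0
     | Cnt e \<Rightarrow> e < k \<and> i = source q e \<and> c = (if operation q e = OZ then 0 else \<rho> i - m)
     | Wt e f \<Rightarrow> e < k \<and> (if f then i \<le> e \<and> c = (if i = e then m else \<rho> e)
         else source q e < i \<and> c = apply_op (operation q e) (\<rho> (source q e)))
     | Done \<Rightarrow> False
     | _ \<Rightarrow> True)"

text \<open>The case split behind all invariants below: without a mistake the letter of Player 2 in
  a writing round is forced, which leaves five shapes for the successor.\<close>

lemma round_cases:
  assumes o: "wf_state z" and noerr: "\<not> at_read z \<longrightarrow> (b = 1) = expects_one z"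
    and z': "z' = (if at_read z then after_read z (d a) (d b) else advance z)"
  obtains (one) q i m \<rho> where "z = (q, i, Suc m, \<rho>)" "z' = (q, i, m, \<rho>)" "b = 1" "i < k" "Suc m \<le> \<rho> i" "q < N"
  | (block) q i \<rho> where "z = (q, i, 0, \<rho>)" "z' = (q, Suc i, \<rho> (Suc i), \<rho>)" "b \<noteq> 1" "Suc i < k" "q < N"
  | (wait) i \<rho> where "z = (0, i, 0, \<rho>)" "z' = (0, k, 0, \<rho>)" "b \<noteq> 1" "Suc i = k"
  | (config) q i \<rho> q' \<rho>' where "z = (q, i, 0, \<rho>)" "z' = (q', 0, \<rho>' 0, \<rho>')" "b \<noteq> 1" "Suc i = k" "q \<noteq> 0" "q < N"
      "\<And>e. \<rho>' e = apply_op (operation q e) (\<rho> (source q e))"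
  | (read) m q' \<rho> where "z = (0, k, m, \<rho>)" "z' = (q', 0, \<rho> 0, \<rho>)" "q' < N"
proof -
  obtain q i m \<rho> where z: "z = (q, i, m, \<rho>)" by (metis prod.exhaust)
  have wf_state: "q < N" "i \<le> k" "i = k \<longrightarrow> q = 0" "i < k \<longrightarrow> m \<le> \<rho> i" using o by (auto simp: z wf_state_def)
  show thesis
  proof (cases "i = k")
    case True
    then show ?thesis using read[of m \<rho>] wf_state z z' entry by (auto simp: at_read_eq after_read_eq start_def)
  next
    case False
    then have i: "i < k" using wf_state by simp
    have z'2: "z' = advance z" and b: "(b = 1) = (0 < m)" using False noerr z' by (auto simp: z at_read_eq expects_one_eq)
    show ?thesis
    proof (cases m)
      case (Suc m')
      then show ?thesis using one[of q i m' \<rho>] z z'2 b i wf_state by (auto simp: advance_eq)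
    next
      case 0
      show ?thesis
      proof (cases "Suc i < k")
        case True
        then show ?thesis using block[of q i \<rho>] z z'2 b i wf_state 0 by (auto simp: advance_eq)
      next
        case False
        then have ik: "Suc i = k" using i by simp
        show ?thesis
        proof (cases "q = 0")
          case True
          then show ?thesis using wait[of i \<rho>] z z'2 b ik 0 by (auto simp: advance_eq)
        next
          case q: False
          obtain q' \<rho>' where ms: "machine_step P (q, \<rho>) = (q', \<rho>')" by (metis prod.exhaust)
          have "\<rho>' e = apply_op (operation q e) (\<rho> (source q e))" for e using machine_step_reg[of q \<rho> e] ms by (simp del: machine_step.simps)
          moreover have "z' = (q', 0, \<rho>' 0, \<rho>')" using z z'2 0 ik q ms by (simp add: advance_eq start_def del: machine_step.simps)
          ultimately show ?thesis using config[of q i \<rho> q' \<rho>'] z b ik q wf_state 0 by blast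
        qed
      qed
    qed
  qed
qed

lemma apply_op_adjust:
  "nat (int (if f = OZ then 0 else x) + (case f of OS \<Rightarrow> 1 | OP \<Rightarrow> -1 | _ \<Rightarrow> 0)) = apply_op f x"
  by (cases f) auto

lemma mode_inv_step:
  assumes o: "wf_state z" and noerr: "\<not> at_read z \<longrightarrow> (b = 1) = expects_one z"
    and z': "z' = (if at_read z then after_read z (d a) (d b) else advance z)"
    and mode_inv: "mode_inv z mo c" and mode_step: "mode_step (track z) mo (c \<noteq> 0) b (track z') mo' j"
  shows "mode_inv z' mo' (nat (int c + j))"
  using o noerr z'
proof (cases rule: round_cases)
  case (one q i m \<rho>)
  with mode_inv mode_step show ?thesis
    by (cases mo) (auto simp: track_def mode_inv_def Suc_diff_le split: if_splits)
next
  case (block q i \<rho>)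
  with mode_inv mode_step show ?thesis
    by (cases mo) (auto simp: track_def mode_inv_def apply_op_adjust[symmetric] split: if_splits)
next
  case (wait i \<rho>)
  with mode_inv mode_step show ?thesis
    by (cases mo) (auto simp: track_def mode_inv_def split: if_splits)
next
  case (config q i \<rho> q' \<rho>')
  have "source q e < k" if "e < k" for e using source_less config that by blast
  with config mode_inv mode_step show ?thesis
    by (cases mo) (auto simp: track_def mode_inv_def apply_op_adjust[symmetric] split: if_splits)
next
  case (read m q' \<rho>)
  with mode_inv mode_step show ?thesis
    by (cases mo) (auto simp: track_def mode_inv_def split: if_splits)
qed

definition watching :: "mode \<Rightarrow> bool" where
  "watching mo \<longleftrightarrow> (case mo of Watch \<Rightarrow> True | Cnt e \<Rightarrow> True | Wt e f \<Rightarrow> True | _ \<Rightarrow> False)"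

text \<open>Undoing one step recovers the earlier counter contents. Going backwards, a run into a
  prescribed mode can be built without deciding in advance when to start counting.\<close>

lemma mode_inv_reach:
  assumes o: "wf_state z" and noerr: "\<not> at_read z \<longrightarrow> (b = 1) = expects_one z"
    and z': "z' = (if at_read z then after_read z (d a) (d b) else advance z)"
    and mode_inv: "mode_inv z' mo' c'" and w: "watching mo'"
  shows "\<exists>mo c j. mode_inv z mo c \<and> watching mo \<and> mode_step (track z) mo (c \<noteq> 0) b (track z') mo' j \<and> c' = nat (int c + j)"
proof (cases mo')
  case Watch
  then show ?thesis using mode_inv
    by (intro exI[of _ Watch] exI[of _ 0]) (auto simp: mode_inv_def watching_def track_def split: prod.splits)
next
  case (Cnt e)
  from o noerr z' show ?thesis
  proof (cases rule: round_cases)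
    case (one q i m \<rho>)
    then show ?thesis using mode_inv Cnt
      by (intro exI[of _ "Cnt e"] exI[of _ "if operation q e = OZ then 0 else \<rho> i - Suc m"] exI[of _ "if operation q e = OZ then 0 else 1"])
        (auto simp: mode_inv_def watching_def track_def)
  next
    case (block q i \<rho>)
    then show ?thesis using mode_inv Cnt
      by (intro exI[of _ Watch] exI[of _ 0]) (auto simp: mode_inv_def watching_def track_def)
  next
    case (wait i \<rho>)
    then show ?thesis using mode_inv Cnt by (auto simp: mode_inv_def)
  next
    case (config q i \<rho> q' \<rho>')
    then show ?thesis using mode_inv Cnt
      by (intro exI[of _ Watch] exI[of _ 0]) (auto simp: mode_inv_def watching_def track_def)
  next
    case (read m q' \<rho>)
    then show ?thesis using mode_inv Cnt
      by (intro exI[of _ Watch] exI[of _ 0]) (auto simp: mode_inv_def watching_def track_def)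
  qed
next
  case (Wt e f)
  from o noerr z' show ?thesis
  proof (cases rule: round_cases)
    case (one q i m \<rho>)
    show ?thesis
    proof (cases "f \<and> i = e")
      case True
      then show ?thesis using mode_inv Wt one
        by (intro exI[of _ "Wt e True"] exI[of _ "Suc m"] exI[of _ "-1"]) (auto simp: mode_inv_def watching_def track_def)
    next
      case False
      then show ?thesis using mode_inv Wt one
        by (intro exI[of _ "Wt e f"] exI[of _ c'] exI[of _ 0]) (auto simp: mode_inv_def watching_def track_def)
    qed
  next
    case (block q i \<rho>)
    show ?thesis
    proof (cases "\<not> f \<and> i = source q e")
      case True
      then show ?thesis using mode_inv Wt block
        by (intro exI[of _ "Cnt e"] exI[of _ "if operation q e = OZ then 0 else \<rho> i"] exI[of _ "case operation q e of OS \<Rightarrow> 1 | OP \<Rightarrow> -1 | _ \<Rightarrow> 0"])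
          (auto simp: mode_inv_def watching_def track_def apply_op_adjust)
    next
      case False
      then show ?thesis using mode_inv Wt block
        by (intro exI[of _ "Wt e f"] exI[of _ c'] exI[of _ 0]) (auto simp: mode_inv_def watching_def track_def)
    qed
  next
    case (wait i \<rho>)
    have f: "\<not> f" using mode_inv wait Wt by (auto simp: mode_inv_def)
    show ?thesis
    \<comment> \<open>At label 0 every register is its own source; its block is the one just ended
      precisely if \<open>e\<close> is the last register.\<close>
    proof (cases "i = e")
      case True
      then show ?thesis using mode_inv Wt wait f k
        by (intro exI[of _ "Cnt e"] exI[of _ "\<rho> i"] exI[of _ 0])
          (auto simp: mode_inv_def watching_def track_def)
    next
      case False
      then show ?thesis using mode_inv Wt wait f k
        by (intro exI[of _ "Wt e False"] exI[of _ c'] exI[of _ 0]) (auto simp: mode_inv_def watching_def track_def)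
    qed
  next
    case (config q i \<rho> q' \<rho>')
    have f: "f" "e < k" using mode_inv config Wt by (auto simp: mode_inv_def split: if_splits)
    then have source: "source q e < k" using source_less config by blast
    show ?thesis
    proof (cases "i = source q e")
      case True
      then show ?thesis using mode_inv Wt config f
        by (intro exI[of _ "Cnt e"] exI[of _ "if operation q e = OZ then 0 else \<rho> i"] exI[of _ "case operation q e of OS \<Rightarrow> 1 | OP \<Rightarrow> -1 | _ \<Rightarrow> 0"])
          (auto simp: mode_inv_def watching_def track_def apply_op_adjust)
    next
      case False
      then show ?thesis using mode_inv Wt config f source
        by (intro exI[of _ "Wt e False"] exI[of _ c'] exI[of _ 0]) (auto simp: mode_inv_def watching_def track_def)
    qed
  next
    case (read m q' \<rho>)
    have f: "f" "e < k" using mode_inv read Wt by (auto simp: mode_inv_def split: if_splits)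
    then show ?thesis using mode_inv Wt read
      by (intro exI[of _ "Wt e False"] exI[of _ c'] exI[of _ 0]) (auto simp: mode_inv_def watching_def track_def split: if_splits)
  qed
qed (use w in \<open>auto simp: watching_def\<close>)

end

section \<open>The one-counter automaton supervising the machine\<close>

context reg_machine begin

definition states :: "((nat \<times> nat \<times> bool) \<times> mode) set" where
  "states = ({..<N} \<times> {..k} \<times> UNIV) \<times> ({Watch, Done, Take1, Take2} \<union> range Hold \<union> Cnt ` {..<k} \<union>
     (\<lambda>(e, f). Wt e f) ` ({..<k} \<times> UNIV))"

lemma track_step_closed: "tr \<in> {..<N} \<times> {..k} \<times> UNIV \<Longrightarrow> track_step tr a b \<in> {..<N} \<times> {..k} \<times> UNIV"
  using entry labels N by (auto simp: track_step_def split: prod.splits)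

lemma mode_step_closed:
  assumes "mode_step tr mo pos b tr' mo' j" "(tr, mo) \<in> states"
  shows "mo' \<in> snd ` states \<and> j \<in> {-1, 0, 1}"
proof -
  have *: "snd ` states = {Watch, Done, Take1, Take2} \<union> range Hold \<union> Cnt ` {..<k} \<union>
     (\<lambda>(e, f). Wt e f) ` ({..<k} \<times> UNIV)"
    unfolding states_def using N by (subst snd_image_times) auto
  have mo: "mo \<in> snd ` states" using assms(2) by force
  obtain q i z where tr: "tr = (q, i, z)" by (metis prod.exhaust)
  obtain q' i' z' where tr': "tr' = (q', i', z')" by (metis prod.exhaust)
  show ?thesis
    using assms(1) mo unfolding * tr tr'
    by (cases mo) (auto split: if_splits op.splits)
qed

lemma lang_BCL:
  assumes "finite X"
  shows "BCL 1 X {y \<in> omega_words X. round_accepts delta init final y}"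
proof (rule BCL_1_round[OF assms, of states])
  have "finite ((\<lambda>(e, f). Wt e f) ` ({..<k} \<times> (UNIV :: bool set)))"
    by (intro finite_imageI finite_cartesian_product) auto
  then show "finite states" unfolding states_def by auto
  show "p \<in> states" if "init p" for p
    using that N k unfolding init_def states_def by (cases p) auto
  fix p pos a b p' j assume *: "delta p pos a b p' j" "p \<in> states"
  obtain tr mo tr' mo' where p: "p = (tr, mo)" "p' = (tr', mo')" by (metis prod.exhaust)
  have "mode_step tr mo pos b tr' mo' j" "tr' = track_step tr a b" using *(1) by (auto simp: delta_def p)
  moreover from this(1) *(2) have "mo' \<in> snd ` states \<and> j \<in> {-1, 0, 1}" unfolding p by (rule mode_step_closed)
  moreover have "tr \<in> {..<N} \<times> {..k} \<times> UNIV" using *(2) by (auto simp: p states_def)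
  ultimately show "p' \<in> states \<and> j \<in> {-1, 0, 1}"
    using track_step_closed[of tr a b] unfolding p states_def by force
qed

lemma track_z0: "track (start (0, \<lambda>_. 0)) = (0, 0, False)"
  by (simp add: track_def start_def P0)

lemma mode_inv_z0: "init (tr, mo) \<Longrightarrow> mode_inv (start (0, \<lambda>_. 0)) mo 0"
  and init_z0: "mode_inv (start (0, \<lambda>_. 0)) mo c \<Longrightarrow> watching mo \<Longrightarrow> init ((0, 0, False), mo) \<and> c = 0"
  using k by (auto simp: init_def mode_inv_def start_def watching_def split: mode.splits if_splits)

lemma track_step_run:
  assumes "\<not> at_read (ref_run y n) \<longrightarrow> (y (2*n+1) = 1) = expects_one (ref_run y n)"
  shows "track_step (track (ref_run y n)) (y (2*n)) (y (2*n+1)) = track (ref_run y (Suc n))"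
  using assms track_advance[OF wf_state_run] track_after_read by auto

lemma round_stepI:
  assumes "\<not> at_read (ref_run y n) \<longrightarrow> (y (2*n+1) = 1) = expects_one (ref_run y n)"
    and "mode_step (track (ref_run y n)) mo (c \<noteq> 0) (y (2*n+1)) (track (ref_run y (Suc n))) mo' j"
    and "c' = nat (int c + j)"
  shows "round_step delta y n ((track (ref_run y n), mo), c) ((track (ref_run y (Suc n)), mo'), c')"
  unfolding round_step_def delta_def using assms(2,3) track_step_run[OF assms(1)] by (intro exI[of _ j]) simp

text \<open>At the first mistake, in block \<open>i\<close> with \<open>m\<close> ones owed, mode
  \<open>Wt i True\<close> with counter \<open>m\<close> is reachable, and the wrong letter leads to
  \<open>Done\<close>: it is a one although nothing is owed, or a block end although something
  is.\<close>

lemma err_accepts: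
  assumes "ref_err y" shows "round_accepts delta init final y"
proof -
  let ?Z = "ref_run y"
  define n where "n = (LEAST n. \<not> at_read (?Z n) \<and> (y (2*n+1) = 1) \<noteq> expects_one (?Z n))"
  have n: "\<not> at_read (?Z n)" "(y (2*n+1) = 1) \<noteq> expects_one (?Z n)"
    using LeastI_ex[OF assms[unfolded ref_err_def]] unfolding n_def by auto
  have noerr: "\<not> at_read (?Z l) \<longrightarrow> (y (2*l+1) = 1) = expects_one (?Z l)" if "l < n" for l
    using not_less_Least[OF that[unfolded n_def]] by blast
  have reach: "\<exists>p. init p \<and> round_path delta y 0 (p, 0) l ((track (?Z l), mo), c)"
    if "l \<le> n" "mode_inv (?Z l) mo c" "watching mo" for l mo c
    using that
  proof (induction l arbitrary: mo c)
    case 0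
    have "init (track (?Z 0), mo)" "c = 0" using 0 init_z0[of mo c] track_z0 by simp_all
    then show ?case using round_path_refl by blast
  next
    case (Suc l)
    then have ne: "\<not> at_read (?Z l) \<longrightarrow> (y (2*l+1) = 1) = expects_one (?Z l)" using noerr by simp
    obtain mo0 c0 j where p: "mode_inv (?Z l) mo0 c0" "watching mo0"
      "mode_step (track (?Z l)) mo0 (c0 \<noteq> 0) (y (2*l+1)) (track (?Z (Suc l))) mo j" "c = nat (int c0 + j)"
      using mode_inv_reach[OF wf_state_run ne _ Suc.prems(2,3), of "y (2*l)"] by auto
    then obtain q where "init q" "round_path delta y 0 (q, 0) l ((track (?Z l), mo0), c0)" using Suc by fastforce
    then show ?case using round_path_step round_stepI[OF ne p(3,4)] by blast
  qed
  obtain q i m \<rho> where z: "?Z n = (q, i, m, \<rho>)" by (metis prod.exhaust)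
  have i: "i < k" using wf_state_run[of y n] n(1) by (auto simp: z wf_state_def at_read_eq)
  then have "mode_inv (?Z n) (Wt i True) m" by (simp add: z mode_inv_def)
  then obtain p where p: "init p" "round_path delta y 0 (p, 0) n ((track (?Z n), Wt i True), m)"
    using reach by (fastforce simp: watching_def)
  define tr where "tr = track_step (track (?Z n)) (y (2*n)) (y (2*n+1))"
  have "mode_step (track (?Z n)) (Wt i True) (m \<noteq> 0) (y (2*n+1)) tr Done 0"
    using n(2) i by (cases tr) (auto simp: z track_def expects_one_eq)
  then have "round_step delta y n ((track (?Z n), Wt i True), m) ((tr, Done), m)"
    unfolding round_step_def delta_def tr_def by (intro exI[of _ 0]) simp
  then have 1: "round_path delta y 0 (p, 0) (Suc n) ((tr, Done), m)" by (rule round_path_step[OF p(2)])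
  show ?thesis
  proof (rule round_accepts_progress[where ini = init and p = p and
      G = "\<lambda>a x. (a = 0 \<and> x = (p, 0)) \<or> snd (fst x) = Done", OF p(1)])
    fix a :: nat and x :: "((nat \<times> nat \<times> bool) \<times> mode) \<times> nat"
    assume "(a = 0 \<and> x = (p, 0)) \<or> snd (fst x) = Done"
    then show "\<exists>b x'. a < b \<and> round_path delta y a x b x' \<and> ((b = 0 \<and> x' = (p, 0)) \<or> snd (fst x') = Done) \<and> final (fst x')"
    proof
      assume "a = 0 \<and> x = (p, 0)"
      then show ?thesis using 1
        by (intro exI[of _ "Suc n"] exI[of _ "((tr, Done), m)"] conjI) (simp_all add: final_def)
    next
      assume D: "snd (fst x) = Done"
      obtain t c where x: "x = ((t, Done), c)" using D by (metis prod.collapse)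
      have "round_step delta y a x ((track_step t (y (2*a)) (y (2*a+1)), Done), c)"
        unfolding round_step_def delta_def x by (intro exI[of _ 0]) simp
      from round_path_step[OF round_path_refl this] show ?thesis
        by (intro exI[of _ "Suc a"] exI) (auto simp: final_def)
    qed
  qed simp
qed

section \<open>Following a path through the written edges\<close>

definition item :: "(nat \<Rightarrow> nat) \<Rightarrow> nat \<Rightarrow> nat \<Rightarrow> bool" where
  "item y s s' \<longleftrightarrow> (\<exists>n i m \<rho>. ref_run y n = (qo, i, m, \<rho>) \<and> \<rho> 0 = s \<and> \<rho> 1 = s')"

text \<open>\<open>s\<close> is the node completed last. In \<open>Take1\<close> the counter is what
  remains of it, in \<open>Take2\<close> the part of the next node read so far.\<close>

definition held :: "nat \<times> nat \<times> nat \<times> regs \<Rightarrow> mode \<Rightarrow> nat \<Rightarrow> nat \<Rightarrow> bool" where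
  "held = (\<lambda>(q, i, m, \<rho>) mo c s. case mo of Hold f \<Rightarrow> c = s
     | Take1 \<Rightarrow> q = qo \<and> i = 0 \<and> s = c + (\<rho> 0 - m)
     | Take2 \<Rightarrow> q = qo \<and> i = 1 \<and> \<rho> 0 = s \<and> c = \<rho> 1 - m
     | _ \<Rightarrow> False)"

text \<open>\<open>Hold True\<close> is entered only at the end of block 1 of an output
  configuration, after the zero test closing \<open>Take1\<close> has forced register 0 to equal the
  old node.\<close>

lemma held_step:
  assumes o: "wf_state z" and noerr: "\<not> at_read z \<longrightarrow> (b = 1) = expects_one z"
    and z': "z' = (if at_read z then after_read z (d a) (d b) else advance z)"
    and held: "held z mo c s" and mode_step: "mode_step (track z) mo (c \<noteq> 0) b (track z') mo' j"
    and c': "c' = nat (int c + j)"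
  shows "if mo' = Hold True then (\<exists>i m \<rho>. z = (qo, i, m, \<rho>) \<and> \<rho> 0 = s \<and> \<rho> 1 = c') \<and> held z' mo' c' c'
    else held z' mo' c' s"
  using o noerr z'
proof (cases rule: round_cases)
  case (one q i m \<rho>)
  with held mode_step c' show ?thesis
    by (cases mo) (auto simp: track_def held_def Suc_diff_le split: if_splits)
next
  case (block q i \<rho>)
  with held mode_step c' show ?thesis
    by (cases mo) (auto simp: track_def held_def split: if_splits)
next
  case (wait i \<rho>)
  with held mode_step c' k show ?thesis
    by (cases mo) (auto simp: track_def held_def split: if_splits)
next
  case (config q i \<rho> q' \<rho>')
  with held mode_step c' k show ?thesis
    by (cases mo) (auto simp: track_def held_def split: if_splits)
next
  case (read m q' \<rho>)
  with held mode_step c' k show ?thesis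
    by (cases mo) (auto simp: track_def held_def split: if_splits)
qed

text \<open>Without mistakes \<open>Done\<close> never occurs, so the final states visited are
  \<open>Hold True\<close>. Mistake-finding modes never turn into path-following ones; hence the run
  follows a path from the start, and the initial counter 0 is its first node.\<close>

lemma accepts_items:
  assumes ne: "\<not> ref_err y" and acc: "round_accepts delta init final y"
  shows "\<exists>g. g 0 = 0 \<and> (\<forall>i::nat. item y (g i) (g (Suc i)))"
proof -
  let ?Z = "ref_run y"
  have noerr: "\<not> at_read (?Z l) \<longrightarrow> (y (2*l+1) = 1) = expects_one (?Z l)" for l
    using ne unfolding ref_err_def by blast
  obtain C where C: "init (fst (C 0))" "snd (C 0) = 0"
    "\<And>n. \<exists>j. delta (fst (C n)) (snd (C n) \<noteq> 0) (y (2*n)) (y (2*n+1)) (fst (C (Suc n))) j \<and>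
       snd (C (Suc n)) = nat (int (snd (C n)) + j)"
    "infinite {n. final (fst (C n))}"
    using acc unfolding round_accepts_def by blast
  define mo where "mo n = snd (fst (C n))" for n
  define c where "c n = snd (C n)" for n
  have tr: "fst (fst (C n)) = track (?Z n)" for n
  proof (induction n)
    case 0
    then show ?case using C(1) by (simp add: init_def track_z0)
  next
    case (Suc n)
    then show ?case using C(3)[of n] track_step_run[OF noerr] unfolding delta_def by auto
  qed
  have step: "\<exists>j. mode_step (track (?Z n)) (mo n) (c n \<noteq> 0) (y (2*n+1)) (track (?Z (Suc n))) (mo (Suc n)) j \<and>
      c (Suc n) = nat (int (c n) + j)" for n
    using C(3)[of n] unfolding delta_def tr mo_def c_def by blast
  have Z': "?Z (Suc n) = (if at_read (?Z n) then after_read (?Z n) (d (y (2*n))) (d (y (2*n+1))) else advance (?Z n))" for n by simp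
  have mode_inv: "mode_inv (?Z n) (mo n) (c n)" for n
  proof (induction n)
    case 0
    show ?case using C(1,2) mode_inv_z0[of "fst (fst (C 0))" "mo 0"] by (simp add: mo_def c_def)
  next
    case (Suc n)
    then show ?case using step[of n] mode_inv_step[OF wf_state_run noerr Z'] by metis
  qed
  have nd: "mo n \<noteq> Done" for n using mode_inv[of n] by (cases "ref_run y n") (auto simp: mode_inv_def)
  have fin: "final (fst (C n)) \<longleftrightarrow> mo n = Hold True" for n using nd[of n] unfolding final_def mo_def by simp
  have w: "watching (mo (Suc n))" if "watching (mo n)" for n
  proof -
    obtain q i z where t: "track (?Z n) = (q, i, z)" by (metis prod.exhaust)
    obtain q' i' z' where t': "track (?Z (Suc n)) = (q', i', z')" by (metis prod.exhaust)
    show ?thesis using step[of n] that nd[of "Suc n"] unfolding t t' 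
      by (cases "mo n") (auto simp: watching_def split: if_splits)
  qed
  have "\<not> watching (mo 0)"
  proof
    assume "watching (mo 0)"
    then have *: "watching (mo n)" for n by (induction n) (auto intro: w)
    have "mo n \<noteq> Hold True" for n using *[of n] by (auto simp: watching_def)
    then have "\<not> final (fst (C n))" for n unfolding fin by blast
    then show False using C(4) by simp
  qed
  then have mo0: "mo 0 = Hold False" using C(1) by (auto simp: init_def mo_def watching_def)
  define s where "s = rec_nat 0 (\<lambda>n s. if mo (Suc n) = Hold True then c (Suc n) else s)"
  have s: "s 0 = 0" "s (Suc n) = (if mo (Suc n) = Hold True then c (Suc n) else s n)" for n
    by (simp_all add: s_def)
  have held: "held (?Z n) (mo n) (c n) (s n)" for n
  proof (induction n)
    case 0
    then show ?case using mo0 C(2) s(1) by (simp add: held_def c_def split: prod.splits)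
  next
    case (Suc n)
    obtain j where j: "mode_step (track (?Z n)) (mo n) (c n \<noteq> 0) (y (2*n+1)) (track (?Z (Suc n))) (mo (Suc n)) j"
      "c (Suc n) = nat (int (c n) + j)" using step by blast
    from held_step[OF wf_state_run noerr Z' Suc j] show ?case unfolding s(2)[of n] by (auto split: if_splits)
  qed
  have "\<exists>g. g 0 = s 0 \<and> (\<forall>i::nat. item y (g i) (g (Suc i)))"
  proof (rule flagged_subsequence[where fl = "\<lambda>n. mo n = Hold True"])
    show "infinite {n. mo n = Hold True}" using C(4) unfolding fin .
    show "s (Suc n) = s n" if "\<not> mo (Suc n) = Hold True" for n using that s by simp
    fix n assume *: "mo (Suc n) = Hold True"
    obtain j where j: "mode_step (track (?Z n)) (mo n) (c n \<noteq> 0) (y (2*n+1)) (track (?Z (Suc n))) (mo (Suc n)) j"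
      "c (Suc n) = nat (int (c n) + j)" using step by blast
    from held_step[OF wf_state_run noerr Z' held[of n] j] * s(2)[of n]
    show "item y (s n) (s (Suc n))" unfolding item_def by auto
  qed
  then show ?thesis using s(1) by simp
qed

text \<open>Passes through the ones left in a block: \<open>f\<close> is the counter and
  \<open>j\<close> its constant change, which covers \<open>Take1\<close> counting down as well as
  \<open>Take2\<close> counting up.\<close>

lemma ones_written:
  assumes ne: "\<not> ref_err y" and z: "ref_run y n = (q, i, m, \<rho>)" and i: "i < k"
    and p: "round_path delta y a x n ((track (ref_run y n), mo), f 0)"
    and f: "\<And>l tr tr'. l < m \<Longrightarrow> mode_step tr mo (f l \<noteq> 0) 1 tr' mo j \<and> f (Suc l) = nat (int (f l) + j)"
  shows "ref_run y (n + m) = (q, i, 0, \<rho>) \<and> round_path delta y a x (n + m) ((track (ref_run y (n + m)), mo), f m)"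
proof -
  have "ref_run y (n + l) = (q, i, m - l, \<rho>) \<and> round_path delta y a x (n + l) ((track (ref_run y (n + l)), mo), f l)"
    if "l \<le> m" for l
    using that
  proof (induction l)
    case 0
    then show ?case using z p by simp
  next
    case (Suc l)
    let ?n = "n + l"
    from Suc have zl: "ref_run y ?n = (q, i, m - l, \<rho>)"
      and pl: "round_path delta y a x ?n ((track (ref_run y ?n), mo), f l)" by auto
    have noerr: "\<not> at_read (ref_run y ?n) \<longrightarrow> (y (2 * ?n + 1) = 1) = expects_one (ref_run y ?n)"
      using ne unfolding ref_err_def by blast
    have nrd: "\<not> at_read (ref_run y ?n)" using i by (simp add: zl at_read_eq)
    have b: "y (2 * ?n + 1) = 1" using noerr nrd Suc.prems by (simp add: zl expects_one_eq)
    have z': "ref_run y (Suc ?n) = (q, i, m - Suc l, \<rho>)"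
      using nrd Suc.prems by (simp add: zl advance_eq)
    have "mode_step (track (ref_run y ?n)) mo (f l \<noteq> 0) (y (2 * ?n + 1)) (track (ref_run y (Suc ?n))) mo j"
      "f (Suc l) = nat (int (f l) + j)" using b f[of l] Suc.prems by auto
    from round_path_step[OF pl round_stepI[OF noerr this]] show ?case using z' by simp
  qed
  from this[OF order_refl] show ?thesis unfolding diff_self_eq_0 .
qed

text \<open>Every edge is required arbitrarily late because the automaton, having completed one
  edge, waits in \<open>Hold\<close> for the next edge of the path to come up again.\<close>

lemma items_accepts:
  assumes ne: "\<not> ref_err y" and g0: "g 0 = 0"
    and items: "\<And>i J. \<exists>n\<ge>J. \<exists>\<rho>. ref_run y n = start (qo, \<rho>) \<and> \<rho> 0 = g i \<and> \<rho> 1 = g (Suc i)"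
  shows "round_accepts delta init final y"
proof -
  let ?Z = "ref_run y"
  have noerr: "\<not> at_read (?Z l) \<longrightarrow> (y (2*l+1) = 1) = expects_one (?Z l)" for l
    using ne unfolding ref_err_def by blast
  have Z': "?Z (Suc n) = (if at_read (?Z n) then after_read (?Z n) (d (y (2*n))) (d (y (2*n+1))) else advance (?Z n))" for n by simp
  have hold: "\<exists>f'. round_path delta y a ((track (?Z a), Hold f), c) n ((track (?Z n), Hold f'), c)" if "a \<le> n" for a n f c
    using that
  proof (induction n rule: dec_induct)
    case base
    then show ?case using round_path_refl by blast
  next
    case (step n)
    then obtain f' where p: "round_path delta y a ((track (?Z a), Hold f), c) n ((track (?Z n), Hold f'), c)" by blast
    have "mode_step (track (?Z n)) (Hold f') (c \<noteq> 0) (y (2*n+1)) (track (?Z (Suc n))) (Hold False) 0"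
      by (cases "track (?Z n)"; cases "track (?Z (Suc n))") simp
    from round_path_step[OF p round_stepI[OF noerr this]] show ?case by (metis add_0_right nat_int)
  qed
  show ?thesis
  proof (rule round_accepts_progress[where p = "(track (?Z 0), Hold False)" and
      G = "\<lambda>a x. \<exists>i f. x = ((track (?Z a), Hold f), g i)"])
    show "init (track (?Z 0), Hold False)" using track_z0 by (simp add: init_def)
    show "\<exists>i f. ((track (?Z 0), Hold False), 0) = ((track (?Z 0), Hold f), g i)" using g0 by metis
    fix a x assume "\<exists>i f. x = ((track (?Z a), Hold f), g i)"
    then obtain i f where x: "x = ((track (?Z a), Hold f), g i)" by blast
    obtain n0 \<rho> where n0: "Suc a \<le> n0" "?Z n0 = start (qo, \<rho>)" "\<rho> 0 = g i" "\<rho> 1 = g (Suc i)" using items by blast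
    then obtain n where n: "n0 = Suc n" "a \<le> n" by (cases n0) auto
    have Zn: "?Z (Suc n) = (qo, 0, \<rho> 0, \<rho>)" using n0 n by (simp add: start_def)
    obtain f' where 1: "round_path delta y a x n ((track (?Z n), Hold f'), g i)" using hold[OF n(2)] x by blast
    \<comment> \<open>A configuration begins right after a reading or a block end, which are the
      rounds in which \<open>Hold\<close> may change to \<open>Take1\<close>.\<close>
    have "mode_step (track (?Z n)) (Hold f') (g i \<noteq> 0) (y (2*n+1)) (track (?Z (Suc n))) Take1 0"
      using wf_state_run[of y n] noerr[of n] Z'[of n]
    proof (cases rule: round_cases)
      case (one q i m \<rho>')
      then show ?thesis using Zn by auto
    next
      case (block q i \<rho>')
      then show ?thesis using Zn by auto
    next
      case (wait i \<rho>')
      then show ?thesis using Zn k by auto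
    next
      case (config q i \<rho>1 q' \<rho>2)
      show ?thesis unfolding config(1) Zn using config(3) by (simp add: track_def)
    next
      case (read m q' \<rho>')
      show ?thesis unfolding read(1) Zn by (simp add: track_def)
    qed
    from round_path_step[OF 1 round_stepI[OF noerr this]]
    have 2: "round_path delta y a x n0 ((track (?Z n0), Take1), \<rho> 0)" using n0 n(1) by simp
    define n1 where "n1 = n0 + \<rho> 0"
    \<comment> \<open>Register 0 equals the current node, so the counter is empty exactly when block
      0 ends.\<close>
    have z1: "?Z n1 = (qo, 0, 0, \<rho>)" and p1: "round_path delta y a x n1 ((track (?Z n1), Take1), 0)"
      using ones_written[OF ne Zn[folded n(1)], where f = "\<lambda>l. \<rho> 0 - l" and mo = Take1 and j = "-1" and a = a and x = x] 2 k
      unfolding n1_def by (auto simp: nat_diff_distrib)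
    have r1: "\<not> at_read (?Z n1)" using k by (simp add: z1 at_read_eq)
    have b1: "y (2 * n1 + 1) \<noteq> 1" using noerr[of n1] r1 by (simp add: z1 expects_one_eq)
    have z2: "?Z (Suc n1) = (qo, 1, \<rho> 1, \<rho>)"
      unfolding Z'[of n1] using r1 k by (simp add: z1 advance_eq)
    have "mode_step (track (?Z n1)) Take1 (0 \<noteq> (0::nat)) (y (2 * n1 + 1)) (track (?Z (Suc n1))) Take2 0"
      using b1 by simp
    from round_path_step[OF p1 round_stepI[OF noerr this]]
    have p2: "round_path delta y a x (Suc n1) ((track (?Z (Suc n1)), Take2), 0)" by simp
    define n2 where "n2 = Suc n1 + \<rho> 1"
    have z3: "?Z n2 = (qo, 1, 0, \<rho>)" and p3: "round_path delta y a x n2 ((track (?Z n2), Take2), \<rho> 1)"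
      using ones_written[OF ne z2, where f = "\<lambda>l. l" and mo = Take2 and j = 1 and a = a and x = x] p2 k
      unfolding n2_def by (auto simp: nat_add_distrib)
    have r3: "\<not> at_read (?Z n2)" using k by (simp add: z3 at_read_eq)
    have b3: "y (2 * n2 + 1) \<noteq> 1" using noerr[of n2] r3 by (simp add: z3 expects_one_eq)
    have "mode_step (track (?Z n2)) Take2 (\<rho> 1 \<noteq> 0) (y (2 * n2 + 1)) (track (?Z (Suc n2))) (Hold True) 0"
      using b3 by simp
    from round_path_step[OF p3 round_stepI[OF noerr this]]
    have "round_path delta y a x (Suc n2) ((track (?Z (Suc n2)), Hold True), g (Suc i))" using n0 by simp
    moreover have "a < Suc n2" using n unfolding n2_def n1_def by simp
    ultimately show "\<exists>b x'. a < b \<and> round_path delta y a x b x' \<and>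
      (\<exists>i f. x' = ((track (?Z b), Hold f), g i)) \<and> final (fst x')"
      by (intro exI[of _ "Suc n2"] exI[of _ "((track (?Z (Suc n2)), Hold True), g (Suc i))"])
        (auto simp: final_def simp del: ref_run.simps)
  qed
qed

end

section \<open>Normal forms of effective analytic sets\<close>

abbreviation pfst :: "nat \<Rightarrow> nat" where "pfst x \<equiv> fst (prod_decode x)"
abbreviation psnd :: "nat \<Rightarrow> nat" where "psnd x \<equiv> snd (prod_decode x)"

lemma decidable_mem: assumes "decidable 1 (\<lambda>xs. xs ! 0 \<in> R)" "computable k a" shows "decidable k (\<lambda>xs. a xs \<in> R)"
proof -
  have "computable1 (\<lambda>x. of_bool (x \<in> R))" using assms(1) unfolding computable1_def decidable_def .
  from computable1D[OF this assms(2)] show ?thesis unfolding decidable_def .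
qed

text \<open>The latest pair comes first because the machine extends its record by
  \<open>lcons\<close>.\<close>

definition pair_code :: "(nat \<Rightarrow> nat) \<Rightarrow> nat \<Rightarrow> nat" where
  "pair_code \<sigma> j = list_encode (rev (map (\<lambda>i. prod_encode (\<sigma> (2*i), \<sigma> (2*i+1))) [0..<j]))"

lemma pair_code_0: "pair_code \<sigma> 0 = 0"
  by (simp add: pair_code_def)

lemma pair_code_Suc: "pair_code \<sigma> (Suc j) = lcons (prod_encode (\<sigma> (2*j), \<sigma> (2*j+1))) (pair_code \<sigma> j)"
  by (simp add: pair_code_def)

definition unpairs :: "nat \<Rightarrow> nat" where
  "unpairs l = foldl (\<lambda>acc p. lcons (pfst p) (lcons (psnd p) acc)) 0 (list_decode l)"

lemma unpairs_pair_code: "unpairs (pair_code \<sigma> j) = list_encode (prefix_of \<sigma> (2*j))"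
proof -
  have *: "foldl (\<lambda>acc p. lcons (pfst p) (lcons (psnd p) acc)) (list_encode ys)
      (rev (map (\<lambda>i. prod_encode (\<sigma> (2*i), \<sigma> (2*i+1))) [0..<j])) = list_encode (prefix_of \<sigma> (2*j) @ ys)" for ys
    by (induction j arbitrary: ys) (auto simp: prefix_of_def)
  from *[of "[]"] show ?thesis by (simp add: unpairs_def pair_code_def)
qed

lemma computable_unpairs [computable_intros]: assumes "computable k a" shows "computable k (\<lambda>xs. unpairs (a xs))"
proof -
  have "computable2 (\<lambda>acc p. lcons (pfst p) (lcons (psnd p) acc))"
    unfolding computable2_def by (intro computable_intros; simp)
  from computable_foldl[OF this computable_const[of k 0] assms] show ?thesis unfolding unpairs_def .
qed

definition all_bits :: "nat \<Rightarrow> nat" where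
  "all_bits l = foldl (\<lambda>acc x. acc * of_bool (x \<le> 1)) 1 (list_decode l)"

lemma all_bits: "all_bits (list_encode xs) = of_bool (\<forall>x\<in>set xs. x \<le> 1)"
proof -
  have "foldl (\<lambda>acc x. acc * of_bool (x \<le> 1)) a xs = a * of_bool (\<forall>x\<in>set xs. x \<le> 1)" for a :: nat
    by (induction xs arbitrary: a) auto
  then show ?thesis by (simp add: all_bits_def)
qed

lemma computable_all_bits [computable_intros]: assumes "computable k a" shows "computable k (\<lambda>xs. all_bits (a xs))"
proof -
  have "computable2 (\<lambda>acc x. acc * of_bool (x \<le> 1))"
    unfolding computable2_def by (intro computable_intros; simp)
  from computable_foldl[OF this computable_const[of k 1] assms] show ?thesis unfolding all_bits_def .
qed

definition edge1 :: "nat \<Rightarrow> nat" where "edge1 t = pfst (psnd t)"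
definition edge2 :: "nat \<Rightarrow> nat" where "edge2 t = pfst (psnd (psnd t))"
definition edgem :: "nat \<Rightarrow> nat" where "edgem t = psnd (psnd (psnd t))"

text \<open>Nodes are pairs \<open>(n, u)\<close>: \<open>u\<close> is a guessed prefix of \<open>\<tau>\<close> that verifies the first \<open>n\<close> conditions.
  The time stamp \<open>t\<close> codes \<open>(padding, node, next node, m)\<close>; the padding lets every edge recur.\<close>

definition edge_valid :: "nat set \<Rightarrow> nat \<Rightarrow> nat \<Rightarrow> bool" where
  "edge_valid R t l \<longleftrightarrow>
     pfst (edge2 t) = Suc (pfst (edge1 t)) \<and>
     list_encode (take (length (list_decode (psnd (edge1 t)))) (list_decode (psnd (edge2 t)))) = psnd (edge1 t) \<and>
     all_bits (psnd (edge2 t)) = 1 \<and>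
     edgem t \<le> length (list_decode (psnd (edge2 t))) \<and>
     prod_encode (pfst (edge1 t), prod_encode (list_encode (take (edgem t) (list_decode (psnd (edge2 t)))),
        list_encode (take (edgem t) (list_decode (unpairs l))))) \<in> R"

lemma computable_edge: "computable 1 (\<lambda>xs. edge1 (xs ! 0))" "computable 1 (\<lambda>xs. edge2 (xs ! 0))"
  unfolding edge1_def edge2_def by (intro computable_intros; simp)+

lemma decidable_edge_valid:
  assumes "recursive_set R" shows "decidable 2 (\<lambda>xs. edge_valid R (xs ! 0) (xs ! 1))"
  unfolding edge_valid_def edge1_def edge2_def edgem_def
  by (intro computable_intros decidable_mem[OF assms[unfolded recursive_set_iff]]; simp)

lemma le_prod_encodes: "psnd t \<le> t" "pfst t \<le> t"
  using le_prod_encode_2[of "psnd t" "pfst t"] le_prod_encode_1[of "pfst t" "psnd t"] by simp_all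

text \<open>This makes an edge decidable at stage \<open>t\<close>: the \<open>t + 1\<close> pairs
  read by then contain the first \<open>edgem t\<close> letters.\<close>

lemma edgem_le: "edgem t \<le> t"
  unfolding edgem_def using le_prod_encodes(1) by (meson order_trans)

text \<open>A path consists of nested words \<open>u i\<close>; their union, filled up with
  \<open>False\<close> where they end, is \<open>\<tau>\<close>, and edge \<open>i\<close> witnesses
  condition \<open>i\<close>. Conversely, \<open>\<tau>\<close> is cut at a length
  \<open>len i\<close> that serves the first \<open>i\<close> conditions, and the padding makes time
  stamps as large as desired.\<close>

lemma Sigma11_edges:
  assumes \<sigma>: "\<sigma> \<in> omega_words X"
    and L: "L = {\<sigma> \<in> omega_words X. \<exists>\<tau> :: nat \<Rightarrow> bool. \<forall>n. \<exists>m. code_triple n (prefix_of \<tau> m) (prefix_of \<sigma> m) \<in> R}"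
  defines "edge s s' t \<equiv> edge_valid R t (pair_code \<sigma> (Suc t)) \<and> edge1 t = s \<and> edge2 t = s'"
  shows "g 0 = 0 \<Longrightarrow> (\<And>i. \<exists>t. edge (g i) (g (Suc i)) t) \<Longrightarrow> \<sigma> \<in> L"
    and "\<sigma> \<in> L \<Longrightarrow> \<exists>g. g 0 = 0 \<and> (\<forall>i J. \<exists>t\<ge>J. edge (g i) (g (Suc i)) t)"
proof -
  have take: "list_encode (take (edgem t) (list_decode (unpairs (pair_code \<sigma> (Suc t))))) =
      list_encode (prefix_of \<sigma> (edgem t))" for t
    using edgem_le[of t] unfolding unpairs_pair_code by (simp add: prefix_of_def take_map)
  \<comment> \<open>The code \<open>0\<close> is level 0 with the empty word, the node where paths
    start.\<close>
  have z: "prod_decode 0 = (0, 0)"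
    using prod_encode_inverse[of "(0,0)"] by (simp add: prod_encode_def)
  {
    assume g0: "g 0 = 0" and "\<And>i. \<exists>t. edge (g i) (g (Suc i)) t"
    then obtain t where t: "\<And>i. edge (g i) (g (Suc i)) (t i)" by metis
    define u where "u i = list_decode (psnd (g i))" for i
    have n: "pfst (g i) = i" for i
    proof (induction i)
      case (Suc i)
      then show ?case using t[of i] by (auto simp: edge_def edge_valid_def)
    qed (simp add: g0 z)
    have pre: "take (length (u i)) (u (Suc i)) = u i" for i
      using t[of i] unfolding edge_def edge_valid_def u_def by (metis list_encode_inverse)
    have bits: "x \<le> 1" if "x \<in> set (u (Suc i))" for x i
    proof -
      have "all_bits (psnd (g (Suc i))) = 1" using t[of i] unfolding edge_def edge_valid_def by auto
      then have "all_bits (list_encode (u (Suc i))) = 1" unfolding u_def by simp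
      then show ?thesis using that unfolding all_bits of_bool_eq_1_iff by blast
    qed
    have pre2: "take (length (u i)) (u j) = u i" if "i \<le> j" for i j
      using that
    proof (induction j rule: dec_induct)
      case (step j)
      have le: "length (u i) \<le> length (u j)" using step.IH by (metis length_take min.cobounded1 min.commute)
      have "take (length (u i)) (u (Suc j)) = take (length (u i)) (take (length (u j)) (u (Suc j)))"
        using le by simp
      then show ?case using pre[of j] step.IH by simp
    qed simp
    define \<tau> where "\<tau> l \<longleftrightarrow> (\<exists>i. l < length (u i) \<and> u i ! l = 1)" for l
    have \<tau>: "of_bool (\<tau> l) = u (Suc i) ! l" if l: "l < length (u (Suc i))" for l i
    proof -
      have "u (Suc i) ! l \<le> 1" using bits[OF nth_mem[OF l]] .
      moreover have "u (Suc i) ! l = 1" if "l < length (u j)" "u j ! l = 1" for j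
      proof (cases "j \<le> Suc i")
        case True
        then show ?thesis using pre2[OF True] that by (metis nth_take)
      next
        case False
        then show ?thesis using pre2[of "Suc i" j] that l by (metis nth_take nat_le_linear)
      qed
      ultimately show ?thesis unfolding \<tau>_def using l by (cases "u (Suc i) ! l = 1") auto
    qed
    have "\<exists>m. code_triple i (prefix_of \<tau> m) (prefix_of \<sigma> m) \<in> R" for i
    proof (intro exI[of _ "edgem (t i)"])
      let ?m = "edgem (t i)"
      have "?m \<le> length (u (Suc i))" using t[of i] unfolding edge_def edge_valid_def u_def by auto
      then have "map of_bool (prefix_of \<tau> ?m) = take ?m (u (Suc i))"
        using \<tau> by (intro nth_equalityI) (auto simp: prefix_of_def)
      moreover have "prod_encode (pfst (g i), prod_encode (list_encode (take ?m (u (Suc i))),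
        list_encode (prefix_of \<sigma> ?m))) \<in> R"
        using t[of i] unfolding edge_def edge_valid_def u_def take by auto
      ultimately show "code_triple i (prefix_of \<tau> ?m) (prefix_of \<sigma> ?m) \<in> R"
        by (simp add: code_triple_def n)
    qed
    then show "\<sigma> \<in> L" unfolding L using \<sigma> by blast
  }
  {
    assume "\<sigma> \<in> L"
    then obtain \<tau> where "\<forall>n. \<exists>m. code_triple n (prefix_of \<tau> m) (prefix_of \<sigma> m) \<in> R" unfolding L by blast
    then obtain m where m: "\<And>n. code_triple n (prefix_of \<tau> (m n)) (prefix_of \<sigma> (m n)) \<in> R" by metis
    define len where "len = rec_nat 0 (\<lambda>i l. max l (m i))"
    have len: "len 0 = 0" "len (Suc i) = max (len i) (m i)" for i by (simp_all add: len_def)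
    define g where "g i = prod_encode (i, list_encode (map of_bool (prefix_of \<tau> (len i))))" for i
    have "g 0 = 0" by (simp add: g_def len prefix_of_def prod_encode_def)
    moreover have "\<exists>t\<ge>J. edge (g i) (g (Suc i)) t" for i J
    proof -
      define t where "t = prod_encode (J, prod_encode (g i, prod_encode (g (Suc i), m i)))"
      have e: "edge1 t = g i" "edge2 t = g (Suc i)" "edgem t = m i"
        by (simp_all add: edge1_def edge2_def edgem_def t_def)
      have tk: "take a (map of_bool (prefix_of \<tau> b)) = (map of_bool (prefix_of \<tau> a) :: nat list)" if "a \<le> b" for a b
        using that by (simp add: prefix_of_def take_map)
      have "edge_valid R t (pair_code \<sigma> (Suc t))"
        unfolding edge_valid_def take using m[of i]
        by (auto simp: e g_def tk len all_bits code_triple_def)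
      moreover have "J \<le> t" unfolding t_def by (rule le_prod_encode_1)
      ultimately show ?thesis using e unfolding edge_def by blast
    qed
    ultimately show "\<exists>g. g 0 = 0 \<and> (\<forall>i J. \<exists>t\<ge>J. edge (g i) (g (Suc i)) t)" by blast
  }
qed

section \<open>Coding sequences of numbers by bit sequences\<close>

definition run_step :: "nat \<times> nat list \<Rightarrow> nat \<Rightarrow> nat \<times> nat list" where
  "run_step = (\<lambda>(c, acc) x. if x = 0 then (0, acc @ [c]) else (Suc c, acc))"

text \<open>An infinite sequence of numbers \<open>h\<close> is coded by the bits of \<open>1\<^sup>h\<^sup>0 0 1\<^sup>h\<^sup>1 0 \<dots>\<close>.\<close>

definition runs :: "nat list \<Rightarrow> nat list" where
  "runs u = snd (foldl run_step (0, []) u)"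

lemma run_step_prefix: "\<exists>zs. snd (foldl run_step p v) = snd p @ zs"
proof (induction v arbitrary: p)
  case (Cons x v)
  obtain c acc where p: "p = (c, acc)" by (cases p)
  from Cons[of "run_step p x"] show ?case by (auto simp: p run_step_def)
qed simp

text \<open>A completed block is never revised by later bits, so numbers decoded from prefixes are
  stable.\<close>

lemma runs_nth_append: "i < length (runs u) \<Longrightarrow> runs (u @ v) ! i = runs u ! i \<and> i < length (runs (u @ v))"
  using run_step_prefix[of "foldl run_step (0, []) u" v] by (auto simp: runs_def nth_append)

lemma runs_replicate: "foldl run_step (0, acc) (replicate n 1 @ [0]) = (0, acc @ [n])"
proof -
  have "foldl run_step (c, acc) (replicate n 1) = (c + n, acc)" for c
    by (induction n arbitrary: c) (auto simp: run_step_def)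
  then show ?thesis by (simp add: run_step_def)
qed

definition run_word :: "(nat \<Rightarrow> nat) \<Rightarrow> nat \<Rightarrow> bool list" where
  "run_word h n = concat (map (\<lambda>i. replicate (h i) True @ [False]) [0..<n])"

lemma run_word_Suc: "run_word h (Suc n) = run_word h n @ replicate (h n) True @ [False]"
  by (simp add: run_word_def)

lemma runs_run_word: "runs (map of_bool (run_word h n)) = map h [0..<n]"
proof -
  have "foldl run_step (0, []) (map of_bool (run_word h n)) = (0, map h [0..<n])"
  proof (induction n)
    case 0
    then show ?case by (simp add: run_word_def)
  next
    case (Suc n)
    have "map of_bool (run_word h (Suc n)) = map of_bool (run_word h n) @ replicate (h n) 1 @ [0 :: nat]"
      by (simp add: run_word_Suc)
    then show ?case using Suc runs_replicate by (simp del: foldl_append add: foldl_append[of _ _ "map of_bool (run_word h n)"])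
  qed
  then show ?thesis by (simp add: runs_def)
qed

lemma length_run_word: "n \<le> length (run_word h n)"
  by (induction n) (auto simp: run_word_def)

lemma run_word_prefix: "m \<le> n \<Longrightarrow> \<exists>w. run_word h n = run_word h m @ w"
proof (induction n rule: dec_induct)
  case (step n)
  then show ?case by (auto simp: run_word_Suc)
qed simp

lemma run_word_limit: "\<exists>\<tau>. \<forall>n. prefix_of \<tau> (length (run_word h n)) = run_word h n"
proof
  define \<tau> where "\<tau> l = run_word h (Suc l) ! l" for l
  have "\<tau> l = run_word h n ! l" if "l < length (run_word h n)" for l n
  proof -
    have l: "l < length (run_word h (Suc l))" using length_run_word[of "Suc l" h] by simp
    have "run_word h (Suc l) ! l = run_word h n ! l"
    proof (cases "Suc l \<le> n")
      case True
      then show ?thesis using run_word_prefix[OF True, of h] l by (auto simp: nth_append)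
    next
      case False
      then show ?thesis using run_word_prefix[of n "Suc l" h] that by (auto simp: nth_append)
    qed
    then show ?thesis by (simp add: \<tau>_def)
  qed
  then show "\<forall>n. prefix_of \<tau> (length (run_word h n)) = run_word h n"
    by (auto simp: prefix_of_def intro!: nth_equalityI)
qed

text \<open>The computable counterpart of \<open>runs\<close> on codes; blocks are collected in
  reverse and turned round at the end.\<close>

definition lruns :: "nat \<Rightarrow> nat" where
  "lruns l = list_encode (rev (list_decode (psnd (foldl (\<lambda>p x. if x = 0 then prod_encode (0, lcons (pfst p) (psnd p))
      else prod_encode (Suc (pfst p), psnd p)) (prod_encode (0, 0)) (list_decode l)))))"

lemma lruns: "lruns (list_encode u) = list_encode (runs u)"
proof -
  have "foldl (\<lambda>p x. if x = 0 then prod_encode (0, lcons (pfst p) (psnd p)) else prod_encode (Suc (pfst p), psnd p))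
      (prod_encode (c, list_encode (rev acc))) u =
      (let r = foldl run_step (c, acc) u in prod_encode (fst r, list_encode (rev (snd r))))" for c acc
  proof (induction u arbitrary: c acc)
    case (Cons x u)
    show ?case
    proof (cases "x = 0")
      case True
      have "list_encode (c # rev acc) = list_encode (rev (acc @ [c]))" by simp
      then show ?thesis using Cons[of 0 "acc @ [c]"] True by (simp add: run_step_def)
    next
      case False
      then show ?thesis using Cons[of "Suc c" acc] by (simp add: run_step_def)
    qed
  qed (simp add: Let_def)
  from this[of 0 "[]"] show ?thesis by (simp add: lruns_def runs_def Let_def)
qed

lemma computable_lruns [computable_intros]: assumes "computable k a" shows "computable k (\<lambda>xs. lruns (a xs))"
proof -
  have "computable2 (\<lambda>p x. if x = 0 then prod_encode (0, lcons (pfst p) (psnd p)) else prod_encode (Suc (pfst p), psnd p))"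
    unfolding computable2_def by (intro computable_intros; simp)
  from computable_foldl[OF this computable_const[of k "prod_encode (0, 0)"] assms] show ?thesis
    unfolding lruns_def by (intro computable_intros)
qed

definition lnth :: "nat \<Rightarrow> nat \<Rightarrow> nat" where
  "lnth l n = lhd (list_encode (drop n (list_decode l)))"

lemma lnth: "n < length xs \<Longrightarrow> lnth (list_encode xs) n = xs ! n"
  by (simp add: lnth_def lhd_drop)

lemma computable_lnth [computable_intros]: "computable k a \<Longrightarrow> computable k b \<Longrightarrow> computable k (\<lambda>xs. lnth (a xs) (b xs))"
  unfolding lnth_def by (intro computable_intros)

text \<open>A quantifier over number sequences becomes one over bit sequences. Both sequences are
  cut at the same length, and decoding \<open>h (Suc n)\<close> may take a long prefix; hence
  \<open>E\<close> has to persist when the prefix of \<open>\<sigma>\<close> grows.\<close>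

lemma Sigma11_sequences:
  assumes cI: "decidable 1 (\<lambda>xs. I (xs ! 0))" and cE: "decidable 3 (\<lambda>xs. E (xs ! 0) (xs ! 1) (xs ! 2))"
    and mono: "\<And>\<sigma> m m' c c'. m \<le> m' \<Longrightarrow> E c c' (list_encode (prefix_of \<sigma> m)) \<Longrightarrow> E c c' (list_encode (prefix_of \<sigma> m'))"
  shows "Sigma11 X {\<sigma> \<in> omega_words X. \<exists>h. I (h 0) \<and> (\<forall>n::nat. \<exists>m. E (h n) (h (Suc n)) (list_encode (prefix_of \<sigma> m)))}"
proof -
  \<comment> \<open>Requiring \<open>n + 2\<close> completed blocks for every \<open>n\<close>
    excludes bit sequences with finitely many \<open>False\<close>. The start condition
    \<open>I\<close> is repeated at each \<open>n\<close>, as the normal form has no separate clause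
    for it.\<close>
  define P where "P n u v \<longleftrightarrow> Suc (Suc n) \<le> length (list_decode (lruns u)) \<and> I (lnth (lruns u) 0) \<and>
     E (lnth (lruns u) n) (lnth (lruns u) (Suc n)) v" for n u v
  define R where "R = {x. P (pfst x) (pfst (psnd x)) (psnd (psnd x))}"
  have I: "decidable k (\<lambda>xs. I (a xs))" if "computable k a" for k a
    using computable1D[OF _ that, of "\<lambda>x. of_bool (I x)"] cI unfolding decidable_def computable1_def by simp
  have E: "decidable k (\<lambda>xs. E (a xs) (b xs) (c xs))" if "computable k a" "computable k b" "computable k c" for k a b c
    using computable3D[OF _ that, of "\<lambda>x y z. of_bool (E x y z)"] cE unfolding decidable_def computable3_def by simp
  have "recursive_set R" unfolding recursive_set_iff R_def P_def mem_Collect_eq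
    by (intro computable_intros I E; simp)
  moreover have "(\<exists>h. I (h 0) \<and> (\<forall>n::nat. \<exists>m. E (h n) (h (Suc n)) (list_encode (prefix_of \<sigma> m)))) \<longleftrightarrow>
     (\<exists>\<tau> :: nat \<Rightarrow> bool. \<forall>n. \<exists>m. code_triple n (prefix_of \<tau> m) (prefix_of \<sigma> m) \<in> R)" (is "?l \<longleftrightarrow> ?r") for \<sigma>
  proof
    assume ?l
    then obtain h where h: "I (h 0)" "\<And>n. \<exists>m. E (h n) (h (Suc n)) (list_encode (prefix_of \<sigma> m))" by blast
    obtain \<tau> where \<tau>: "\<And>n. prefix_of \<tau> (length (run_word h n)) = run_word h n" using run_word_limit by blast
    have "\<exists>m. code_triple n (prefix_of \<tau> m) (prefix_of \<sigma> m) \<in> R" for n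
    proof -
      obtain m where m: "E (h n) (h (Suc n)) (list_encode (prefix_of \<sigma> m))" using h by blast
      define M where "M = max m (Suc (Suc n))"
      let ?l = "length (run_word h M)"
      have "m \<le> ?l" using length_run_word[of M h] unfolding M_def by linarith
      then have "E (h n) (h (Suc n)) (list_encode (prefix_of \<sigma> ?l))" using mono m by blast
      then have "P n (list_encode (map of_bool (run_word h M))) (list_encode (prefix_of \<sigma> ?l))"
        using h(1) unfolding P_def lruns runs_run_word M_def by (simp add: lnth)
      then have "code_triple n (prefix_of \<tau> ?l) (prefix_of \<sigma> ?l) \<in> R"
        by (simp add: R_def code_triple_def \<tau>)
      then show ?thesis ..
    qed
    then show ?r by blast
  next
    assume ?r
    then obtain \<tau> :: "nat \<Rightarrow> bool" where "\<forall>n. \<exists>m. code_triple n (prefix_of \<tau> m) (prefix_of \<sigma> m) \<in> R" by blast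
    then obtain m where m: "\<And>n. code_triple n (prefix_of \<tau> (m n)) (prefix_of \<sigma> (m n)) \<in> R" by metis
    define r where "r n = runs (map of_bool (prefix_of \<tau> n))" for n
    have r: "Suc (Suc n) \<le> length (r (m n))" "I (r (m n) ! 0)"
      "E (r (m n) ! n) (r (m n) ! Suc n) (list_encode (prefix_of \<sigma> (m n)))" for n
    proof -
      have *: "P n (list_encode (map of_bool (prefix_of \<tau> (m n)))) (list_encode (prefix_of \<sigma> (m n)))"
        using m[of n] by (simp add: R_def code_triple_def)
      then show 1: "Suc (Suc n) \<le> length (r (m n))" unfolding P_def lruns r_def by simp
      have "lnth (list_encode (r (m n))) 0 = r (m n) ! 0" using 1 by (intro lnth) linarith
      then show "I (r (m n) ! 0)" "E (r (m n) ! n) (r (m n) ! Suc n) (list_encode (prefix_of \<sigma> (m n)))"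
        using * 1 unfolding P_def lruns r_def by (simp_all add: lnth)
    qed
    have pre: "r l' ! i = r l ! i" if "l \<le> l'" "i < length (r l)" for l l' i
    proof -
      have "prefix_of \<tau> l' = prefix_of \<tau> l @ map \<tau> [l..<l']"
        using that(1) upt_add_eq_append[of 0 l "l' - l"] unfolding prefix_of_def by simp
      then show ?thesis using runs_nth_append[of i "map of_bool (prefix_of \<tau> l)"] that(2) unfolding r_def by simp
    qed
    have same: "r l' ! i = r l ! i" if "i < length (r l)" "i < length (r l')" for l l' i
      using pre[of l l' i] pre[of l' l i] that by (metis nat_le_linear)
    define h where "h n = r (m n) ! n" for n
    have "E (h n) (h (Suc n)) (list_encode (prefix_of \<sigma> (m n)))" for n
    proof -
      have "h (Suc n) = r (m n) ! Suc n" unfolding h_def using r(1)[of n] r(1)[of "Suc n"] by (intro same) auto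
      then show ?thesis using r(3)[of n] by (simp add: h_def)
    qed
    moreover have "I (h 0)" using r(2)[of 0] by (simp add: h_def)
    ultimately show ?l by blast
  qed
  then have "{\<sigma> \<in> omega_words X. \<exists>h. I (h 0) \<and> (\<forall>n::nat. \<exists>m. E (h n) (h (Suc n)) (list_encode (prefix_of \<sigma> m)))} =
     {\<sigma> \<in> omega_words X. \<exists>\<tau> :: nat \<Rightarrow> bool. \<forall>n. \<exists>m. code_triple n (prefix_of \<tau> m) (prefix_of \<sigma> m) \<in> R}" by blast
  ultimately show ?thesis unfolding Sigma11_def by blast
qed

section \<open>Pushdown languages are effective analytic\<close>

lemma card_below_strict_mono:
  fixes pos :: "nat \<Rightarrow> nat"
  assumes "strict_mono pos" shows "card {l. l < pos j \<and> l \<in> range pos} = j"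
proof -
  have "{l. l < pos j \<and> l \<in> range pos} = pos ` {..<j}"
    using assms by (auto simp: strict_mono_less)
  moreover have "inj_on pos {..<j}" using assms strict_mono_imp_inj_on inj_on_subset by blast
  ultimately show ?thesis by (simp add: card_image)
qed

text \<open>Turns recurrence into a condition on successive positions: \<open>f n\<close> is the
  distance to the next visit, and no sequence of naturals decreases forever.\<close>

lemma infinitely_often_iff_rank:
  fixes Q :: "nat \<Rightarrow> bool"
  shows "infinite {n. Q n} \<longleftrightarrow> (\<exists>f :: nat \<Rightarrow> nat. \<forall>n. Q n \<or> f (Suc n) < f n)"
proof
  assume inf: "infinite {n. Q n}"
  have ex: "\<exists>m. Q (n + m)" for n
  proof -
    obtain l where "l \<ge> n" "Q l" using inf unfolding infinite_nat_iff_unbounded_le by auto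
    then show ?thesis by (metis le_Suc_ex)
  qed
  define f where "f n = (LEAST m. Q (n + m))" for n
  have f: "Q (n + f n)" for n unfolding f_def using ex[of n] by (rule LeastI_ex)
  have "Q n \<or> f (Suc n) < f n" for n
  proof (cases "f n")
    case 0
    then show ?thesis using f[of n] by simp
  next
    case (Suc m)
    then have "Q (Suc n + m)" using f[of n] by simp
    then have "f (Suc n) \<le> m" unfolding f_def by (rule Least_le)
    then show ?thesis using Suc by simp
  qed
  then show "\<exists>f :: nat \<Rightarrow> nat. \<forall>n. Q n \<or> f (Suc n) < f n" by blast
next
  assume "\<exists>f :: nat \<Rightarrow> nat. \<forall>n. Q n \<or> f (Suc n) < f n"
  then obtain f :: "nat \<Rightarrow> nat" where f: "\<And>n. Q n \<or> f (Suc n) < f n" by blast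
  show "infinite {n. Q n}"
  proof
    assume "finite {n. Q n}"
    then obtain N where N: "\<And>n. Q n \<Longrightarrow> n < N" by (auto simp: finite_nat_set_iff_bounded)
    have "f (N + n) + n \<le> f N" for n
    proof (induction n)
      case (Suc n)
      have "\<not> Q (N + n)" using N by fastforce
      then show ?case using f[of "N + n"] Suc by simp
    qed simp
    from this[of "Suc (f N)"] show False by simp
  qed
qed

section \<open>Coded runs of pushdown automata\<close>

definition ps_state :: "nat \<Rightarrow> nat" where "ps_state c = pfst c"
definition ps_stack :: "nat \<Rightarrow> nat" where "ps_stack c = pfst (psnd c)"
definition ps_count :: "nat \<Rightarrow> nat" where "ps_count c = pfst (psnd (psnd c))"
definition ps_rank1 :: "nat \<Rightarrow> nat" where "ps_rank1 c = pfst (psnd (psnd (psnd c)))"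
definition ps_rank2 :: "nat \<Rightarrow> nat" where "ps_rank2 c = psnd (psnd (psnd (psnd c)))"

text \<open>Codes \<open>(state, stack, number of letters read, rank1, rank2)\<close>; the ranks count down to the next
  visit of an accepting state and to the next letter.\<close>

definition pd_edge :: "ptrans \<Rightarrow> nat \<Rightarrow> nat \<Rightarrow> nat \<Rightarrow> bool" where
  "pd_edge = (\<lambda>(q, a, Z, q', \<gamma>) c c' v. ps_state c = q \<and> ps_state c' = q' \<and> ps_stack c \<noteq> 0 \<and>
     lhd (ps_stack c) = Z \<and> ps_stack c' = foldr lcons \<gamma> (ltl (ps_stack c)) \<and>
     (case a of None \<Rightarrow> ps_count c' = ps_count c
      | Some b \<Rightarrow> ps_count c' = Suc (ps_count c) \<and> ps_count c < length (list_decode v) \<and> lnth v (ps_count c) = b))"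

text \<open>The last two conjuncts are the local forms of visiting \<open>F\<close> infinitely often
  and of reading infinitely many letters.\<close>

definition pd_edges :: "ptrans set \<Rightarrow> nat set \<Rightarrow> nat \<Rightarrow> nat \<Rightarrow> nat \<Rightarrow> bool" where
  "pd_edges \<delta> F c c' v \<longleftrightarrow> (\<exists>t\<in>\<delta>. pd_edge t c c' v) \<and>
     ((\<exists>q\<in>F. ps_state c = q) \<or> ps_rank1 c' < ps_rank1 c) \<and>
     (ps_count c' = Suc (ps_count c) \<or> ps_rank2 c' < ps_rank2 c)"

definition pd_init :: "nat \<Rightarrow> nat \<Rightarrow> nat \<Rightarrow> bool" where
  "pd_init q0 Z0 c \<longleftrightarrow> ps_state c = q0 \<and> ps_stack c = list_encode [Z0] \<and> ps_count c = 0"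

lemma computable_foldr_lcons [computable_intros]: "computable k a \<Longrightarrow> computable k (\<lambda>xs. foldr lcons \<gamma> (a xs))"
  by (induction \<gamma>) (auto intro: computable_lcons computable_const)

lemma decidable_pd_edge: "decidable 3 (\<lambda>xs. pd_edge t (xs ! 0) (xs ! 1) (xs ! 2))"
proof -
  obtain q a Z q' \<gamma> where t: "t = (q, a, Z, q', \<gamma>)" by (metis prod.exhaust)
  show ?thesis
  proof (cases a)
    case None
    show ?thesis unfolding t pd_edge_def None prod.case option.case ps_state_def ps_stack_def ps_count_def
      by (intro computable_intros; simp)
  next
    case (Some b)
    show ?thesis unfolding t pd_edge_def Some prod.case option.case ps_state_def ps_stack_def ps_count_def
      by (intro computable_intros; simp)
  qed
qed

lemma decidable_pd_edges:
  assumes "finite \<delta>" "finite F" shows "decidable 3 (\<lambda>xs. pd_edges \<delta> F (xs ! 0) (xs ! 1) (xs ! 2))"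
  unfolding pd_edges_def ps_state_def ps_rank1_def ps_rank2_def ps_count_def
  by (intro decidable_conj decidable_disj decidable_bex assms decidable_pd_edge; intro computable_intros; simp)

lemma decidable_pd_init: "decidable 1 (\<lambda>xs. pd_init q0 Z0 (xs ! 0))"
  unfolding pd_init_def ps_state_def ps_stack_def ps_count_def by (intro computable_intros; simp)

lemma foldr_lcons: "foldr lcons \<gamma> (list_encode s) = list_encode (\<gamma> @ s)"
  by (induction \<gamma>) auto

lemma pd_edge_prefix:
  "(\<exists>m. pd_edge (q, a, Z, q', \<gamma>) c c' (list_encode (prefix_of \<sigma> m))) \<longleftrightarrow>
     ps_state c = q \<and> ps_state c' = q' \<and> ps_stack c \<noteq> 0 \<and>
     lhd (ps_stack c) = Z \<and> ps_stack c' = foldr lcons \<gamma> (ltl (ps_stack c)) \<and>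
     (case a of None \<Rightarrow> ps_count c' = ps_count c | Some b \<Rightarrow> ps_count c' = Suc (ps_count c) \<and> \<sigma> (ps_count c) = b)"
  by (cases a) (auto simp: pd_edge_def lnth intro!: exI[of _ "Suc (ps_count c)"])

lemma pd_edges_mono:
  assumes "m \<le> m'" "pd_edges \<delta> F c c' (list_encode (prefix_of \<sigma> m))"
  shows "pd_edges \<delta> F c c' (list_encode (prefix_of \<sigma> m'))"
proof -
  have "pd_edge t c c' (list_encode (prefix_of \<sigma> m'))" if "pd_edge t c c' (list_encode (prefix_of \<sigma> m))" for t
  proof -
    obtain q a Z q' \<gamma> where t: "t = (q, a, Z, q', \<gamma>)" by (metis prod.exhaust)
    show ?thesis using that assms(1) unfolding t by (cases a) (auto simp: pd_edge_def lnth)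
  qed
  then show ?thesis using assms(2) unfolding pd_edges_def by blast
qed

text \<open>A run is enriched by its letter count and two ranks. Conversely, the labels are
  recovered from the increments of the letter count, and the second rank ensures that the whole word
  is read.\<close>

lemma pd_accepts_iff:
  "buchi_accepts (pd_step \<delta>) (q0, [Z0]) (\<lambda>c. fst c \<in> F) \<sigma> \<longleftrightarrow>
    (\<exists>h. pd_init q0 Z0 (h 0) \<and> (\<forall>n::nat. \<exists>m. pd_edges \<delta> F (h n) (h (Suc n)) (list_encode (prefix_of \<sigma> m))))"
  (is "?l \<longleftrightarrow> ?r")
proof
  assume ?l
  then obtain C lab pos where C: "C 0 = (q0, [Z0])" "\<And>i. pd_step \<delta> (C i) (lab i) (C (Suc i))"
    and pos: "strict_mono pos" "\<And>k. lab (pos k) = Some (\<sigma> k)" "\<And>i. lab i \<noteq> None \<Longrightarrow> i \<in> range pos"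
    and inf: "infinite {i. fst (C i) \<in> F}"
    unfolding buchi_accepts_def by blast
  define S where "S = {i. lab i \<noteq> None}"
  have S: "S = range pos" using pos unfolding S_def by auto
  have infS: "infinite {i. lab i \<noteq> None}"
    using S pos(1) strict_mono_imp_inj_on range_inj_infinite unfolding S_def by metis
  obtain f1 :: "nat \<Rightarrow> nat" where f1: "\<And>n. fst (C n) \<in> F \<or> f1 (Suc n) < f1 n"
    using inf unfolding infinitely_often_iff_rank by blast
  obtain f2 :: "nat \<Rightarrow> nat" where f2: "\<And>n. lab n \<noteq> None \<or> f2 (Suc n) < f2 n"
    using infS unfolding infinitely_often_iff_rank by blast
  \<comment> \<open>The number of letters read before step \<open>n\<close>, hence the index in
    \<open>\<sigma>\<close> of the next letter.\<close>
  define kk where "kk n = card {l. l < n \<and> l \<in> S}" for n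
  have kkS: "kk (Suc n) = (if lab n = None then kk n else Suc (kk n))" for n
  proof -
    have "{l. l < Suc n \<and> l \<in> S} = (if lab n = None then {l. l < n \<and> l \<in> S} else insert n {l. l < n \<and> l \<in> S})"
      by (auto simp: less_Suc_eq S_def)
    then show ?thesis unfolding kk_def by simp
  qed
  have lab: "b = \<sigma> (kk n)" if "lab n = Some b" for n b
  proof -
    have "n \<in> range pos" using that pos(3) by simp
    then obtain j where j: "n = pos j" by blast
    then have "kk n = j" unfolding kk_def S using card_below_strict_mono[OF pos(1)] by simp
    then show ?thesis using pos(2)[of j] that j by simp
  qed
  define h where "h n = prod_encode (fst (C n), prod_encode (list_encode (snd (C n)),
    prod_encode (kk n, prod_encode (f1 n, f2 n))))" for n
  have h: "ps_state (h n) = fst (C n)" "ps_stack (h n) = list_encode (snd (C n))" "ps_count (h n) = kk n"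
    "ps_rank1 (h n) = f1 n" "ps_rank2 (h n) = f2 n" for n
    by (simp_all add: h_def ps_state_def ps_stack_def ps_count_def ps_rank1_def ps_rank2_def)
  have "\<exists>m. pd_edges \<delta> F (h n) (h (Suc n)) (list_encode (prefix_of \<sigma> m))" for n
  proof -
    obtain Z \<beta> \<gamma> where st: "snd (C n) = Z # \<beta>" "(fst (C n), lab n, Z, fst (C (Suc n)), \<gamma>) \<in> \<delta>"
      "snd (C (Suc n)) = \<gamma> @ \<beta>" using C(2)[of n] unfolding pd_step_def by blast
    have "\<exists>m. pd_edge (fst (C n), lab n, Z, fst (C (Suc n)), \<gamma>) (h n) (h (Suc n)) (list_encode (prefix_of \<sigma> m))"
      unfolding pd_edge_prefix h using st lab[of n] kkS[of n] by (auto simp: foldr_lcons split: option.splits)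
    moreover have "fst (C n) \<in> F \<or> f1 (Suc n) < f1 n" "kk (Suc n) = Suc (kk n) \<or> f2 (Suc n) < f2 n"
      using f1 f2[of n] kkS[of n] by auto
    ultimately show ?thesis unfolding pd_edges_def h using st(2) by blast
  qed
  moreover have "pd_init q0 Z0 (h 0)" by (simp add: pd_init_def h C kk_def)
  ultimately show ?r by blast
next
  assume ?r
  then obtain h where h0: "pd_init q0 Z0 (h 0)"
    and h: "\<And>n. \<exists>m. pd_edges \<delta> F (h n) (h (Suc n)) (list_encode (prefix_of \<sigma> m))" by blast
  define C where "C n = (ps_state (h n), list_decode (ps_stack (h n)))" for n
  define kk where "kk n = ps_count (h n)" for n
  define lab where "lab n = (if kk (Suc n) = Suc (kk n) then Some (\<sigma> (kk n)) else None)" for n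
  have step: "pd_step \<delta> (C n) (lab n) (C (Suc n)) \<and> (lab n = None \<longrightarrow> kk (Suc n) = kk n)" for n
  proof -
    obtain q a Z q' \<gamma> where t: "(q, a, Z, q', \<gamma>) \<in> \<delta>"
      and e: "\<exists>m. pd_edge (q, a, Z, q', \<gamma>) (h n) (h (Suc n)) (list_encode (prefix_of \<sigma> m))"
      using h[of n] unfolding pd_edges_def by fast
    note e = e[unfolded pd_edge_prefix]
    have a: "a = lab n" "lab n = None \<longrightarrow> kk (Suc n) = kk n" using e by (auto simp: lab_def kk_def split: option.splits)
    obtain s where s: "ps_stack (h n) = list_encode s" by (metis list_decode_inverse)
    then have "s \<noteq> []" using e by auto
    then obtain z \<beta> where "s = z # \<beta>" by (cases s) auto
    then have "ps_stack (h n) = list_encode (Z # \<beta>)" "ps_stack (h (Suc n)) = list_encode (\<gamma> @ \<beta>)"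
      using s e by (auto simp: foldr_lcons)
    then show ?thesis using t a e unfolding pd_step_def C_def by auto
  qed
  have "\<forall>n. fst (C n) \<in> F \<or> ps_rank1 (h (Suc n)) < ps_rank1 (h n)"
    using h unfolding pd_edges_def C_def by fastforce
  then have inf: "infinite {n. fst (C n) \<in> F}"
    unfolding infinitely_often_iff_rank by (intro exI[of _ "\<lambda>n. ps_rank1 (h n)"]) auto
  have "\<forall>n. lab n \<noteq> None \<or> ps_rank2 (h (Suc n)) < ps_rank2 (h n)"
    using h unfolding pd_edges_def lab_def kk_def by fastforce
  then have infS: "infinite {n. lab n \<noteq> None}"
    unfolding infinitely_often_iff_rank by (intro exI[of _ "\<lambda>n. ps_rank2 (h n)"]) auto
  define pos where "pos = enumerate {n. lab n \<noteq> None}"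
  have pos: "strict_mono pos" "range pos = {n. lab n \<noteq> None}"
    unfolding pos_def using infS by (auto simp: strict_mono_enumerate range_enumerate)
  have kk: "kk n = card {l. l < n \<and> l \<in> range pos}" for n
  proof (induction n)
    case 0
    then show ?case using h0 by (simp add: kk_def pd_init_def)
  next
    case (Suc n)
    have "{l. l < Suc n \<and> l \<in> range pos} =
        (if lab n = None then {l. l < n \<and> l \<in> range pos} else insert n {l. l < n \<and> l \<in> range pos})"
      unfolding pos(2) by (auto simp: less_Suc_eq)
    moreover have "kk (Suc n) = (if lab n = None then kk n else Suc (kk n))"
      using step[of n] by (auto simp: lab_def)
    ultimately show ?case using Suc by simp
  qed
  have "lab (pos j) = Some (\<sigma> j)" for j
  proof -
    have "pos j \<in> {n. lab n \<noteq> None}" using pos(2) by blast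
    moreover have "kk (pos j) = j" unfolding kk using card_below_strict_mono[OF pos(1)] .
    ultimately show ?thesis by (simp add: lab_def split: if_splits)
  qed
  moreover have "C 0 = (q0, [Z0])" using h0 by (simp add: C_def pd_init_def)
  ultimately show ?l unfolding buchi_accepts_def using step pos inf
    by (intro exI[of _ C] exI[of _ lab] exI[of _ pos]) auto
qed

lemma CFL_Sigma11: assumes "CFL X L" shows "Sigma11 X L"
proof -
  obtain K \<Gamma> \<delta> q0 Z0 F where pa: "pushdown_automaton K X \<Gamma> \<delta> q0 Z0 F" and L: "L = pd_lang X \<delta> q0 Z0 F"
    using assms unfolding CFL_def by blast
  have fin: "finite \<delta>" "finite F"
    using pa unfolding pushdown_automaton_def by (auto intro: finite_subset)
  show ?thesis unfolding L pd_lang_def pd_accepts_iff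
    by (rule Sigma11_sequences[OF decidable_pd_init decidable_pd_edges[OF fin] pd_edges_mono])
qed

section \<open>The machine enumerating the edges\<close>

context referee begin

text \<open>Recurrence of reading is not assumed; positions filled by no reading get an arbitrary
  letter. This avoids a circle, since recurrence is derived from the stages of a word being
  read.\<close>

lemma reads_exist: "\<exists>\<sigma>. ref_reads y \<sigma>"
proof
  define T where "T j = (SOME n. at_read (ref_run y n) \<and> ref_count y n = j)" for j
  have T: "T (ref_count y n) = n" if "at_read (ref_run y n)" for n
  proof -
    have "at_read (ref_run y (T (ref_count y n))) \<and> ref_count y (T (ref_count y n)) = ref_count y n"
      unfolding T_def by (rule someI[of _ n]) (use that in simp)
    then show ?thesis using read_unique that by metis
  qed
  show "ref_reads y (\<lambda>i. d (y (2 * T (i div 2) + i mod 2)))"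
    unfolding ref_reads_def using T by simp
qed

lemma ref_count_const:
  assumes "n \<le> n'" "\<And>l. n \<le> l \<Longrightarrow> l < n' \<Longrightarrow> \<not> at_read (ref_run y l)"
  shows "ref_count y n' = ref_count y n"
  using assms
proof (induction n' rule: dec_induct)
  case (step m)
  then show ?case by (simp add: ref_count_Suc)
qed simp

end

context reg_machine begin

text \<open>Outer induction on the blocks left in the configuration, inner induction on the ones
  owed in the current block.\<close>

lemma config_written:
  assumes "ref_run y n = (q, i, m, \<rho>)" "i < k"
  shows "\<exists>n'>n. ref_run y n' = (if q = 0 then (0, k, 0, \<rho>) else start (machine_step P (q, \<rho>))) \<and>
     (\<forall>l. n \<le> l \<and> l < n' \<longrightarrow> (\<exists>i m. i < k \<and> ref_run y l = (q, i, m, \<rho>)))"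
  using assms
proof (induction "k - i" arbitrary: i m n rule: less_induct)
  case less
  note outer = less.hyps
  from less.prems show ?case
  proof (induction m arbitrary: n)
    case 0
    have s: "ref_run y (Suc n) = advance (q, i, 0, \<rho>)" using 0 by (simp add: at_read_eq)
    show ?case
    proof (cases "Suc i < k")
      case True
      then have "ref_run y (Suc n) = (q, Suc i, \<rho> (Suc i), \<rho>)" using s by (simp add: advance_eq)
      moreover have "k - Suc i < k - i" using True by simp
      ultimately obtain n' where n': "n' > Suc n"
        "ref_run y n' = (if q = 0 then (0, k, 0, \<rho>) else start (machine_step P (q, \<rho>)))"
        "\<forall>l. Suc n \<le> l \<and> l < n' \<longrightarrow> (\<exists>i m. i < k \<and> ref_run y l = (q, i, m, \<rho>))"
        using outer[of "Suc i" "Suc n" "\<rho> (Suc i)"] True by blast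
      have "\<exists>i m. i < k \<and> ref_run y l = (q, i, m, \<rho>)" if "n \<le> l \<and> l < n'" for l
        using that n'(3) 0 by (cases "l = n") auto
      then show ?thesis using n'(1,2) by (intro exI[of _ n']) auto
    next
      case False
      then have "ref_run y (Suc n) = (if q = 0 then (0, k, 0, \<rho>) else start (machine_step P (q, \<rho>)))"
        using s by (simp add: advance_eq del: machine_step.simps)
      moreover have "\<exists>i m. i < k \<and> ref_run y l = (q, i, m, \<rho>)" if "n \<le> l \<and> l < Suc n" for l
        using that 0 by (cases "l = n") auto
      ultimately show ?thesis by (intro exI[of _ "Suc n"]) auto
    qed
  next
    case (Suc m)
    have "ref_run y (Suc n) = (q, i, m, \<rho>)" using Suc.prems by (simp add: at_read_eq advance_eq)
    from Suc.IH[OF this Suc.prems(2)] obtain n' where n': "n' > Suc n"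
        "ref_run y n' = (if q = 0 then (0, k, 0, \<rho>) else start (machine_step P (q, \<rho>)))"
        "\<forall>l. Suc n \<le> l \<and> l < n' \<longrightarrow> (\<exists>i m. i < k \<and> ref_run y l = (q, i, m, \<rho>))" by auto
    have "\<exists>i m. i < k \<and> ref_run y l = (q, i, m, \<rho>)" if "n \<le> l \<and> l < n'" for l
      using that n'(3) Suc.prems by (cases "l = n") auto
    then show ?case using n'(1,2) by (intro exI[of _ n']) auto
  qed
qed

text \<open>The referee mirrors a machine run configuration by configuration; keeping 0 out of
  \<open>D\<close> excludes readings on the way.\<close>

lemma run_written:
  assumes "machine_run P D c c'" "0 \<notin> D" "ref_run y n = start c"
  shows "\<exists>n'\<ge>n. ref_run y n' = start c' \<and>
     (\<forall>l. n \<le> l \<and> l < n' \<longrightarrow> \<not> at_read (ref_run y l) \<and> fst (ref_run y l) \<in> D)"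
  using assms(1) unfolding machine_run_def
proof (induction rule: rtranclp_induct)
  case base
  then show ?case using assms(3) by (intro exI[of _ n]) auto
next
  case (step c1 c2)
  then obtain n1 where n1: "n \<le> n1" "ref_run y n1 = start c1"
    "\<forall>l. n \<le> l \<and> l < n1 \<longrightarrow> \<not> at_read (ref_run y l) \<and> fst (ref_run y l) \<in> D" by blast
  obtain q \<rho> where c1: "c1 = (q, \<rho>)" by (cases c1)
  have q: "q \<in> D" "c2 = machine_step P (q, \<rho>)" using step.hyps by (simp_all add: c1 del: machine_step.simps)
  then have q0: "q \<noteq> 0" using assms(2) by metis
  have "ref_run y n1 = (q, 0, \<rho> 0, \<rho>)" using n1(2) by (simp add: start_def c1)
  from config_written[OF this] k obtain n2 where n2: "n2 > n1"
    "ref_run y n2 = (if q = 0 then (0, k, 0, \<rho>) else start (machine_step P (q, \<rho>)))"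
    "\<forall>l. n1 \<le> l \<and> l < n2 \<longrightarrow> (\<exists>i m. i < k \<and> ref_run y l = (q, i, m, \<rho>))" by auto
  have "\<not> at_read (ref_run y l) \<and> fst (ref_run y l) \<in> D" if "n \<le> l \<and> l < n2" for l
  proof (cases "l < n1")
    case False
    then have "n1 \<le> l \<and> l < n2" using that by simp
    then obtain i m where "i < k" "ref_run y l = (q, i, m, \<rho>)" using n2(3) by blast
    then show ?thesis using q(1) by (simp add: at_read_eq)
  qed (use n1(3) that in blast)
  moreover have "ref_run y n2 = start c2" using n2(2) q(2) q0 by (simp del: machine_step.simps)
  ultimately show ?case using n1(1) n2(1) by (intro exI[of _ n2]) auto
qed

end

text \<open>Before it returns to the reading state \<open>0\<close>, the machine passes through the output state \<open>qo\<close> at most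
  once, with an edge in registers \<open>0\<close> and \<open>1\<close>. Registers \<open>3\<close> and \<open>4\<close> hold the letters read and the time.\<close>

definition emits :: "(nat \<Rightarrow> instr) \<Rightarrow> nat \<Rightarrow> nat set \<Rightarrow> nat \<Rightarrow> regs \<Rightarrow> regs \<Rightarrow> bool" where
  "emits P qo R q \<rho> \<rho>' \<longleftrightarrow> (if edge_valid R (\<rho> 4) (\<rho>' 3)
     then \<exists>\<rho>o. machine_run P (- {0, qo}) (q, \<rho>) (qo, \<rho>o) \<and> \<rho>o 0 = edge1 (\<rho> 4) \<and> \<rho>o 1 = edge2 (\<rho> 4) \<and>
       machine_run P (- {0, qo}) (machine_step P (qo, \<rho>o)) (0, \<rho>')
     else machine_run P (- {0, qo}) (q, \<rho>) (0, \<rho>'))"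

section \<open>Stages with one reading and at most one output\<close>

locale edge_machine = reg_machine P N k qo entry d for P N k qo entry d +
  fixes X R :: "nat set"
  assumes dX: "\<And>a. d a \<in> X" and qo: "qo \<noteq> 0"
    and stage: "\<And>\<rho> a b. a \<in> X \<Longrightarrow> b \<in> X \<Longrightarrow> \<rho> 2 = 0 \<Longrightarrow>
      \<exists>\<rho>'. \<rho>' 4 = Suc (\<rho> 4) \<and> \<rho>' 3 = lcons (prod_encode (a, b)) (\<rho> 3) \<and> \<rho>' 2 = 0 \<and>
        emits P qo R (entry a b) \<rho> \<rho>'"
begin

definition stage_start :: "(nat \<Rightarrow> nat) \<Rightarrow> (nat \<Rightarrow> nat) \<Rightarrow> nat \<Rightarrow> nat \<Rightarrow> bool" where
  "stage_start y \<sigma> j n \<longleftrightarrow> ref_count y n = j \<and>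
     (\<exists>\<rho>. ref_run y n = start (0, \<rho>) \<and> \<rho> 4 = j \<and> \<rho> 3 = pair_code \<sigma> j \<and> \<rho> 2 = 0)"

definition valid :: "(nat \<Rightarrow> nat) \<Rightarrow> nat \<Rightarrow> bool" where
  "valid \<sigma> j \<longleftrightarrow> edge_valid R j (pair_code \<sigma> (Suc j))"

text \<open>The universal clause excludes spurious edges, the last clause guarantees that valid ones
  appear, and the clause on reading yields that readings recur.\<close>

definition stage_outputs :: "(nat \<Rightarrow> nat) \<Rightarrow> (nat \<Rightarrow> nat) \<Rightarrow> nat \<Rightarrow> nat \<Rightarrow> nat \<Rightarrow> bool" where
  "stage_outputs y \<sigma> j n n' \<longleftrightarrow> n < n' \<and> (\<exists>l. n \<le> l \<and> l < n' \<and> at_read (ref_run y l)) \<and>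
     (\<forall>l i m \<rho>. n \<le> l \<and> l < n' \<and> ref_run y l = (qo, i, m, \<rho>) \<longrightarrow> valid \<sigma> j \<and> \<rho> 0 = edge1 j \<and> \<rho> 1 = edge2 j) \<and>
     (valid \<sigma> j \<longrightarrow> (\<exists>l \<rho>. n \<le> l \<and> ref_run y l = start (qo, \<rho>) \<and> \<rho> 0 = edge1 j \<and> \<rho> 1 = edge2 j))"

lemma stage_start_0: "stage_start y \<sigma> 0 0"
  by (simp add: stage_start_def pair_code_0) (rule exI[of _ "\<lambda>_. 0"], simp)

text \<open>A stage writes the configuration at label 0, reads, and runs back to label 0. The runs
  in \<open>emits\<close> avoid 0 and \<open>qo\<close>, so an output configuration occurs only at
  the place named there.\<close>

lemma stage_start_Suc:
  assumes rds: "ref_reads y \<sigma>" and "stage_start y \<sigma> j n"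
  shows "\<exists>n'. stage_start y \<sigma> (Suc j) n' \<and> stage_outputs y \<sigma> j n n'"
proof -
  obtain \<rho> where n: "ref_count y n = j" "ref_run y n = start (0, \<rho>)"
    and \<rho>: "\<rho> 4 = j" "\<rho> 3 = pair_code \<sigma> j" "\<rho> 2 = 0"
    using assms(2) unfolding stage_start_def by blast
  have "ref_run y n = (0, 0, \<rho> 0, \<rho>)" using n(2) by (simp add: start_def)
  from config_written[OF this] k obtain n1 where n1: "n < n1" "ref_run y n1 = (0, k, 0, \<rho>)"
    "\<And>l. n \<le> l \<Longrightarrow> l < n1 \<Longrightarrow> \<exists>i m. i < k \<and> ref_run y l = (0, i, m, \<rho>)" by auto
  have "\<not> at_read (ref_run y l)" if "n \<le> l" "l < n1" for l using n1(3)[OF that] by (auto simp: at_read_eq)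
  then have cnt1: "ref_count y n1 = j" using ref_count_const[of n n1 y] n1(1) n(1) by simp
  have rd1: "at_read (ref_run y n1)" unfolding n1(2) by (simp add: at_read_eq)
  define a where "a = d (y (2 * n1))"
  define b where "b = d (y (2 * n1 + 1))"
  have ab: "\<sigma> (2 * j) = a" "\<sigma> (2 * j + 1) = b"
    using rds rd1 cnt1 unfolding ref_reads_def a_def b_def by auto
  have st: "ref_run y (Suc n1) = start (entry a b, \<rho>)"
    using rd1 n1(2) unfolding ref_run.simps a_def b_def by (simp add: after_read_eq)
  have cnt2: "ref_count y (Suc n1) = Suc j" using cnt1 rd1 by (simp add: ref_count_Suc)
  let ?D = "- {0, qo}"
  obtain \<rho>' where \<rho>': "\<rho>' 4 = Suc j" "\<rho>' 3 = lcons (prod_encode (a, b)) (pair_code \<sigma> j)" "\<rho>' 2 = 0"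
    and run: "emits P qo R (entry a b) \<rho> \<rho>'"
    using stage[of a b \<rho>] dX \<rho> unfolding a_def b_def by auto
  have pc: "\<rho>' 3 = pair_code \<sigma> (Suc j)" using \<rho>'(2) ab by (simp add: pair_code_Suc)
  have early: "fst (ref_run y l) = 0" if "n \<le> l" "l < Suc n1" for l
    using n1(3)[of l] n1(2) that by (cases "l = n1") auto
  show ?thesis
  proof (cases "valid \<sigma> j")
    case False
    then have "machine_run P ?D (entry a b, \<rho>) (0, \<rho>')" using run pc \<rho>(1) by (simp add: valid_def emits_def)
    from run_written[OF this _ st] obtain n2 where n2: "Suc n1 \<le> n2" "ref_run y n2 = start (0, \<rho>')"
      "\<And>l. Suc n1 \<le> l \<Longrightarrow> l < n2 \<Longrightarrow> \<not> at_read (ref_run y l) \<and> fst (ref_run y l) \<in> ?D" by auto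
    have "ref_count y n2 = Suc j" using ref_count_const[of "Suc n1" n2 y] n2 cnt2 by auto
    then have "stage_start y \<sigma> (Suc j) n2" unfolding stage_start_def using n2(2) \<rho>' pc by blast
    moreover have "fst (ref_run y l) \<noteq> qo" if "n \<le> l" "l < n2" for l
      using early[of l] n2(3)[of l] that qo by (cases "l < Suc n1") auto
    moreover have "n < n2" "n \<le> n1" "n1 < n2" using n1(1) n2(1) by auto
    ultimately show ?thesis using rd1 False unfolding stage_outputs_def by (metis fst_conv)
  next
    case True
    then obtain \<rho>o where o: "machine_run P ?D (entry a b, \<rho>) (qo, \<rho>o)" "\<rho>o 0 = edge1 j" "\<rho>o 1 = edge2 j"
      "machine_run P ?D (machine_step P (qo, \<rho>o)) (0, \<rho>')" using run pc \<rho>(1) by (auto simp: valid_def emits_def simp del: machine_step.simps)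
    from run_written[OF o(1) _ st] obtain n2 where n2: "Suc n1 \<le> n2" "ref_run y n2 = start (qo, \<rho>o)"
      "\<And>l. Suc n1 \<le> l \<Longrightarrow> l < n2 \<Longrightarrow> \<not> at_read (ref_run y l) \<and> fst (ref_run y l) \<in> ?D" by auto
    have "ref_run y n2 = (qo, 0, \<rho>o 0, \<rho>o)" using n2(2) by (simp add: start_def)
    from config_written[OF this] k obtain n3 where n3: "n2 < n3" "ref_run y n3 = start (machine_step P (qo, \<rho>o))"
      "\<And>l. n2 \<le> l \<Longrightarrow> l < n3 \<Longrightarrow> \<exists>i m. i < k \<and> ref_run y l = (qo, i, m, \<rho>o)" using qo by auto
    from run_written[OF o(4) _ n3(2)] obtain n4 where n4: "n3 \<le> n4" "ref_run y n4 = start (0, \<rho>')"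
      "\<And>l. n3 \<le> l \<Longrightarrow> l < n4 \<Longrightarrow> \<not> at_read (ref_run y l) \<and> fst (ref_run y l) \<in> ?D" by auto
    have nrd: "\<not> at_read (ref_run y l)" if "Suc n1 \<le> l" "l < n4" for l
    proof -
      consider "l < n2" | "n2 \<le> l" "l < n3" | "n3 \<le> l" by linarith
      then show ?thesis
      proof cases
        case 2
        then obtain i m where "i < k" "ref_run y l = (qo, i, m, \<rho>o)" using n3(3) by blast
        then show ?thesis by (simp add: at_read_eq)
      qed (use n2(3) n4(3) that in blast)+
    qed
    have "ref_count y n4 = ref_count y (Suc n1)"
      by (rule ref_count_const) (use nrd n2(1) n3(1) n4(1) in auto)
    then have "ref_count y n4 = Suc j" using cnt2 by simp
    then have "stage_start y \<sigma> (Suc j) n4" unfolding stage_start_def using n4(2) \<rho>' pc by blast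
    \<comment> \<open>Rounds with label \<open>qo\<close> lie between \<open>n2\<close> and
      \<open>n3\<close>, where a single configuration is being written.\<close>
    moreover have "\<rho>'' = \<rho>o" if l: "n \<le> l" "l < n4" and z: "ref_run y l = (qo, i, m, \<rho>'')" for l i m \<rho>''
    proof -
      have "\<not> l < Suc n1" using early[of l] l(1) z qo by auto
      moreover have "\<not> (Suc n1 \<le> l \<and> l < n2)" using n2(3)[of l] z by auto
      moreover have "\<not> n3 \<le> l" using n4(3)[of l] z l by auto
      ultimately show ?thesis using n3(3)[of l] z by auto
    qed
    moreover have o2: "n < n4" "n1 < n4" "n \<le> n1" "n \<le> n2" using n1(1) n2(1) n3(1) n4(1) by auto
    moreover have "\<exists>l. n \<le> l \<and> l < n4 \<and> at_read (ref_run y l)" using rd1 o2 by blast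
    moreover have "\<exists>l \<rho>. n \<le> l \<and> ref_run y l = start (qo, \<rho>) \<and> \<rho> 0 = edge1 j \<and> \<rho> 1 = edge2 j"
      using o2 n2(2) o(2,3) by blast
    ultimately show ?thesis using True o(2,3) unfolding stage_outputs_def by (intro exI[of _ n4]) blast
  qed
qed

lemma stages:
  assumes "ref_reads y \<sigma>"
  obtains T where "strict_mono T" "T 0 = 0" "\<And>j. stage_outputs y \<sigma> j (T j) (T (Suc j))"
proof -
  have "\<exists>T. \<forall>j. (stage_start y \<sigma> j (T j) \<and> (j = 0 \<longrightarrow> T j = 0)) \<and> stage_outputs y \<sigma> j (T j) (T (Suc j))"
  proof (rule dependent_nat_choice)
    show "\<exists>n. stage_start y \<sigma> 0 n \<and> (0 = (0::nat) \<longrightarrow> n = 0)" using stage_start_0 by blast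
    show "\<exists>n'. (stage_start y \<sigma> (Suc j) n' \<and> (Suc j = 0 \<longrightarrow> n' = 0)) \<and> stage_outputs y \<sigma> j n n'"
      if "stage_start y \<sigma> j n \<and> (j = 0 \<longrightarrow> n = 0)" for n j
      using stage_start_Suc[OF assms conjunct1[OF that]] by blast
  qed
  then obtain T where T: "\<And>j. (stage_start y \<sigma> j (T j) \<and> (j = 0 \<longrightarrow> T j = 0)) \<and> stage_outputs y \<sigma> j (T j) (T (Suc j))"
    by blast
  show thesis
  proof (rule that[of T])
    show "strict_mono T" using T by (simp add: strict_mono_Suc_iff stage_outputs_def)
    show "T 0 = 0" using T[of 0] by simp
  qed (use T in blast)
qed

text \<open>The round in question lies in the stage with the least end beyond it, and the number of
  that stage is the time stamp.\<close>

lemma item_iff_edge: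
  assumes "ref_reads y \<sigma>" "item y s s'"
  shows "\<exists>t. edge_valid R t (pair_code \<sigma> (Suc t)) \<and> edge1 t = s \<and> edge2 t = s'"
proof -
  obtain n i m \<rho> where n: "ref_run y n = (qo, i, m, \<rho>)" "\<rho> 0 = s" "\<rho> 1 = s'"
    using assms(2) unfolding item_def by blast
  obtain T where T: "strict_mono T" "T 0 = 0" "\<And>j. stage_outputs y \<sigma> j (T j) (T (Suc j))"
    using stages[OF assms(1)] by blast
  define j where "j = (LEAST j. n < T (Suc j))"
  have "n < T (Suc n)" using strict_mono_imp_increasing[OF T(1), of "Suc n"] by simp
  then have 1: "n < T (Suc j)" unfolding j_def by (rule LeastI)
  have "T j \<le> n"
  proof (cases j)
    case (Suc i)
    then have "\<not> n < T (Suc i)" using not_less_Least[of i "\<lambda>j. n < T (Suc j)"] unfolding j_def by auto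
    then show ?thesis using Suc by simp
  qed (simp add: T(2))
  with T(3)[of j] 1 n(1) have "valid \<sigma> j \<and> \<rho> 0 = edge1 j \<and> \<rho> 1 = edge2 j" unfolding stage_outputs_def by blast
  then show ?thesis using n unfolding valid_def by auto
qed

text \<open>Every stage contains a reading, and stage \<open>n\<close> begins no earlier than round
  \<open>n\<close>.\<close>

lemma reading: "\<exists>m\<ge>n. at_read (ref_run y m)"
proof -
  obtain \<sigma> where "ref_reads y \<sigma>" using reads_exist by blast
  then obtain T where T: "strict_mono T" "\<And>j. stage_outputs y \<sigma> j (T j) (T (Suc j))"
    using stages by blast
  from T(2)[of n] show ?thesis using strict_mono_imp_increasing[OF T(1), of n]
    unfolding stage_outputs_def by (meson order_trans)
qed

sublocale reading_referee at_read expects_one advance after_read "start (0, \<lambda>_. 0)" d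
  by unfold_locales (rule reading)

lemma accepts_iff:
  assumes L: "L = {\<sigma> \<in> omega_words X. \<exists>\<tau> :: nat \<Rightarrow> bool. \<forall>n. \<exists>m. code_triple n (prefix_of \<tau> m) (prefix_of \<sigma> m) \<in> R}"
    and ne: "\<not> ref_err y" and rds: "ref_reads y \<sigma>"
  shows "round_accepts delta init final y \<longleftrightarrow> \<sigma> \<in> L"
proof -
  have \<sigma>: "\<sigma> \<in> omega_words X"
    unfolding omega_words_def
  proof (intro CollectI allI)
    fix i
    obtain n where n: "at_read (ref_run y n)" "ref_count y n = i div 2" using read_exists by blast
    then have "\<sigma> (2 * (i div 2)) \<in> X" "\<sigma> (2 * (i div 2) + 1) \<in> X"
      using rds dX unfolding ref_reads_def by metis+
    moreover have "i = 2 * (i div 2) \<or> i = 2 * (i div 2) + 1" by arith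
    ultimately show "\<sigma> i \<in> X" by metis
  qed
  show ?thesis
  proof
    assume "round_accepts delta init final y"
    from accepts_items[OF ne this] obtain g where "g 0 = 0" "\<And>i. item y (g i) (g (Suc i))" by blast
    then show "\<sigma> \<in> L" using Sigma11_edges(1)[OF \<sigma> L] item_iff_edge[OF rds] by metis
  next
    assume "\<sigma> \<in> L"
    from Sigma11_edges(2)[OF \<sigma> L this] obtain g where g: "g 0 = 0"
      "\<And>i J. \<exists>t\<ge>J. edge_valid R t (pair_code \<sigma> (Suc t)) \<and> edge1 t = g i \<and> edge2 t = g (Suc i)" by blast
    obtain T where T: "strict_mono T" "\<And>j. stage_outputs y \<sigma> j (T j) (T (Suc j))"
      using stages[OF rds] by blast
    show "round_accepts delta init final y"
    proof (rule items_accepts[where g = g, OF ne g(1)])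
      fix i J
      obtain t where t: "J \<le> t" "valid \<sigma> t" "edge1 t = g i" "edge2 t = g (Suc i)"
        using g(2)[of J i] unfolding valid_def by blast
      \<comment> \<open>Large time stamps thus mean late rounds, which is how recurrence of edges
        reaches the play.\<close>
      moreover have "t \<le> T t" using strict_mono_imp_increasing[OF T(1)] .
      ultimately show "\<exists>n\<ge>J. \<exists>\<rho>. ref_run y n = start (qo, \<rho>) \<and> \<rho> 0 = g i \<and> \<rho> 1 = g (Suc i)"
        using T(2)[of t] t unfolding stage_outputs_def by (metis order_trans)
    qed
  qed
qed

lemma language:
  assumes L: "L = {\<sigma> \<in> omega_words X. \<exists>\<tau> :: nat \<Rightarrow> bool. \<forall>n. \<exists>m. code_triple n (prefix_of \<tau> m) (prefix_of \<sigma> m) \<in> R}"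
  shows "{y \<in> omega_words Y. round_accepts delta init final y} = ref_lang Y L"
proof -
  have "round_accepts delta init final y \<longleftrightarrow> ref_err y \<or> (\<exists>\<sigma>\<in>L. ref_reads y \<sigma>)" for y
  proof (cases "ref_err y")
    case False
    obtain \<sigma> where \<sigma>: "ref_reads y \<sigma>" using reads_exist by blast
    then show ?thesis using accepts_iff[OF L False \<sigma>] False reads_unique by blast
  qed (simp add: err_accepts)
  then show ?thesis unfolding ref_lang_def by simp
qed

end

text \<open>One stage counts the code of the two letters into register 2, pushes it onto register 3,
  clears register 2 and puts the validity of the edge into register 5. For a valid edge it loads
  registers 0 and 1 and passes through \<open>qo\<close>; in any case it advances the time in
  register 4.\<close>

lemma edge_machine_exists:
  assumes R: "recursive_set R" and X: "finite X" and dX: "\<And>a. d a \<in> X"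
  shows "\<exists>P N k qo entry. edge_machine P N k qo entry d X R"
proof -
  define M where "M = Max ((\<lambda>(a, b). prod_encode (a, b)) ` (X \<times> X))"
  have M: "prod_encode (a, b) \<le> M" if "a \<in> X" "b \<in> X" for a b
    unfolding M_def using that X by (intro Max_ge) auto
  define S0 where "S0 = (\<lambda>(e, l, t) \<rho>. \<rho> (2::nat) = (e::nat) \<and> \<rho> 3 = l \<and> \<rho> 4 = t)"
  define S1 where "S1 = (\<lambda>(e, l, t) \<rho>. \<rho> (3::nat) = lcons e l \<and> \<rho> 4 = t)"
  define S2 where "S2 = (\<lambda>(e, l, t) \<rho>. \<rho> (3::nat) = lcons e l \<and> \<rho> 4 = t \<and> \<rho> 2 = 0)"
  define S3 where "S3 = (\<lambda>(e, l, t) \<rho>. \<rho> (3::nat) = lcons e l \<and> \<rho> 4 = t \<and> \<rho> 2 = 0 \<and>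
     \<rho> 5 = of_bool (edge_valid R t (lcons e l)))"
  define T1 where "T1 = (\<lambda>(l, t) \<rho>. \<rho> (3::nat) = (l::nat) \<and> \<rho> 4 = t \<and> \<rho> 2 = (0::nat) \<and> \<rho> 0 = edge1 t)"
  define T2 where "T2 = (\<lambda>(l, t) \<rho>. \<rho> (3::nat) = (l::nat) \<and> \<rho> 4 = t \<and> \<rho> 2 = (0::nat) \<and> \<rho> 0 = edge1 t \<and> \<rho> 1 = edge2 t)"
  define T0 where "T0 = (\<lambda>(l, t) \<rho>. \<rho> (3::nat) = (l::nat) \<and> \<rho> 4 = (t::nat) \<and> \<rho> 2 = (0::nat))"
  have c: "computable 2 (\<lambda>xs. lcons (xs ! 0) (xs ! 1))" by (intro computable_intros; simp)
  have "prog S0 S1"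
    \<comment> \<open>The bound 6 protects registers 0 to 5, the interface of a stage; everything
      above is scratch space.\<close>
    by (rule prog_computable[OF c, where rs = "[2, 3]" and out = 3 and b = 6]) (auto simp: S0_def S1_def)
  moreover have "prog S1 S2"
    by (rule prog_assign[where d = 2 and f = OZ and s = 0]) (auto simp: S1_def S2_def)
  moreover have "prog S2 S3"
    by (rule prog_computable[OF decidable_edge_valid[OF R, unfolded decidable_def], where rs = "[4, 3]" and out = 5 and b = 6])
      (auto simp: S2_def S3_def)
  ultimately have p1: "prog S0 S3" by (blast intro: prog_seq)
  have "prog T0 T1"
    by (rule prog_computable[OF computable_edge(1), where rs = "[4]" and out = 0 and b = 6]) (auto simp: T0_def T1_def)
  moreover have "prog T1 T2"
    by (rule prog_computable[OF computable_edge(2), where rs = "[4]" and out = 1 and b = 6]) (auto simp: T1_def T2_def)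
  ultimately have p2: "prog T0 T2" by (rule prog_seq)
  obtain cs1 where cs1: "realizes (M + 1) cs1 S0 S3" using p1 unfolding prog_def by blast
  define m1 where "m1 = M + 1 + length cs1"
  obtain cs2 where cs2: "realizes (m1 + 1) cs2 T0 T2" using p2 unfolding prog_def by blast
  define qo where "qo = m1 + 1 + length cs2"
  \<comment> \<open>Layout: the reading label 0, a chain of \<open>M\<close> increments, the test
    program, a branch at \<open>m1\<close> on register 5, the output program, the label
    \<open>qo\<close>, which only lets its configuration be written, and \<open>qo + 1\<close>,
    which advances the time and returns to 0.\<close>
  define full where "full = [Ins 0 OI 0 0 0 0] @ map (\<lambda>i. Ins 2 OS 2 0 (i + 2) (i + 2)) [0..<M] @ cs1 @
     [Ins 0 OI 0 5 (qo + 1) (m1 + 1)] @ cs2 @ [Ins 0 OI 0 0 (qo + 1) (qo + 1), Ins 4 OS 4 0 0 0]"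
  define P where "P q = (if q < length full then full ! q else Ins 0 OI 0 0 0 0)" for q
  have "code_at P 0 full" by (simp add: code_at_def P_def)
  then have P0: "P 0 = Ins 0 OI 0 0 0 0" and chain: "code_at P 1 (map (\<lambda>i. Ins 2 OS 2 0 (i + 2) (i + 2)) [0..<M])"
    and c1: "code_at P (M + 1) cs1" and Pm1: "P m1 = Ins 0 OI 0 5 (qo + 1) (m1 + 1)"
    and c2: "code_at P (m1 + 1) cs2" and Pq: "P qo = Ins 0 OI 0 0 (qo + 1) (qo + 1)"
    and Pq1: "P (Suc qo) = Ins 4 OS 4 0 0 0"
    unfolding full_def by (simp_all add: code_at_append code_at_Cons code_at_single m1_def qo_def add.assoc add.commute)
  \<comment> \<open>Sums serve as crude upper bounds, since every label or register index that
    occurs is part of a summand; \<open>M + 2\<close> accounts for the entry labels, which are at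
    most \<open>1 + M\<close>.\<close>
  define N where "N = M + 2 + sum_list (map (\<lambda>i. if_zero i + if_nonzero i) full)"
  define k where "k = 3 + sum_list (map (\<lambda>i. dest i + src i + test i) full)"
  have "Ins 0 OI 0 0 0 0 \<in> set full" by (simp add: full_def)
  then have mem: "P q \<in> set full" for q by (cases "q < length full") (simp_all add: P_def)
  have regs: "dest (P q) < k \<and> src (P q) < k \<and> test (P q) < k" for q
  proof -
    have "dest (P q) + src (P q) + test (P q) \<le> sum_list (map (\<lambda>i. dest i + src i + test i) full)"
      by (rule member_le_sum_list) (simp_all add: mem)
    then show ?thesis unfolding k_def by linarith
  qed
  have labels: "if_zero (P q) < N \<and> if_nonzero (P q) < N" for q
  proof -
    have "if_zero (P q) + if_nonzero (P q) \<le> sum_list (map (\<lambda>i. if_zero i + if_nonzero i) full)"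
      by (rule member_le_sum_list) (simp_all add: mem)
    then show ?thesis unfolding N_def by linarith
  qed
  \<comment> \<open>Reading is a jump, but the program needs the letters as a number. Entering the
    chain of increments of register 2 at \<open>1 + M - e\<close> leaves exactly \<open>e\<close> of
    them to perform, so register 2 grows from 0 to the pair code \<open>e\<close>.\<close>
  define entry where "entry a b = 1 + M - prod_encode (a, b)" for a b
  let ?D = "- {0, qo}"
  have id: "\<rho>(0 := \<rho> 0) = \<rho>" for \<rho> :: regs by simp
  have qo: "m1 < qo" "M < m1" by (simp_all add: qo_def m1_def)
  have ch: "machine_run P ?D (1 + M - i, \<rho>) (M + 1, \<rho>(2 := \<rho> 2 + i))" if "i \<le> M" for i \<rho>
    using that
  proof (induction i arbitrary: \<rho>)
    case 0
    then show ?case by (simp add: machine_run_refl)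
  next
    case (Suc i)
    have "P (M - i) = Ins 2 OS 2 0 (1 + M - i) (1 + M - i)"
      using chain[unfolded code_at_def, rule_format, of "M - Suc i"] Suc.prems by (simp add: Suc_diff_Suc Suc_diff_le)
    then have st: "machine_step P (1 + M - Suc i, \<rho>) = (1 + M - i, \<rho>(2 := Suc (\<rho> 2)))" by simp
    have "(\<rho>(2 := Suc (\<rho> 2)))(2 := (\<rho>(2 := Suc (\<rho> 2))) 2 + i) = \<rho>(2 := \<rho> 2 + Suc i)"
      by (rule ext) simp
    with Suc.IH[of "\<rho>(2 := Suc (\<rho> 2))"] Suc.prems
    have rest: "machine_run P ?D (1 + M - i, \<rho>(2 := Suc (\<rho> 2))) (M + 1, \<rho>(2 := \<rho> 2 + Suc i))" by (metis Suc_leD)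
    have D: "fst (1 + M - Suc i, \<rho>) \<in> ?D" using Suc.prems qo by auto
    show ?case by (rule machine_run_step[OF D]) (unfold st, rule rest)
  qed
  have "edge_machine P N k qo entry d X R"
  proof
    show "2 < k" "0 < N" "qo \<noteq> 0" "P 0 = Ins 0 OI 0 0 0 0" using P0 by (simp_all add: k_def N_def qo_def)
    show "entry (d a) (d b) < N" for a b by (simp add: entry_def N_def)
    fix \<rho> :: regs and a b assume ab: "a \<in> X" "b \<in> X" and \<rho>2: "\<rho> 2 = 0"
    let ?e = "prod_encode (a, b)"
    have "machine_run P ?D (entry a b, \<rho>) (M + 1, \<rho>(2 := ?e))"
      using ch[OF M[OF ab], of \<rho>] \<rho>2 by (simp add: entry_def)
    moreover have "S0 (?e, \<rho> 3, \<rho> 4) (\<rho>(2 := ?e))" by (simp add: S0_def)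
    then obtain \<rho>1 where
      r1: "machine_run P {M + 1..<m1} (M + 1, \<rho>(2 := ?e)) (m1, \<rho>1)" "S3 (?e, \<rho> 3, \<rho> 4) \<rho>1"
      by (rule realizesD[OF cs1 c1, folded m1_def])
    have "machine_run P ?D (M + 1, \<rho>(2 := ?e)) (m1, \<rho>1)"
      by (rule machine_run_mono[OF r1(1)]) (use qo in auto)
    ultimately have a1: "machine_run P ?D (entry a b, \<rho>) (m1, \<rho>1)" by (rule machine_run_trans)
    have S3: "\<rho>1 3 = lcons ?e (\<rho> 3)" "\<rho>1 4 = \<rho> 4" "\<rho>1 2 = 0" "\<rho>1 5 = of_bool (edge_valid R (\<rho> 4) (lcons ?e (\<rho> 3)))"
      using r1(2) by (simp_all add: S3_def)
    have a3: "machine_run P ?D (Suc qo, \<rho>') (0, \<rho>'(4 := Suc (\<rho>' 4)))" for \<rho>'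
      by (rule machine_run_step) (simp_all add: Pq1 machine_run_refl)
    let ?l = "lcons ?e (\<rho> 3)"
    show "\<exists>\<rho>'. \<rho>' 4 = Suc (\<rho> 4) \<and> \<rho>' 3 = ?l \<and> \<rho>' 2 = 0 \<and> emits P qo R (entry a b) \<rho> \<rho>'"
    proof (cases "edge_valid R (\<rho> 4) ?l")
      case True
      have "T0 (?l, \<rho> 4) \<rho>1" using S3 by (simp add: T0_def)
      then obtain \<rho>2 where
        r2: "machine_run P {m1 + 1..<qo} (m1 + 1, \<rho>1) (qo, \<rho>2)" "T2 (?l, \<rho> 4) \<rho>2"
        by (rule realizesD[OF cs2 c2, folded qo_def])
      have "machine_run P ?D (m1 + 1, \<rho>1) (qo, \<rho>2)" by (rule machine_run_mono[OF r2(1)]) auto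
      then have "machine_run P ?D (m1, \<rho>1) (qo, \<rho>2)"
        by - (rule machine_run_step, use S3 True qo in \<open>simp_all add: Pm1\<close>)
      then have "machine_run P ?D (entry a b, \<rho>) (qo, \<rho>2)" using machine_run_trans[OF a1] by blast
      moreover have "machine_step P (qo, \<rho>2) = (Suc qo, \<rho>2)" by (simp add: Pq)
      ultimately show ?thesis using a3[of \<rho>2] True r2(2)
        by (intro exI[of _ "\<rho>2(4 := Suc (\<rho>2 4))"]) (auto simp: T2_def emits_def simp del: machine_step.simps)
    next
      case False
      have "machine_run P ?D (m1, \<rho>1) (0, \<rho>1(4 := Suc (\<rho>1 4)))"
        by (rule machine_run_step) (use S3 False qo a3[of \<rho>1] in \<open>simp_all add: Pm1\<close>)
      then have "machine_run P ?D (entry a b, \<rho>) (0, \<rho>1(4 := Suc (\<rho>1 4)))" using machine_run_trans[OF a1] by blast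
      then show ?thesis using False S3 by (intro exI[of _ "\<rho>1(4 := Suc (\<rho>1 4))"]) (auto simp: emits_def)
    qed
  qed (use regs labels dX in auto)
  then show ?thesis by blast
qed

lemma Det_BCL_Sigma11:
  assumes det: "Det (BCL 1)" shows "Det Sigma11"
  unfolding Det_def
proof (intro allI impI)
  fix X A assume *: "alphabet X \<and> A \<subseteq> omega_words X \<and> Sigma11 X A"
  then have X: "finite X" "X \<noteq> {}" and S: "Sigma11 X A"
    by (simp_all add: alphabet_def)
  obtain R where R: "recursive_set R"
    and AR: "A = {\<sigma> \<in> omega_words X. \<exists>\<tau> :: nat \<Rightarrow> bool. \<forall>n. \<exists>m. code_triple n (prefix_of \<tau> m) (prefix_of \<sigma> m) \<in> R}"
    using S unfolding Sigma11_def by (elim exE conjE)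
  obtain x0 where x0: "x0 \<in> X" using X by blast
  \<comment> \<open>Letters outside \<open>X\<close> are read as \<open>x0\<close>, so that a
    reading round admits no illegal move.\<close>
  define d where "d a = (if a \<in> X then a else x0)" for a
  define Y where "Y = X \<union> {0, 1}"
  have dX: "d a \<in> X" for a using x0 by (simp add: d_def)
  obtain P N k qo entry where M: "edge_machine P N k qo entry d X R"
    using edge_machine_exists[where d = d, OF R X(1) dX] by blast
  interpret edge_machine P N k qo entry d X R
    by (rule M)
  have "BCL 1 Y (ref_lang Y A)"
    using lang_BCL[of Y] X(1) unfolding language[OF AR] by (simp add: Y_def)
  moreover have "ref_lang Y A \<subseteq> omega_words Y" by (auto simp: ref_lang_def)
  moreover have "alphabet Y" using X by (simp add: alphabet_def Y_def)
  ultimately have "determined Y (ref_lang Y A)"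
    using det[unfolded Det_def, rule_format, of Y "ref_lang Y A"] by simp
  moreover have "X \<subseteq> Y" "0 \<in> Y" "1 \<in> Y" by (auto simp: Y_def)
  moreover have "d a = a" if "a \<in> X" for a using that by (simp add: d_def)
  ultimately show "determined X A"
    using x0 dX by - (rule determined_transfer[where ?x0.0 = x0 and X' = Y], simp_all)
qed

theorem theorem3p3:
  shows "(Det Sigma11 \<longleftrightarrow> Det CFL) \<and> (Det CFL \<longleftrightarrow> Det (BCL 1))"
proof -
  have "Det Sigma11 \<Longrightarrow> Det CFL" unfolding Det_def using CFL_Sigma11 by blast
  moreover have "Det CFL \<Longrightarrow> Det (BCL 1)" unfolding Det_def using BCL_1_CFL by blast
  ultimately show ?thesis using Det_BCL_Sigma11 by blast
qed

end
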